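(* Let $1\leq p,p_1,p_2,q<\infty$ and $-1/p_1\leq\lambda<0$. Suppose that $w\in A_q(\mathbb{H}^n)$, with critical index $r_w$ for the reverse Hölder condition. If $1/p>(1/p_1+1/p_2)\,q\,r_w/(r_w-1)$ and $q\leq p_2$, then for any $1<\delta<r_w$ there is a constant $C>0$, independent of $f$, $b$, $\Phi$ and $A$, such that $$\Vert \mathcal{H}_{\Phi,A}^{b}f\Vert_{\dot{L}^{p,\lambda}(\mathbb{H}^n;w)}\leq C\,C_2\,\Vert f\Vert_{\dot{L}^{p_1,\lambda}(\mathbb{H}^n;w)}\Vert b\Vert_{CMO^{p_2}(\mathbb{H}^n;w)},$$ where $$\begin{aligned}C_2={}&\int_{\Vert A(y)\Vert>1}\frac{|\Phi(y)|}{|y|_h^{Q}}\left(\frac{\Vert A(y)\Vert^{Q}}{|\det A(y)|}\right)^{q/p_1}\Vert A(y)\Vert^{Q\lambda(\delta-1)/\delta}\max\left\{\frac{\Vert A(y)\Vert^{Q}}{|\det A(y)|},\ \log_2\Vert A(y)\Vert\right\}dy\\&+\int_{\Vert A(y)\Vert\leq1}\frac{|\Phi(y)|}{|y|_h^{Q}}\left(\frac{\Vert A(y)\Vert^{Q}}{|\det A(y)|}\right)^{q/p_1}\Vert A(y)\Vert^{Q\lambda q}\max\left\{\frac{\Vert A(y)\Vert^{Q}}{|\det A(y)|},\ \log_2\frac{1}{\Vert A(y)\Vert}\right\}dy.\end{aligned}$$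
   Context: The Heisenberg group $\mathbb{H}^n$ is $\mathbf{R}^{2n}\times\mathbf{R}$ with group law $x\cdot y=\big(x_1+y_1,\dots,x_{2n}+y_{2n},\,x_{2n+1}+y_{2n+1}+2\sum_{j=1}^n(y_jx_{n+j}-x_jy_{n+j})\big)$; the inverse of $x$ is $-x$; Haar measure is Lebesgue measure $dx$, and $|E|$ is the measure of $E$. $Q=2n+2$ is the homogeneous dimension. The norm is $|x|_h=\big[(\sum_{i=1}^{2n}x_i^2)^2+x_{2n+1}^2\big]^{1/4}$, the distance is $d(p,q)=|q^{-1}p|_h$, and $B(x,r)=\{y: d(x,y)<r\}$. For a $(2n+1)\times(2n+1)$ real matrix $M$ (acting on $\mathbf{R}^{2n+1}$), $\Vert M\Vert=\sup_{x\in\mathbb{H}^n,\,x\neq0}|Mx|_h/|x|_h$. $\Phi$ is a locally integrable function on $\mathbb{H}^n$, and $A(y)$ is a function on $\mathbb{H}^n$ with values in $(2n+1)\times(2n+1)$ matrices with $\det A(y)\neq0$ for almost every $y$ in the support of $\Phi$. The Hausdorff operator is $\mathcal{H}_{\Phi,A}f(x)=\int_{\mathbb{H}^n}\frac{\Phi(y)}{|y|_h^Q}f(A(y)x)\,dy$. For a locally integrable function $b$ on $\mathbb{H}^n$, its commutator is $\mathcal{H}^b_{\Phi,A}f=b\,\mathcal{H}_{\Phi,A}f-\mathcal{H}_{\Phi,A}(bf)$, i.e. $\mathcal{H}^b_{\Phi,A}f(x)=\int_{\mathbb{H}^n}\frac{\Phi(y)}{|y|_h^Q}f(A(y)x)\,[b(x)-b(A(y)x)]\,dy$.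 A weight $w$ is a nonnegative locally integrable function on $\mathbb{H}^n$; $w(E)=\int_E w(x)\,dx$. For $1<p<\infty$, $w\in A_p(\mathbb{H}^n)$ if there is $C$ with $\left(\frac1{|B|}\int_Bw\,dx\right)\left(\frac1{|B|}\int_Bw^{-1/(p-1)}dx\right)^{p-1}\leq C$ for all balls $B$; $w\in A_1(\mathbb{H}^n)$ if there is $C$ with $\frac1{|B|}\int_Bw\,dx\leq C\,\mathrm{ess\,inf}_{x\in B}w(x)$ for all balls $B$. For $r>1$, $w\in RH_r(\mathbb{H}^n)$ if there is $C$ with $\left(\frac1{|B|}\int_Bw^r\,dx\right)^{1/r}\leq\frac{C}{|B|}\int_Bw\,dx$ for all balls $B$. The critical index for the reverse Hölder condition is $r_w=\sup\{r>1: w\in RH_r(\mathbb{H}^n)\}$ (when $r_w=\infty$, $r_w/(r_w-1)$ is read as $1$). For $1\leq p<\infty$ and $-1/p\leq\lambda<0$, the weighted central Morrey space $\dot{L}^{p,\lambda}(\mathbb{H}^n;w)$ consists of $f\in L^p_{loc}(\mathbb{H}^n;w)$ with $\Vert f\Vert_{\dot{L}^{p,\lambda}(\mathbb{H}^n;w)}=\sup_{r>0}\left(\frac{1}{w(B(0,r))^{1+p\lambda}}\int_{B(0,r)}|f(x)|^pw(x)\,dx\right)^{1/p}<\infty$. For $1\leq p<\infty$, the weighted central BMO space $CMO^p(\mathbb{H}^n;w)$ consists of $f\in L^p_{loc}(\mathbb{H}^n;w)$ with $\Vert f\Vert_{CMO^p(\mathbb{H}^n;w)}=\sup_{r>0}\left(\frac1{w(B(0,r))}\int_{B(0,r)}|f(x)-f_{B(0,r)}|^pw(x)\,dx\right)^{1/p}<\infty$,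 where $f_{B(0,r)}=\frac1{|B(0,r)|}\int_{B(0,r)}f(x)\,dx$. *)

theory Defs
  imports "HOL-Analysis.Analysis"
begin

section \<open>The Heisenberg group\<close>

text \<open>
  A point of the group over \<open>'n\<close>, with \<open>n = CARD('n)\<close>, is a vector of length \<open>2n + 1\<close>:
  the index \<open>Some (Inl j)\<close> is the coordinate \<open>j\<close>, \<open>Some (Inr j)\<close> the coordinate \<open>n + j\<close>,
  and \<open>None\<close> the central coordinate \<open>2n + 1\<close>.
\<close>

type_synonym 'n heis_index = "('n + 'n) option"
type_synonym 'n heis = "real ^ 'n heis_index"
type_synonym 'n heis_matrix = "real ^ 'n heis_index ^ 'n heis_index"

definition heis_mult :: "'n::finite heis \<Rightarrow> 'n heis \<Rightarrow> 'n heis" where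
  "heis_mult x y = (\<chi> i. case i of
       Some k \<Rightarrow> x $ Some k + y $ Some k
     | None \<Rightarrow> x $ None + y $ None
         + 2 * (\<Sum>j\<in>UNIV. y $ Some (Inl j) * x $ Some (Inr j) - x $ Some (Inl j) * y $ Some (Inr j)))"

definition heis_norm :: "'n::finite heis \<Rightarrow> real" where
  "heis_norm x = root 4 ((\<Sum>k\<in>UNIV. (x $ Some k)\<^sup>2)\<^sup>2 + (x $ None)\<^sup>2)"

text \<open>The inverse of \<open>q\<close> in the group is \<open>- q\<close>.\<close>

definition heis_dist :: "'n::finite heis \<Rightarrow> 'n heis \<Rightarrow> real" where
  "heis_dist p q = heis_norm (heis_mult (- q) p)"

definition heis_ball :: "'n::finite heis \<Rightarrow> real \<Rightarrow> 'n heis set" where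
  "heis_ball x r = {y. heis_dist x y < r}"

definition heis_dim :: "'n::finite itself \<Rightarrow> nat" where
  "heis_dim _ = 2 * CARD('n) + 2"

text \<open>
  The supremum is infinite for every matrix that mixes the central coordinate with the other
  ones, so it has to be taken in the extended half-line.
\<close>

definition heis_matrix_norm :: "'n::finite heis_matrix \<Rightarrow> ennreal" where
  "heis_matrix_norm M = (SUP x\<in>-{0}. ennreal (heis_norm (M *v x) / heis_norm x))"


section \<open>Extended powers, local integrability, averages\<close>

text \<open>
  Real powers on the extended half-line, with \<open>0\<close> to a negative power equal to \<open>\<infinity>\<close>
  (unlike \<^const>\<open>powr\<close>) and every zeroth power equal to \<open>1\<close>.
\<close>

definition epow :: "ennreal \<Rightarrow> real \<Rightarrow> ennreal" where
  "epow x a =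
     (if a = 0 then 1
      else if x = \<infinity> then (if a > 0 then \<infinity> else 0)
      else if x = 0 then (if a > 0 then 0 else \<infinity>)
      else ennreal (enn2real x powr a))"

definition locally_integrable ::
    "('a::euclidean_space \<Rightarrow> 'b::euclidean_space) \<Rightarrow> bool" where
  "locally_integrable f \<longleftrightarrow> (\<forall>K. compact K \<longrightarrow> f absolutely_integrable_on K)"

definition ess_inf_on :: "'a::euclidean_space set \<Rightarrow> ('a \<Rightarrow> ennreal) \<Rightarrow> ennreal" where
  "ess_inf_on B g = Sup {c. AE x in lebesgue. x \<in> B \<longrightarrow> c \<le> g x}"

definition mean_on :: "'a::euclidean_space set \<Rightarrow> ('a \<Rightarrow> ennreal) \<Rightarrow> ennreal" where
  "mean_on B g = (\<integral>\<^sup>+x\<in>B. g x \<partial>lebesgue) / emeasure lebesgue B"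

definition cmean_on :: "'a::euclidean_space set \<Rightarrow> ('a \<Rightarrow> complex) \<Rightarrow> complex" where
  "cmean_on B f = (LINT x:B|lebesgue. f x) / of_real (measure lebesgue B)"


section \<open>Weights\<close>

text \<open>
  A weight that vanishes almost everywhere is excluded: the norms below divide by the
  weighted measure of balls.
\<close>

definition weight :: "('n::finite heis \<Rightarrow> real) \<Rightarrow> bool" where
  "weight w \<longleftrightarrow> (\<forall>x. 0 \<le> w x) \<and> locally_integrable w \<and> \<not> (AE x in lebesgue. w x = 0)"

definition wmeasure :: "('n::finite heis \<Rightarrow> real) \<Rightarrow> 'n heis set \<Rightarrow> ennreal" where
  "wmeasure w E = (\<integral>\<^sup>+x\<in>E. ennreal (w x) \<partial>lebesgue)"

definition muckenhoupt :: "real \<Rightarrow> ('n::finite heis \<Rightarrow> real) \<Rightarrow> bool" where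
  "muckenhoupt p w \<longleftrightarrow> weight w \<and>
     (if p = 1
      then \<exists>C::real. \<forall>x. \<forall>r>0.
        mean_on (heis_ball x r) (\<lambda>y. ennreal (w y))
          \<le> ennreal C * ess_inf_on (heis_ball x r) (\<lambda>y. ennreal (w y))
      else \<exists>C::real. \<forall>x. \<forall>r>0.
        mean_on (heis_ball x r) (\<lambda>y. ennreal (w y))
          * epow (mean_on (heis_ball x r) (\<lambda>y. epow (ennreal (w y)) (- 1 / (p - 1)))) (p - 1)
          \<le> ennreal C)"

definition reverse_hoelder :: "real \<Rightarrow> ('n::finite heis \<Rightarrow> real) \<Rightarrow> bool" where
  "reverse_hoelder r w \<longleftrightarrow> weight w \<and>
     (\<exists>C::real. \<forall>x. \<forall>s>0.
        epow (mean_on (heis_ball x s) (\<lambda>y. epow (ennreal (w y)) r)) (1 / r)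
          \<le> ennreal C * mean_on (heis_ball x s) (\<lambda>y. ennreal (w y)))"

definition rh_index :: "('n::finite heis \<Rightarrow> real) \<Rightarrow> ereal" where
  "rh_index w = Sup {ereal r |r. 1 < r \<and> reverse_hoelder r w}"

text \<open>The number \<open>r / (r - 1)\<close>, read as \<open>1\<close> for \<open>r = \<infinity>\<close>.\<close>

definition conj_exponent :: "ereal \<Rightarrow> real" where
  "conj_exponent r = (if r = \<infinity> then 1 else real_of_ereal r / (real_of_ereal r - 1))"


section \<open>Central Morrey and central BMO spaces\<close>

definition Lp_loc :: "real \<Rightarrow> ('n::finite heis \<Rightarrow> real) \<Rightarrow> ('n heis \<Rightarrow> complex) set" where
  "Lp_loc p w = {f. f \<in> borel_measurable lebesgue \<and>
     (\<forall>K. compact K \<longrightarrow> (\<integral>\<^sup>+x\<in>K. ennreal (norm (f x) powr p * w x) \<partial>lebesgue) < \<infinity>)}"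

definition morrey_norm ::
    "real \<Rightarrow> real \<Rightarrow> ('n::finite heis \<Rightarrow> real) \<Rightarrow> ('n heis \<Rightarrow> complex) \<Rightarrow> ennreal" where
  "morrey_norm p lam w f = (SUP r\<in>{0<..}.
     epow ((\<integral>\<^sup>+x\<in>heis_ball 0 r. ennreal (norm (f x) powr p * w x) \<partial>lebesgue)
             / epow (wmeasure w (heis_ball 0 r)) (1 + p * lam)) (1 / p))"

definition central_morrey ::
    "real \<Rightarrow> real \<Rightarrow> ('n::finite heis \<Rightarrow> real) \<Rightarrow> ('n heis \<Rightarrow> complex) set" where
  "central_morrey p lam w = {f \<in> Lp_loc p w. morrey_norm p lam w f < \<infinity>}"

definition cmo_norm ::
    "real \<Rightarrow> ('n::finite heis \<Rightarrow> real) \<Rightarrow> ('n heis \<Rightarrow> complex) \<Rightarrow> ennreal" where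
  "cmo_norm p w f = (SUP r\<in>{0<..}.
     epow ((\<integral>\<^sup>+x\<in>heis_ball 0 r.
               ennreal (norm (f x - cmean_on (heis_ball 0 r) f) powr p * w x) \<partial>lebesgue)
             / wmeasure w (heis_ball 0 r)) (1 / p))"

definition central_bmo ::
    "real \<Rightarrow> ('n::finite heis \<Rightarrow> real) \<Rightarrow> ('n heis \<Rightarrow> complex) set" where
  "central_bmo p w = {f \<in> Lp_loc p w. cmo_norm p w f < \<infinity>}"


section \<open>The Hausdorff operator and its commutator\<close>

definition hausdorff_integrand ::
    "('n::finite heis \<Rightarrow> complex) \<Rightarrow> ('n heis \<Rightarrow> 'n heis_matrix) \<Rightarrow> ('n heis \<Rightarrow> complex)
      \<Rightarrow> 'n heis \<Rightarrow> 'n heis \<Rightarrow> complex" where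
  "hausdorff_integrand \<Phi> A f x y =
     \<Phi> y / of_real (heis_norm y ^ heis_dim TYPE('n)) * f (A y *v x)"

definition hausdorff_op ::
    "('n::finite heis \<Rightarrow> complex) \<Rightarrow> ('n heis \<Rightarrow> 'n heis_matrix) \<Rightarrow> ('n heis \<Rightarrow> complex)
      \<Rightarrow> 'n heis \<Rightarrow> complex" where
  "hausdorff_op \<Phi> A f x = (LINT y|lebesgue. hausdorff_integrand \<Phi> A f x y)"

definition hausdorff_defined_at ::
    "('n::finite heis \<Rightarrow> complex) \<Rightarrow> ('n heis \<Rightarrow> 'n heis_matrix) \<Rightarrow> ('n heis \<Rightarrow> complex)
      \<Rightarrow> 'n heis \<Rightarrow> bool" where
  "hausdorff_defined_at \<Phi> A f x \<longleftrightarrow> integrable lebesgue (hausdorff_integrand \<Phi> A f x)"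

definition hausdorff_commutator ::
    "('n::finite heis \<Rightarrow> complex) \<Rightarrow> ('n heis \<Rightarrow> complex) \<Rightarrow> ('n heis \<Rightarrow> 'n heis_matrix)
      \<Rightarrow> ('n heis \<Rightarrow> complex) \<Rightarrow> 'n heis \<Rightarrow> complex" where
  "hausdorff_commutator b \<Phi> A f x =
     b x * hausdorff_op \<Phi> A f x - hausdorff_op \<Phi> A (\<lambda>z. b z * f z) x"

lemma hausdorff_commutator_eq_integral:
  assumes "hausdorff_defined_at \<Phi> A f x" "hausdorff_defined_at \<Phi> A (\<lambda>z. b z * f z) x"
  shows "hausdorff_commutator b \<Phi> A f x =
    (LINT y|lebesgue. hausdorff_integrand \<Phi> A f x y * (b x - b (A y *v x)))"
proof -
  have "hausdorff_commutator b \<Phi> A f x =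
      (LINT y|lebesgue. b x * hausdorff_integrand \<Phi> A f x y
         - hausdorff_integrand \<Phi> A (\<lambda>z. b z * f z) x y)"
    using assms unfolding hausdorff_commutator_def hausdorff_op_def hausdorff_defined_at_def
    by (subst Bochner_Integration.integral_diff) auto
  also have "\<dots> = (LINT y|lebesgue. hausdorff_integrand \<Phi> A f x y * (b x - b (A y *v x)))"
    by (simp add: hausdorff_integrand_def algebra_simps diff_divide_distrib)
  finally show ?thesis .
qed

text \<open>
  The factor of the two integrands that depends on \<open>A(y)\<close>, with \<open>N\<close> the norm of the matrix, \<open>d\<close>
  the absolute value of its determinant, \<open>e\<close> the exponent of the middle power and \<open>l\<close> the
  logarithm. For \<open>N = \<infinity>\<close> the product of the three factors would read \<open>\<infinity> * 0 * \<infinity>\<close>; the value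
  \<open>\<infinity>\<close> is its limit as \<open>N \<rightarrow> \<infinity>\<close> with \<open>d\<close> fixed (in the first integral of \<open>commutator_const\<close>
  the total power of \<open>N\<close> is \<open>Q * (q / p1 + lam * (delta - 1) / delta + 1)\<close>, which is positive
  because \<open>- 1 / p1 \<le> lam < 0\<close>, \<open>1 \<le> q\<close> and \<open>1 < delta\<close>).
\<close>

definition commutator_kernel ::
    "nat \<Rightarrow> ennreal \<Rightarrow> real \<Rightarrow> real \<Rightarrow> real \<Rightarrow> (real \<Rightarrow> real) \<Rightarrow> ennreal" where
  "commutator_kernel Q N d s e l =
     (if N = \<infinity> then \<infinity>
      else let t = enn2real N in
        ennreal ((t ^ Q / d) powr s * t powr e * max (t ^ Q / d) (l t)))"

definition commutator_const ::
    "real \<Rightarrow> real \<Rightarrow> real \<Rightarrow> real \<Rightarrow> ('n::finite heis \<Rightarrow> complex) \<Rightarrow> ('n heis \<Rightarrow> 'n heis_matrix)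
      \<Rightarrow> ennreal" where
  "commutator_const p1 q lam delta \<Phi> A =
     (let Q = heis_dim TYPE('n) in
       (\<integral>\<^sup>+y\<in>{y. heis_matrix_norm (A y) > 1}.
          ennreal (norm (\<Phi> y) / heis_norm y ^ Q)
          * commutator_kernel Q (heis_matrix_norm (A y)) \<bar>det (A y)\<bar> (q / p1)
              (real Q * lam * (delta - 1) / delta) (\<lambda>t. log 2 t) \<partial>lebesgue)
     + (\<integral>\<^sup>+y\<in>{y. heis_matrix_norm (A y) \<le> 1}.
          ennreal (norm (\<Phi> y) / heis_norm y ^ Q)
          * commutator_kernel Q (heis_matrix_norm (A y)) \<bar>det (A y)\<bar> (q / p1)
              (real Q * lam * q) (\<lambda>t. log 2 (1 / t)) \<partial>lebesgue))"

end

theory Submission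
  imports Defs
begin

text \<open>
  The commutator is the integral over \<open>y\<close> of \<open>\<Phi>(y) / |y|\<^sup>Q\<close> times the
  function \<open>x \<mapsto> f (A(y) x) (b x - b (A(y) x))\<close>. By Minkowski's integral inequality
  (\<open>Lp_bound_integral_Minkowski\<close>) it suffices to estimate this function for a single matrix
  \<open>A = A(y)\<close> in \<open>L\<^sup>p\<close> of each centred ball \<open>B = B(0,r)\<close>,
  carrying the probability measure \<open>w dx / w(B)\<close>; up to the norms of \<open>f\<close> and
  \<open>b\<close>, the bound has to be the integrand of the constant times \<open>w(B)\<close> to the power
  \<open>\<lambda>\<close>. This is \<open>substituted_Lp_bounds\<close>. Below, \<open>N\<close> is the
  norm of \<open>A\<close>, \<open>NB\<close> is \<open>B(0,Nr)\<close>, and \<open>R = N\<^sup>Q / |det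
  A|\<close>; since \<open>A\<close> maps \<open>B\<close> into \<open>NB\<close>, comparing volumes gives
  \<open>R \<ge> 1\<close>.

  A linear substitution respects Lebesgue measure but not \<open>w\<close>, so the weight is traded for
  Lebesgue measure and back. Hoelder's inequality turns the \<open>A_q\<close> condition into a bound of the
  Lebesgue mean of \<open>|g|\<close> by the \<open>q\<close>-th power mean for \<open>w\<close>
  (\<open>muckenhoupt_Lp_bound\<close>), and the reverse Hoelder condition with exponent \<open>s\<close>
  into a bound of the \<open>w\<close>-mean of \<open>|g|\<close> by the \<open>s'\<close>-th power mean for
  Lebesgue measure, \<open>s' = s / (s - 1)\<close> (\<open>reverse_hoelder_Lp_bound\<close>). Between the
  two, the change of variables costs a factor \<open>R\<close>. Altogether the \<open>L\<^sup>P\<close> mean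
  of \<open>g\<close> over \<open>NB\<close> controls the mean of \<open>x \<mapsto> g (A x)\<close> over
  \<open>B\<close> with exponent \<open>P / (q s')\<close>, at the cost of \<open>R\<close> to the power
  \<open>q / P\<close> (\<open>Lp_bound_matrix_substitution\<close>). Tested on indicators of balls, the
  same two comparisons bound \<open>w(B) / w(NB)\<close> by powers of \<open>|B| / |NB|\<close>; this
  converts \<open>w(NB)\<close> to the power \<open>\<lambda>\<close>, which the Morrey norm of
  \<open>f\<close> produces, into \<open>w(B)\<close> to the power \<open>\<lambda>\<close> and yields the
  powers of \<open>N\<close> in the constant (\<open>wvol_powr_le\<close>).

  The factor \<open>b x - b (A x)\<close> is split by inserting the means of \<open>b\<close> over
  \<open>B\<close> and \<open>NB\<close>. The first piece is bounded by the CMO norm of \<open>b\<close>.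
  The two means differ by at most a multiple of \<open>1 + |log\<^sub>2 N|\<close> times that norm, along a
  chain of balls with doubling radii (\<open>cmean_on_difference_log\<close>). The last piece is again a
  substitution, with cost \<open>R\<close> to the power \<open>q / p\<^sub>2\<close>, which is at most
  \<open>R\<close> because \<open>q \<le> p\<^sub>2\<close>. As \<open>R \<ge> 1\<close>, all three are at
  most a multiple of \<open>max R |log\<^sub>2 N|\<close>. Hoelder's inequality joins the factors \<open>f
  (A x)\<close> and \<open>b x - b (A x)\<close>, with exponents \<open>p\<^sub>1 / (q s')\<close> and
  \<open>p\<^sub>2 / (q s')\<close>; the strict inequality in the hypothesis on \<open>p\<close> leaves room
  to choose an admissible \<open>s \<ge> delta\<close> (\<open>exists_reverse_hoelder_exponent\<close>).

  If the constant is infinite, the norm inequality says something only when one of the two norms on the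
  right vanishes. Then \<open>f = 0\<close> or \<open>b\<close> is constant, almost everywhere, and the
  commutator is \<open>0\<close> almost everywhere.
\<close>

section \<open>Lebesgue measure under linear maps\<close>

lemma det_shear:
  fixes m n :: "'k::finite"
  assumes "m \<noteq> n"
  shows "det (\<chi> i j. of_bool (i = m \<and> j = n \<or> i = j) :: real^'k^'k) = 1"
proof -
  have eq: "(\<chi> k. if k = m then row m (mat 1) + 1 *s row n (mat 1) else row k (mat 1))
      = (\<chi> i j. of_bool (i = m \<and> j = n \<or> i = j) :: real^'k^'k)"
    using assms by (auto simp: vec_eq_iff row_def mat_def)
  show ?thesis
    by (simp only: eq[symmetric] det_row_operation[OF assms] det_I)
qed

text \<open>
  Both sides are multiplicative in \<open>A\<close>, so elementary matrices suffice. Among these, the swaps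
  permute the sides of a box, and the shears preserve the volume of a box; volumes of boxes determine the
  effect of a linear map on all sets of finite measure.
\<close>

proposition measure_matrix_image:
  fixes A :: "real^'k^'k"
  assumes "S \<in> lmeasurable"
  shows "(*v) A ` S \<in> lmeasurable"
    and "measure lebesgue ((*v) A ` S) = \<bar>det A\<bar> * measure lebesgue S"
proof -
  let ?P = "\<lambda>A::real^'k^'k. \<forall>S\<in>lmeasurable. (*v) A ` S \<in> lmeasurable \<and>
      measure lebesgue ((*v) A ` S) = \<bar>det A\<bar> * measure lebesgue S"
  have suff: "?P A" if "\<And>a b. cbox a b \<noteq> {} \<Longrightarrow>
      measure lebesgue ((*v) A ` cbox a b) = \<bar>det A\<bar> * measure lebesgue (cbox a b)" for A
  proof -
    have "measure lebesgue ((*v) A ` cbox a b) = \<bar>det A\<bar> * measure lebesgue (cbox a b)" for a b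
      using that[of a b] by (cases "cbox a b = {}") auto
    then show ?thesis
      using measure_linear_sufficient[OF matrix_vector_mul_linear] by metis
  qed
  have "?P A"
  proof (induction A rule: induct_matrix_elementary_alt)
    case (1 A B)
    have eq: "(*v) (A ** B) ` S = (*v) A ` (*v) B ` S" for S
      by (simp add: image_image matrix_vector_mul_assoc)
    show ?case
      using 1 unfolding eq by (simp add: det_mul abs_mult)
  next
    case (2 A i)
    have "det A = 0"
      using 2 by (rule det_zero_row)
    then have "\<not> inj ((*v) A)"
      by (metis det_nz_iff_inj matrix_of_matrix_vector_mul matrix_vector_mul_linear)
    then have "negligible ((*v) A ` S)" for S
      by (rule negligible_linear_singular_image[OF matrix_vector_mul_linear])
    then show ?case
      using \<open>det A = 0\<close> by (simp add: negligible_iff_measure)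
  next
    case (3 A)
    have "(*v) A = (\<lambda>x. \<chi> k. A$k$k * x$k)"
    proof
      fix x
      have "(\<Sum>j\<in>UNIV. A$i$j * x$j) = A$i$i * x$i" for i
        using 3 by (subst sum.remove[of _ i]) (auto intro!: sum.neutral)
      then show "A *v x = (\<chi> k. A$k$k * x$k)"
        by (simp add: matrix_vector_mult_def)
    qed
    moreover have "det A = (\<Prod>k\<in>UNIV. A$k$k)"
      using 3 by (rule det_diagonal)
    ultimately show ?case
      by (simp add: measurable_stretch measure_stretch)
  next
    case (4 m n)
    let ?t = "Transposition.transpose m n"
    let ?T = "\<chi> i j. mat 1 $ i $ ?t j :: real^'k^'k"
    have det: "\<bar>det ?T\<bar> = 1"
      using det_permute_columns[OF permutes_swap_id[of m UNIV n], of "mat 1 :: real^'k^'k"]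
      by (simp add: sign_swap_id 4)
    have eq: "?T *v x = (\<chi> i. x $ ?t i)" for x
    proof -
      have "(\<Sum>j\<in>UNIV. (if i = ?t j then 1 else 0) * x $ j) = x $ ?t i" for i
        by (subst sum.remove[of _ "?t i"]) (auto intro!: sum.neutral split: if_splits)
      then show ?thesis
        by (simp add: matrix_vector_mult_def mat_def)
    qed
    have "(*v) ?T ` cbox a b = cbox (?T *v a) (?T *v b)" for a b
    proof -
      have "x \<in> (*v) ?T ` cbox a b" if "x \<in> cbox (?T *v a) (?T *v b)" for x
      proof
        show "x = ?T *v (?T *v x)"
          by (simp add: eq vec_eq_iff)
        show "?T *v x \<in> cbox a b"
          using that unfolding eq mem_box_cart by simp (metis transpose_involutory)
      qed
      then show ?thesis
        by (auto simp: eq mem_box_cart)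
    qed
    moreover have "measure lborel (cbox (?T *v a) (?T *v b)) = measure lborel (cbox a b)" if "cbox a b \<noteq> {}" for a b
    proof -
      have "cbox (?T *v a) (?T *v b) \<noteq> {}"
        using that by (simp add: eq interval_ne_empty_cart)
      then show ?thesis
        using that prod.permute[OF permutes_swap_id[of m UNIV n], of "\<lambda>i. b$i - a$i"]
        by (simp add: content_cbox_cart eq o_def)
    qed
    ultimately show ?case
      using det by (intro suff) simp
  next
    case (5 m n)
    let ?T = "\<chi> i j. of_bool (i = m \<and> j = n \<or> i = j) :: real^'k^'k"
    have eq: "(*v) ?T = (\<lambda>x. \<chi> i. if i = m then x$m + x$n else x$i)"
    proof
      fix x :: "real^'k"
      have "(\<Sum>j\<in>UNIV. of_bool (i = m \<and> j = n \<or> i = j) * x $ j)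
          = (\<Sum>j\<in>UNIV. (if j = i then x$j else 0) + (if j = n then of_bool (i = m) * x$j else 0))" for i
        using 5 by (intro sum.cong) auto
      then show "?T *v x = (\<chi> i. if i = m then x$m + x$n else x$i)"
        by (auto simp: matrix_vector_mult_def vec_eq_iff sum.distrib)
    qed
    have "measure lebesgue ((*v) ?T ` cbox a b) = measure lebesgue (cbox a b)" if "cbox a b \<noteq> {}" for a b
    proof -
      \<comment> \<open>After a translation the \<open>n\<close>-th side of the box starts at \<open>0\<close>, as \<open>measure_shear_interval\<close> requires.\<close>
      define v where "v = axis n (a$n)"
      have "cbox a b = (+) v ` cbox (a - v) (b - v)"
        by (simp add: cbox_translation[symmetric])
      then have "(*v) ?T ` cbox a b = (+) (?T *v v) ` (*v) ?T ` cbox (a - v) (b - v)"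
        by (simp add: image_image matrix_vector_right_distrib)
      then have "measure lebesgue ((*v) ?T ` cbox a b) = measure lebesgue ((*v) ?T ` cbox (a - v) (b - v))"
        by (simp add: measure_translation)
      also have "\<dots> = measure lebesgue (cbox (a - v) (b - v))"
        unfolding eq using that 5
        by (intro measure_shear_interval) (auto simp: v_def interval_ne_empty_cart)
      also have "\<dots> = measure lebesgue (cbox a b)"
        using measure_translation[of v "cbox (a - v) (b - v)"] \<open>cbox a b = _\<close> by simp
      finally show ?thesis .
    qed
    then show ?case
      by (intro suff) (simp only: det_shear[OF 5] abs_one mult_1)
  qed
  with assms show "(*v) A ` S \<in> lmeasurable"
    and "measure lebesgue ((*v) A ` S) = \<bar>det A\<bar> * measure lebesgue S"
    by auto
qed

text \<open>
  Lebesgue measure is determined by its values on boxes, and the preimage of a box is its image under the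
  inverse matrix.
\<close>

lemma lborel_matrix_image:
  fixes A :: "real^'k^'k"
  assumes "det A \<noteq> 0"
  shows "lborel = density (distr lborel borel ((*v) A)) (\<lambda>_. ennreal \<bar>det A\<bar>)"
proof (rule lborel_eqI)
  have [measurable]: "(*v) A \<in> borel_measurable borel"
    by (intro borel_measurable_continuous_onI linear_continuous_on linear_conv_bounded_linear[THEN iffD1] matrix_vector_mul_linear)
  obtain B where B: "A ** B = mat 1" "B ** A = mat 1"
    using assms invertible_det_nz[of A] unfolding invertible_def by auto
  fix l u :: "real^'k"
  assume "\<And>b. b \<in> Basis \<Longrightarrow> l \<bullet> b \<le> u \<bullet> b"
  then have content: "emeasure lborel (box l u) = (\<Prod>b\<in>Basis. (u - l) \<bullet> b)"
    by (auto simp: emeasure_lborel_box_eq inner_diff_left)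
  have vimage: "(*v) A -` box l u = (*v) B ` box l u"
  proof (intro set_eqI iffI)
    fix x assume "x \<in> (*v) A -` box l u"
    then show "x \<in> (*v) B ` box l u"
      by (intro image_eqI[of _ _ "A *v x"]) (auto simp: matrix_vector_mul_assoc B)
  qed (auto simp: matrix_vector_mul_assoc B)
  have "box l u \<in> lmeasurable"
    by simp
  note img = measure_matrix_image[OF this, of B]
  have "emeasure lborel ((*v) A -` box l u) = emeasure lebesgue ((*v) B ` box l u)"
    unfolding vimage[symmetric] by (simp add: measurable_sets_borel[of _ borel])
  also have "\<dots> = ennreal (\<bar>det B\<bar> * measure lebesgue (box l u))"
    using img(1) unfolding img(2)[symmetric] by (intro emeasure_eq_ennreal_measure) (rule fmeasurableD2)
  also have "\<dots> = ennreal \<bar>det B\<bar> * emeasure lborel (box l u)"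
    using emeasure_lborel_box_finite[of l u]
    by (simp add: ennreal_mult emeasure_eq_ennreal_measure less_top[symmetric])
  finally have *: "emeasure lborel ((*v) A -` box l u) = ennreal \<bar>det B\<bar> * emeasure lborel (box l u)" .
  have "det A * det B = 1"
    using B(1) by (metis det_I det_mul)
  then have "ennreal \<bar>det A\<bar> * ennreal \<bar>det B\<bar> = 1"
    by (simp add: ennreal_mult[symmetric] abs_mult[symmetric])
  then show "emeasure (density (distr lborel borel ((*v) A)) (\<lambda>_. ennreal \<bar>det A\<bar>)) (box l u)
      = (\<Prod>b\<in>Basis. (u - l) \<bullet> b)"
    by (simp add: emeasure_density nn_integral_cmult emeasure_distr * content mult.assoc[symmetric])
qed simp

corollary nn_integral_matrix_image:
  fixes A :: "real^'k^'k" and g :: "real^'k \<Rightarrow> ennreal"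
  assumes "det A \<noteq> 0" and [measurable]: "g \<in> borel_measurable borel"
  shows "(\<integral>\<^sup>+x. g x \<partial>lborel) = ennreal \<bar>det A\<bar> * (\<integral>\<^sup>+x. g (A *v x) \<partial>lborel)"
proof -
  have [measurable]: "(*v) A \<in> borel_measurable borel"
    by (intro borel_measurable_continuous_onI linear_continuous_on linear_conv_bounded_linear[THEN iffD1] matrix_vector_mul_linear)
  show ?thesis
    by (subst lborel_matrix_image[OF assms(1)])
      (simp add: nn_integral_density nn_integral_distr nn_integral_cmult)
qed

section \<open>Bounds on \<open>L\<^sup>p\<close> norms\<close>

text \<open>
  The bound \<open>X\<close> is a real number, so that powers and roots of norms are computed in the reals
  and no finiteness of the integral has to be assumed beforehand.
\<close>

definition Lp_bound :: "'a measure \<Rightarrow> real \<Rightarrow> ('a \<Rightarrow> real) \<Rightarrow> real \<Rightarrow> bool" where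
  "Lp_bound M p g X \<longleftrightarrow> g \<in> borel_measurable M \<and> 0 \<le> X \<and>
     (\<integral>\<^sup>+x. ennreal (\<bar>g x\<bar> powr p) \<partial>M) \<le> ennreal (X powr p)"

lemma Lp_bound_measurable [measurable_dest]: "Lp_bound M p g X \<Longrightarrow> g \<in> borel_measurable M"
  and Lp_bound_nonneg: "Lp_bound M p g X \<Longrightarrow> 0 \<le> X"
  and Lp_bound_integral: "Lp_bound M p g X \<Longrightarrow> (\<integral>\<^sup>+x. ennreal (\<bar>g x\<bar> powr p) \<partial>M) \<le> ennreal (X powr p)"
  by (auto simp: Lp_bound_def)

lemma Lp_bound_mono:
  assumes "Lp_bound M p g X" "X \<le> Y" "0 < p"
  shows "Lp_bound M p g Y"
proof -
  have "ennreal (X powr p) \<le> ennreal (Y powr p)"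
    using assms by (intro ennreal_leI powr_mono2) (auto dest: Lp_bound_nonneg)
  with assms show ?thesis
    unfolding Lp_bound_def by (meson order_trans)
qed

lemma Lp_bound_AE_mono:
  assumes g: "Lp_bound M p g X" and "0 < p" and "AE x in M. \<bar>f x\<bar> \<le> \<bar>g x\<bar>"
    and "f \<in> borel_measurable M"
  shows "Lp_bound M p f X"
proof -
  have "(\<integral>\<^sup>+x. ennreal (\<bar>f x\<bar> powr p) \<partial>M) \<le> (\<integral>\<^sup>+x. ennreal (\<bar>g x\<bar> powr p) \<partial>M)"
    using assms(3) by (intro nn_integral_mono_AE) (auto intro!: ennreal_leI powr_mono2 less_imp_le[OF \<open>0 < p\<close>])
  with assms show ?thesis
    by (auto simp: Lp_bound_def)
qed

lemma Lp_bound_zeroD: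
  assumes "Lp_bound M p g 0" "0 < p"
  shows "AE x in M. g x = 0"
proof -
  have [measurable]: "g \<in> borel_measurable M"
    using assms(1) by (rule Lp_bound_measurable)
  have "(\<integral>\<^sup>+x. ennreal (\<bar>g x\<bar> powr p) \<partial>M) = 0"
    using Lp_bound_integral[OF assms(1)] by simp
  then have "AE x in M. ennreal (\<bar>g x\<bar> powr p) = 0"
    by (subst (asm) nn_integral_0_iff_AE) auto
  then show ?thesis
    by eventually_elim (simp add: ennreal_eq_0_iff powr_eq_0_iff)
qed

lemma Lp_bound_AE_zero:
  assumes "AE x in M. f x = 0" "f \<in> borel_measurable M" "0 \<le> X"
  shows "Lp_bound M p f X"
proof -
  have "(\<integral>\<^sup>+x. ennreal (\<bar>f x\<bar> powr p) \<partial>M) = (\<integral>\<^sup>+x. 0 \<partial>M)"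
    using assms(1) by (intro nn_integral_cong_AE) auto
  with assms show ?thesis
    by (auto simp: Lp_bound_def)
qed

lemma Lp_bound_const:
  assumes "emeasure M (space M) \<le> 1" "0 < p"
  shows "Lp_bound M p (\<lambda>_. c) \<bar>c\<bar>"
proof -
  have "(\<integral>\<^sup>+x. ennreal (\<bar>c\<bar> powr p) \<partial>M) \<le> ennreal (\<bar>c\<bar> powr p) * 1"
    using assms by (subst nn_integral_const) (intro mult_left_mono, auto)
  then show ?thesis
    by (simp add: Lp_bound_def)
qed

lemma Lp_bound_powr_iff:
  assumes "g \<in> borel_measurable M" "0 \<le> X" "r \<noteq> 0"
  shows "Lp_bound M p (\<lambda>x. \<bar>g x\<bar> powr r) (X powr r) \<longleftrightarrow> Lp_bound M (r * p) g X"
  using assms by (simp add: Lp_bound_def powr_powr)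

lemma Lp_bound_scaled_iff:
  assumes [measurable]: "g \<in> borel_measurable M" and "0 < c" "0 < p" 
  shows "Lp_bound M p (\<lambda>x. c * g x) (c * X) \<longleftrightarrow> Lp_bound M p g X"
proof -
  have "(\<integral>\<^sup>+x. ennreal (\<bar>c * g x\<bar> powr p) \<partial>M) = ennreal (c powr p) * (\<integral>\<^sup>+x. ennreal (\<bar>g x\<bar> powr p) \<partial>M)"
    using assms by (subst nn_integral_cmult[symmetric]) (auto simp: abs_mult powr_mult ennreal_mult)
  moreover have "ennreal ((c * X) powr p) = ennreal (c powr p) * ennreal (X powr p)"
    by (simp add: powr_mult ennreal_mult)
  ultimately show ?thesis
    using assms by (simp add: Lp_bound_def ennreal_mult_le_mult_iff zero_le_mult_iff)
qed

text \<open>Weighted AM-GM with three weights, the third one belonging to \<open>1\<close>.\<close>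

lemma powr_mult_powr_le:
  fixes u v \<alpha> \<beta> :: real
  assumes "0 \<le> u" "0 \<le> v" "0 < \<alpha>" "0 < \<beta>" "\<alpha> + \<beta> \<le> 1"
  shows "u powr \<alpha> * v powr \<beta> \<le> \<alpha> * u + \<beta> * v + (1 - \<alpha> - \<beta>)"
proof (cases "u = 0 \<or> v = 0")
  case True
  then show ?thesis
    using assms by auto
next
  case False
  define s z where "s = \<alpha> + \<beta>" and "z = u powr (\<alpha> / s) * v powr (\<beta> / s)"
  have s: "0 < s" "s \<le> 1"
    using assms by (auto simp: s_def)
  have "z \<le> \<alpha> / s * u + \<beta> / s * v"
    unfolding z_def using assms False s
    by (intro Youngs_inequality_0) (auto simp: s_def add_divide_distrib[symmetric])
  then have "s * z \<le> \<alpha> * u + \<beta> * v"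
    using s by (simp add: field_simps)
  moreover have "z powr s * 1 powr (1 - s) \<le> s * z + (1 - s) * 1"
    using s False assms by (intro Youngs_inequality_0) (auto simp: z_def)
  moreover have "z powr s = u powr \<alpha> * v powr \<beta>"
    using s by (simp add: z_def powr_mult powr_powr)
  ultimately show ?thesis
    by (simp add: s_def)
qed

text \<open>
  After division by \<open>X\<close> and \<open>Y\<close> this is weighted AM-GM under the integral sign.
  The slack \<open>1 - p / a - p / b\<close> is the weight of the constant function \<open>1\<close>, whose
  integral is at most \<open>1\<close>; this is where the total mass enters.
\<close>

proposition Lp_bound_Hoelder:
  assumes M: "emeasure M (space M) \<le> 1" and pos: "0 < a" "0 < b" "0 < p"
    and exp: "1 / a + 1 / b \<le> 1 / p"
    and f: "Lp_bound M a f X" and g: "Lp_bound M b g Y"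
  shows "Lp_bound M p (\<lambda>x. f x * g x) (X * Y)"
proof -
  note [measurable] = Lp_bound_measurable[OF f] Lp_bound_measurable[OF g]
  have XY: "0 \<le> X" "0 \<le> Y"
    using f g by (auto simp: Lp_bound_def)
  show ?thesis
  proof (cases "X = 0 \<or> Y = 0")
    case True
    then have "AE x in M. f x = 0 \<or> g x = 0"
      using f g pos by (auto dest!: Lp_bound_zeroD)
    then have "AE x in M. f x * g x = 0"
      by eventually_elim auto
    then show ?thesis
      using XY by (intro Lp_bound_AE_zero) auto
  next
    case False
    then have pXY: "0 < X" "0 < Y"
      using XY by auto
    let ?u = "\<lambda>x. \<bar>f x\<bar> powr a / X powr a" and ?v = "\<lambda>x. \<bar>g x\<bar> powr b / Y powr b"
    let ?\<gamma> = "1 - p / a - p / b"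
    have le1: "p / a + p / b \<le> 1"
      using exp pos by (simp add: field_simps)
    have int1: "(\<integral>\<^sup>+x. ennreal (?u x) \<partial>M) \<le> 1" "(\<integral>\<^sup>+x. ennreal (?v x) \<partial>M) \<le> 1"
    proof -
      have *: "(\<integral>\<^sup>+x. ennreal (\<bar>h x\<bar> powr c / Z powr c) \<partial>M) \<le> 1"
        if h: "Lp_bound M c h Z" and Z: "0 < Z" for c h Z
      proof -
        have [measurable]: "h \<in> borel_measurable M"
          using h by (rule Lp_bound_measurable)
        have "(\<integral>\<^sup>+x. ennreal (\<bar>h x\<bar> powr c / Z powr c) \<partial>M)
            = (\<integral>\<^sup>+x. ennreal (\<bar>h x\<bar> powr c) * ennreal (1 / Z powr c) \<partial>M)"
          by (intro nn_integral_cong) (simp add: ennreal_mult[symmetric])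
        also have "\<dots> = (\<integral>\<^sup>+x. ennreal (\<bar>h x\<bar> powr c) \<partial>M) * ennreal (1 / Z powr c)"
          by (rule nn_integral_multc) measurable
        also have "\<dots> \<le> ennreal (Z powr c) * ennreal (1 / Z powr c)"
          using h by (intro mult_right_mono) (auto simp: Lp_bound_def)
        also have "\<dots> = 1"
          using Z by (simp add: ennreal_mult[symmetric])
        finally show ?thesis .
      qed
      show "(\<integral>\<^sup>+x. ennreal (?u x) \<partial>M) \<le> 1" "(\<integral>\<^sup>+x. ennreal (?v x) \<partial>M) \<le> 1"
        using *[OF f] *[OF g] pXY by auto
    qed
    have "\<bar>f x * g x\<bar> powr p \<le> (X * Y) powr p * (p / a * ?u x + p / b * ?v x + ?\<gamma>)" for x
    proof -
      have "?u x powr (p / a) * ?v x powr (p / b) \<le> p / a * ?u x + p / b * ?v x + ?\<gamma>"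
        using pos le1 by (intro powr_mult_powr_le) auto
      moreover have "\<bar>f x * g x\<bar> powr p = (X * Y) powr p * (?u x powr (p / a) * ?v x powr (p / b))"
        using pos pXY by (simp add: powr_divide powr_powr abs_mult powr_mult)
      ultimately show ?thesis
        by (simp add: mult_left_mono)
    qed
    then have "(\<integral>\<^sup>+x. ennreal (\<bar>f x * g x\<bar> powr p) \<partial>M)
        \<le> (\<integral>\<^sup>+x. ennreal ((X * Y) powr p) *
            (ennreal (p / a) * ennreal (?u x) + ennreal (p / b) * ennreal (?v x) + ennreal ?\<gamma>) \<partial>M)"
      using pos le1
      by (intro nn_integral_mono)
        (simp add: ennreal_mult[symmetric] ennreal_plus[symmetric] ennreal_leI del: ennreal_plus)
    also have "\<dots> = ennreal ((X * Y) powr p) *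
        (ennreal (p / a) * (\<integral>\<^sup>+x. ennreal (?u x) \<partial>M) + ennreal (p / b) * (\<integral>\<^sup>+x. ennreal (?v x) \<partial>M)
          + ennreal ?\<gamma> * emeasure M (space M))"
      by (simp add: nn_integral_cmult nn_integral_add)
    also have "\<dots> \<le> ennreal ((X * Y) powr p) * (ennreal (p / a) * 1 + ennreal (p / b) * 1 + ennreal ?\<gamma> * 1)"
      using M int1 by (intro mult_left_mono add_mono) auto
    also have "\<dots> = ennreal ((X * Y) powr p)"
      using pos le1 by (simp add: ennreal_plus[symmetric] del: ennreal_plus)
    finally show ?thesis
      using XY by (simp add: Lp_bound_def)
  qed
qed

lemma Lp_bound_lower_exponent:
  assumes M: "emeasure M (space M) \<le> 1" and "0 < p" "p \<le> a" and f: "Lp_bound M a f X"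
  shows "Lp_bound M p f X"
proof (cases "p = a")
  case False
  define c where "c = 1 / (1 / p - 1 / a)"
  have "0 < c"
    using assms False by (simp add: c_def field_simps)
  then have "Lp_bound M p (\<lambda>x. f x * 1) (X * \<bar>1\<bar>)"
    using assms by (intro Lp_bound_Hoelder[OF M _ _ _ _ f Lp_bound_const[OF M], of c]) (auto simp: c_def)
  then show ?thesis
    by simp
qed (use f in simp)

lemma powr_convex_combination:
  fixes x y t p :: real
  assumes "1 \<le> p" "0 \<le> x" "0 \<le> y" "0 \<le> t" "t \<le> 1"
  shows "(t * x + (1 - t) * y) powr p \<le> t * x powr p + (1 - t) * y powr p"
proof -
  have scale: "(s * z) powr p \<le> s * z powr p" if "0 \<le> s" "s \<le> 1" for s z
  proof (cases "s = 0")
    case False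
    have "s powr p \<le> s powr 1"
      using that assms(1) False by (intro powr_mono') auto
    then show ?thesis
      using that by (simp add: powr_mult mult_right_mono)
  qed simp
  show ?thesis
  proof (cases "x = 0 \<or> y = 0")
    case True
    then show ?thesis
      using scale[of t x] scale[of "1 - t" y] assms by auto
  next
    case False
    then show ?thesis
      using convex_onD[OF powr_convex[OF assms(1)], of "1 - t" x y] assms by (simp add: mult.commute)
  qed
qed

text \<open>
  Convexity of \<open>t \<mapsto> t\<^sup>p\<close>, applied to \<open>f / X\<close> and \<open>g /
  Y\<close> with weights \<open>X / (X + Y)\<close> and \<open>Y / (X + Y)\<close>.
\<close>

proposition Lp_bound_add:
  assumes p: "1 \<le> p" and f: "Lp_bound M p f X" and g: "Lp_bound M p g Y"
  shows "Lp_bound M p (\<lambda>x. f x + g x) (X + Y)"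
proof -
  note [measurable] = Lp_bound_measurable[OF f] Lp_bound_measurable[OF g]
  have XY: "0 \<le> X" "0 \<le> Y"
    using f g by (auto simp: Lp_bound_def)
  consider "X = 0" | "Y = 0" | "0 < X" "0 < Y"
    using XY by linarith
  then show ?thesis
  proof cases
    case 1
    then have "AE x in M. f x = 0"
      using f p by (auto dest!: Lp_bound_zeroD)
    then have "AE x in M. \<bar>f x + g x\<bar> \<le> \<bar>g x\<bar>"
      by eventually_elim simp
    moreover have "Lp_bound M p g (X + Y)"
      using 1 g by simp
    ultimately show ?thesis
      using p by (rule_tac Lp_bound_AE_mono) auto
  next
    case 2
    then have "AE x in M. g x = 0"
      using g p by (auto dest!: Lp_bound_zeroD)
    then have "AE x in M. \<bar>f x + g x\<bar> \<le> \<bar>f x\<bar>"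
      by eventually_elim simp
    moreover have "Lp_bound M p f (X + Y)"
      using 2 f by simp
    ultimately show ?thesis
      using p by (rule_tac Lp_bound_AE_mono) auto
  next
    case 3
    define t where "t = X / (X + Y)"
    have t: "0 \<le> t" "t \<le> 1" "1 - t = Y / (X + Y)"
      using 3 by (auto simp: t_def field_simps)
    let ?c = "(X + Y) powr p"
    define A B where "A = ?c * t / X powr p" and "B = ?c * (1 - t) / Y powr p"
    have AB: "0 \<le> A" "0 \<le> B"
      using t(1,2) by (auto simp: A_def B_def)
    have "\<bar>f x + g x\<bar> powr p
        \<le> A * \<bar>f x\<bar> powr p + B * \<bar>g x\<bar> powr p" for x
    proof -
      have "(X + Y) * t = X" "(X + Y) * (1 - t) = Y"
        using 3 unfolding t(3) by (simp_all add: t_def)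
      then have "(X + Y) * (t * a + (1 - t) * b) = X * a + Y * b" for a b
        by (simp add: distrib_left mult.assoc[symmetric])
      from this[of "\<bar>f x\<bar> / X" "\<bar>g x\<bar> / Y"]
      have eq: "(X + Y) * (t * (\<bar>f x\<bar> / X) + (1 - t) * (\<bar>g x\<bar> / Y)) = \<bar>f x\<bar> + \<bar>g x\<bar>"
        using 3 by simp
      have "\<bar>f x + g x\<bar> powr p \<le> (\<bar>f x\<bar> + \<bar>g x\<bar>) powr p"
        using p by (intro powr_mono2) auto
      also have "\<dots> = ?c * (t * (\<bar>f x\<bar> / X) + (1 - t) * (\<bar>g x\<bar> / Y)) powr p"
        unfolding eq[symmetric] by (rule powr_mult)
      also have "\<dots> \<le> ?c * (t * (\<bar>f x\<bar> / X) powr p + (1 - t) * (\<bar>g x\<bar> / Y) powr p)"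
        using p t 3 by (intro mult_left_mono powr_convex_combination) auto
      finally show ?thesis
        unfolding A_def B_def by (simp only: powr_divide) (simp add: algebra_simps)
    qed
    then have "(\<integral>\<^sup>+x. ennreal (\<bar>f x + g x\<bar> powr p) \<partial>M)
        \<le> (\<integral>\<^sup>+x. ennreal A * ennreal (\<bar>f x\<bar> powr p) + ennreal B * ennreal (\<bar>g x\<bar> powr p) \<partial>M)"
      using AB by (intro nn_integral_mono)
        (simp add: ennreal_mult[symmetric] ennreal_plus[symmetric] ennreal_leI del: ennreal_plus)
    also have "\<dots> = ennreal A * (\<integral>\<^sup>+x. ennreal (\<bar>f x\<bar> powr p) \<partial>M)
              + ennreal B * (\<integral>\<^sup>+x. ennreal (\<bar>g x\<bar> powr p) \<partial>M)"
      by (simp add: nn_integral_cmult nn_integral_add)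
    also have "\<dots> \<le> ennreal A * ennreal (X powr p) + ennreal B * ennreal (Y powr p)"
      using f g by (intro add_mono mult_left_mono) (auto simp: Lp_bound_def)
    also have "\<dots> = ennreal (A * X powr p + B * Y powr p)"
      using AB by (simp add: ennreal_mult[symmetric] ennreal_plus[symmetric] del: ennreal_plus)
    also have "A * X powr p + B * Y powr p = ?c"
    proof -
      have "A * X powr p = ?c * t" "B * Y powr p = ?c * (1 - t)"
        using 3 by (simp_all add: A_def B_def)
      then show ?thesis
        by (simp add: algebra_simps)
    qed
    finally show ?thesis
      using XY by (simp add: Lp_bound_def)
  qed
qed

text \<open>
  Minkowski's integral inequality for a majorant \<open>h\<close> of the norms. The function \<open>h /
  H\<close> is a subprobability density, and Jensen's inequality for it replaces duality: the
  \<open>p\<close>-th power of the inner integral is at most \<open>H\<^sup>p\<close> times \<open>J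
  x\<close>, and Tonelli's theorem bounds the integral of \<open>J\<close> by \<open>1\<close>.
\<close>

lemma Lp_bound_integral_Minkowski_pos:
  fixes F :: "'a \<Rightarrow> 'b \<Rightarrow> real" and h :: "'b \<Rightarrow> real"
  assumes "sigma_finite_measure M" "sigma_finite_measure N"
    and F [measurable]: "case_prod F \<in> borel_measurable (M \<Otimes>\<^sub>M N)" and F0: "\<And>x y. 0 \<le> F x y"
    and h [measurable]: "h \<in> borel_measurable N" and h0: "\<And>y. 0 \<le> h y"
    and zero: "AE y in N. h y = 0 \<longrightarrow> (\<forall>x. F x y = 0)"
    and p: "1 \<le> p"
    and bound: "AE y in N. Lp_bound M p (\<lambda>x. F x y) (h y)"
    and H: "(\<integral>\<^sup>+y. ennreal (h y) \<partial>N) \<le> ennreal H" "0 < H"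
  shows "AE x in M. (\<integral>\<^sup>+y. ennreal (F x y) \<partial>N) < \<infinity>"
    and "Lp_bound M p (\<lambda>x. enn2real (\<integral>\<^sup>+y. ennreal (F x y) \<partial>N)) H"
proof -
  interpret M: sigma_finite_measure M by fact
  interpret N: sigma_finite_measure N by fact
  interpret pair_sigma_finite M N ..
  define J where "J x = (\<integral>\<^sup>+y. ennreal (h y / H * (F x y / h y) powr p) \<partial>N)" for x
  have J_meas [measurable]: "J \<in> borel_measurable M"
    unfolding J_def by measurable
  have "(\<integral>\<^sup>+x. J x \<partial>M) = (\<integral>\<^sup>+y. (\<integral>\<^sup>+x. ennreal (h y / H * (F x y / h y) powr p) \<partial>M) \<partial>N)"
    unfolding J_def by (rule Fubini'[symmetric]) measurable
  also have "\<dots> \<le> (\<integral>\<^sup>+y. ennreal (h y / H) \<partial>N)"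
  proof (rule nn_integral_mono_AE)
    show "AE y in N. (\<integral>\<^sup>+x. ennreal (h y / H * (F x y / h y) powr p) \<partial>M) \<le> ennreal (h y / H)"
      using bound
    proof eventually_elim
      fix y assume y: "Lp_bound M p (\<lambda>x. F x y) (h y)"
      have [measurable]: "(\<lambda>x. F x y) \<in> borel_measurable M"
        using y by (rule Lp_bound_measurable)
      have "(\<integral>\<^sup>+x. ennreal (h y / H * (F x y / h y) powr p) \<partial>M)
          = ennreal (h y / H / h y powr p) * (\<integral>\<^sup>+x. ennreal (\<bar>F x y\<bar> powr p) \<partial>M)"
        using F0 h0 H by (subst nn_integral_cmult[symmetric])
          (auto simp: ennreal_mult[symmetric] powr_divide)
      also have "\<dots> \<le> ennreal (h y / H / h y powr p) * ennreal (h y powr p)"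
        using y by (intro mult_left_mono) (auto simp: Lp_bound_def)
      also have "\<dots> \<le> ennreal (h y / H)"
        using h0 H by (simp add: ennreal_mult[symmetric])
      finally show "(\<integral>\<^sup>+x. ennreal (h y / H * (F x y / h y) powr p) \<partial>M) \<le> ennreal (h y / H)" .
    qed
  qed
  also have h1: "(\<integral>\<^sup>+y. ennreal (h y / H) \<partial>N) \<le> 1"
  proof -
    have "(\<integral>\<^sup>+y. ennreal (h y / H) \<partial>N) = (\<integral>\<^sup>+y. ennreal (h y) \<partial>N) * ennreal (1 / H)"
      using h0 H by (subst nn_integral_multc[symmetric]) (auto simp: ennreal_mult[symmetric])
    also have "\<dots> \<le> ennreal H * ennreal (1 / H)"
      using H by (intro mult_right_mono) auto
    also have "\<dots> = 1"
      using H by (simp add: ennreal_mult[symmetric])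
    finally show ?thesis .
  qed
  finally have J1: "(\<integral>\<^sup>+x. J x \<partial>M) \<le> 1" .
  then have J_fin: "AE x in M. J x \<noteq> \<infinity>"
    by (intro nn_integral_PInf_AE) (auto simp: top_unique)
  \<comment> \<open>Jensen's inequality for the density \<open>h / H\<close> and the function \<open>F / h\<close>\<close>
  have key: "(\<integral>\<^sup>+y. ennreal (F x y) \<partial>N) \<le> ennreal (H * enn2real (J x) powr (1 / p))"
    if "x \<in> space M" "J x \<noteq> \<infinity>" for x
  proof -
    have [measurable]: "(\<lambda>y. F x y) \<in> borel_measurable N"
      using that(1) by measurable
    define D where "D = density N (\<lambda>y. ennreal (h y / H))"
    let ?g = "\<lambda>y. F x y / h y"
    have "emeasure D (space D) \<le> 1"
      using h1 by (simp add: D_def emeasure_density)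
    moreover have "(\<integral>\<^sup>+y. ennreal (\<bar>?g y\<bar> powr p) \<partial>D) = J x"
      unfolding D_def J_def using F0 h0 H
      by (subst nn_integral_density) (auto simp: ennreal_mult[symmetric] intro!: nn_integral_cong)
    then have "Lp_bound D p ?g (enn2real (J x) powr (1 / p))"
      using p that(2) by (auto simp: Lp_bound_def D_def powr_powr ennreal_enn2real_if)
    ultimately have "Lp_bound D 1 ?g (enn2real (J x) powr (1 / p))"
      using p by (rule_tac Lp_bound_lower_exponent) auto
    then have *: "(\<integral>\<^sup>+y. ennreal \<bar>?g y\<bar> \<partial>D) \<le> ennreal (enn2real (J x) powr (1 / p))"
      by (simp add: Lp_bound_def)
    have "(\<integral>\<^sup>+y. ennreal (F x y) \<partial>N) = (\<integral>\<^sup>+y. ennreal H * (ennreal (h y / H) * ennreal \<bar>?g y\<bar>) \<partial>N)"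
    proof (rule nn_integral_cong_AE)
      show "AE y in N. ennreal (F x y) = ennreal H * (ennreal (h y / H) * ennreal \<bar>?g y\<bar>)"
        using zero
      proof eventually_elim
        fix y assume "h y = 0 \<longrightarrow> (\<forall>x. F x y = 0)"
        then show "ennreal (F x y) = ennreal H * (ennreal (h y / H) * ennreal \<bar>?g y\<bar>)"
          using F0[of x y] h0[of y] H by (cases "h y = 0") (auto simp: ennreal_mult[symmetric])
      qed
    qed
    also have "\<dots> = ennreal H * (\<integral>\<^sup>+y. ennreal \<bar>?g y\<bar> \<partial>D)"
      unfolding D_def by (simp add: nn_integral_cmult nn_integral_density)
    also have "\<dots> \<le> ennreal H * ennreal (enn2real (J x) powr (1 / p))"
      using * by (intro mult_left_mono) auto
    finally show ?thesis
      using H by (simp add: ennreal_mult)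
  qed
  show "AE x in M. (\<integral>\<^sup>+y. ennreal (F x y) \<partial>N) < \<infinity>"
    using J_fin AE_space by eventually_elim (rule le_less_trans[OF key], auto)
  let ?T = "\<lambda>x. enn2real (\<integral>\<^sup>+y. ennreal (F x y) \<partial>N)"
  have "(\<integral>\<^sup>+x. ennreal (\<bar>?T x\<bar> powr p) \<partial>M) \<le> (\<integral>\<^sup>+x. ennreal (H powr p) * J x \<partial>M)"
  proof (rule nn_integral_mono_AE)
    show "AE x in M. ennreal (\<bar>?T x\<bar> powr p) \<le> ennreal (H powr p) * J x"
      using J_fin AE_space
    proof eventually_elim
      fix x assume x: "x \<in> space M" "J x \<noteq> \<infinity>"
      have "?T x \<le> H * enn2real (J x) powr (1 / p)"
        using key[OF x] H by (intro enn2real_leI) auto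
      then have "\<bar>?T x\<bar> powr p \<le> (H * enn2real (J x) powr (1 / p)) powr p"
        using p by (intro powr_mono2) auto
      also have "\<dots> = H powr p * enn2real (J x)"
        using p by (simp add: powr_mult powr_powr)
      finally have "ennreal (\<bar>?T x\<bar> powr p) \<le> ennreal (H powr p) * ennreal (enn2real (J x))"
        by (simp add: ennreal_mult[symmetric])
      then show "ennreal (\<bar>?T x\<bar> powr p) \<le> ennreal (H powr p) * J x"
        using x by (simp add: ennreal_enn2real_if)
    qed
  qed
  also have "\<dots> = ennreal (H powr p) * (\<integral>\<^sup>+x. J x \<partial>M)"
    by (rule nn_integral_cmult) measurable
  also have "\<dots> \<le> ennreal (H powr p) * 1"
    using J1 by (intro mult_left_mono) auto
  finally show "Lp_bound M p ?T H"
    using H by (auto simp: Lp_bound_def)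
qed

proposition Lp_bound_integral_Minkowski:
  fixes F :: "'a \<Rightarrow> 'b \<Rightarrow> real" and h :: "'b \<Rightarrow> real"
  assumes "sigma_finite_measure M" "sigma_finite_measure N"
    and F [measurable]: "case_prod F \<in> borel_measurable (M \<Otimes>\<^sub>M N)" and F0: "\<And>x y. 0 \<le> F x y"
    and h [measurable]: "h \<in> borel_measurable N" and h0: "\<And>y. 0 \<le> h y"
    and zero: "AE y in N. h y = 0 \<longrightarrow> (\<forall>x. F x y = 0)"
    and p: "1 \<le> p"
    and bound: "AE y in N. Lp_bound M p (\<lambda>x. F x y) (h y)"
    and H: "(\<integral>\<^sup>+y. ennreal (h y) \<partial>N) \<le> ennreal H" "0 \<le> H"
  shows "AE x in M. (\<integral>\<^sup>+y. ennreal (F x y) \<partial>N) < \<infinity>"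
    and "Lp_bound M p (\<lambda>x. enn2real (\<integral>\<^sup>+y. ennreal (F x y) \<partial>N)) H"
proof -
  interpret N: sigma_finite_measure N by fact
  have "(AE x in M. (\<integral>\<^sup>+y. ennreal (F x y) \<partial>N) < \<infinity>) \<and> Lp_bound M p (\<lambda>x. enn2real (\<integral>\<^sup>+y. ennreal (F x y) \<partial>N)) H"
  proof (cases "H = 0")
    case True
    then have "(\<integral>\<^sup>+y. ennreal (h y) \<partial>N) = 0"
      using H by simp
    then have "AE y in N. ennreal (h y) = 0"
      by (subst (asm) nn_integral_0_iff_AE) auto
    with zero have "AE y in N. \<forall>x. F x y = 0"
      by eventually_elim (use h0 in \<open>auto simp: ennreal_eq_0_iff order_antisym\<close>)
    then have "(\<integral>\<^sup>+y. ennreal (F x y) \<partial>N) = (\<integral>\<^sup>+y. 0 \<partial>N)" for x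
      by (intro nn_integral_cong_AE) auto
    then show ?thesis
      using True by (simp add: Lp_bound_AE_zero)
  next
    case False
    with H(2) have "0 < H"
      by simp
    then show ?thesis
      using Lp_bound_integral_Minkowski_pos[OF assms(1-9) H(1)] by blast
  qed
  then show "AE x in M. (\<integral>\<^sup>+y. ennreal (F x y) \<partial>N) < \<infinity>"
    and "Lp_bound M p (\<lambda>x. enn2real (\<integral>\<^sup>+y. ennreal (F x y) \<partial>N)) H"
    by auto
qed

section \<open>The homogeneous norm and centred balls\<close>

lemma heis_norm_nonneg [simp]: "0 \<le> heis_norm x"
  by (simp add: heis_norm_def)

lemma heis_norm_pow4: "heis_norm x ^ 4 = (\<Sum>k\<in>UNIV. (x $ Some k)\<^sup>2)\<^sup>2 + (x $ None)\<^sup>2"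
  unfolding heis_norm_def by (rule real_root_pow_pos2) auto

lemma heis_norm_eq_0_iff [simp]: "heis_norm x = 0 \<longleftrightarrow> x = 0"
proof
  assume "heis_norm x = 0"
  then have "(\<Sum>k\<in>UNIV. (x $ Some k)\<^sup>2)\<^sup>2 + (x $ None)\<^sup>2 = 0"
    unfolding heis_norm_pow4[symmetric] by simp
  then have *: "(\<Sum>k\<in>UNIV. (x $ Some k)\<^sup>2) = 0" "x $ None = 0"
    by (simp_all only: sum_power2_eq_zero_iff)
  then have "x $ Some k = 0" for k
    by (simp add: sum_nonneg_eq_0_iff)
  with * show "x = 0"
    unfolding vec_eq_iff by (metis not_Some_eq zero_index)
qed (simp add: heis_norm_def)

lemma heis_norm_zero [simp]: "heis_norm 0 = 0"
  by simp

lemma heis_norm_pos_iff [simp]: "0 < heis_norm x \<longleftrightarrow> x \<noteq> 0"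
  using heis_norm_nonneg[of x] heis_norm_eq_0_iff[of x] by linarith

lemma continuous_on_heis_norm: "continuous_on A heis_norm"
  unfolding heis_norm_def by (intro continuous_intros)

lemma borel_measurable_heis_norm [measurable]: "heis_norm \<in> borel_measurable borel"
  by (intro borel_measurable_continuous_onI continuous_on_heis_norm)

text \<open>
  The distance of a point to the origin is its norm, as multiplication by the neutral element is trivial and
  the norm is even.
\<close>

lemma heis_ball_0: "heis_ball 0 r = {y. heis_norm y < r}"
proof -
  have "heis_mult (- y) 0 = - y" for y :: "'a heis"
    by (simp add: heis_mult_def vec_eq_iff split: option.split)
  moreover have "heis_norm (- y) = heis_norm y" for y :: "'a heis"
    by (simp add: heis_norm_def)
  ultimately show ?thesis
    by (simp add: heis_ball_def heis_dist_def)
qed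

lemma open_heis_ball_0: "open (heis_ball 0 r)"
  unfolding heis_ball_0 by (intro open_Collect_less continuous_on_heis_norm continuous_on_const)

lemma heis_ball_0_borel [measurable]: "heis_ball 0 r \<in> sets borel"
  by (rule borel_open[OF open_heis_ball_0])

lemma heis_ball_0_mono: "r \<le> s \<Longrightarrow> heis_ball 0 r \<subseteq> heis_ball 0 s"
  by (auto simp: heis_ball_0)

lemma heis_ball_0_exhausts: "\<exists>k::nat. x \<in> heis_ball 0 (real k + 1)"
proof -
  obtain k :: nat where "heis_norm x < real k"
    using reals_Archimedean2 by blast
  then have "x \<in> heis_ball 0 (real k + 1)"
    by (simp add: heis_ball_0)
  then show ?thesis ..
qed

lemma bounded_heis_ball_0: "bounded (heis_ball 0 r :: 'n::finite heis set)"
proof -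
  have "\<bar>x $ i\<bar> \<le> max \<bar>r\<bar> (r^2)" if "heis_norm x < r" for x :: "'n heis" and i
  proof -
    let ?S = "\<Sum>k\<in>UNIV. (x $ Some k)\<^sup>2"
    have r: "0 < r"
      using that heis_norm_nonneg[of x] by linarith
    have "heis_norm x ^ 4 \<le> r ^ 4"
      using that by (intro power_mono) auto
    then have le: "?S\<^sup>2 + (x $ None)\<^sup>2 \<le> (r\<^sup>2)\<^sup>2"
      unfolding heis_norm_pow4 by simp
    have "?S\<^sup>2 \<le> (r\<^sup>2)\<^sup>2" "(x $ None)\<^sup>2 \<le> (r\<^sup>2)\<^sup>2"
      using le zero_le_power2[of ?S] zero_le_power2[of "x $ None"] by linarith+
    then have S: "?S \<le> r\<^sup>2" and N: "\<bar>x $ None\<bar> \<le> r\<^sup>2"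
      using power2_le_imp_le[of ?S "r\<^sup>2"] power2_le_imp_le[of "\<bar>x $ None\<bar>" "r\<^sup>2"] by auto
    show ?thesis
    proof (cases i)
      case None
      with N show ?thesis by auto
    next
      case (Some k)
      have "(x $ Some k)\<^sup>2 \<le> ?S"
        by (rule member_le_sum) auto
      with S have "\<bar>x $ Some k\<bar>\<^sup>2 \<le> r\<^sup>2"
        by simp
      then have "\<bar>x $ Some k\<bar> \<le> r"
        by (rule power2_le_imp_le) (use r in simp)
      with Some r show ?thesis by auto
    qed
  qed
  then have "heis_ball 0 r \<subseteq> cbox (\<chi> i. - max \<bar>r\<bar> (r^2)) (\<chi> i::'n heis_index. max \<bar>r\<bar> (r^2))"
    unfolding heis_ball_0 subset_iff mem_Collect_eq mem_box_cart vec_lambda_beta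
    by (metis abs_le_D1 abs_le_D2 minus_le_iff)
  then show ?thesis
    using bounded_cbox bounded_subset by blast
qed

lemma heis_ball_0_lmeasurable: "heis_ball 0 r \<in> lmeasurable"
  by (intro lmeasurable_open bounded_heis_ball_0 open_heis_ball_0)

lemma measure_heis_ball_0_pos:
  assumes "0 < r"
  shows "0 < measure lebesgue (heis_ball 0 r)"
proof -
  have "0 \<in> heis_ball 0 r"
    using assms by (simp add: heis_ball_0)
  then have "\<not> negligible (heis_ball 0 r)"
    using open_not_negligible[OF open_heis_ball_0] by blast
  then show ?thesis
    using negligible_iff_measure[of "heis_ball 0 r"] heis_ball_0_lmeasurable
    by (metis measure_nonneg order_le_less)
qed

lemma compact_subset_heis_ball_0:
  fixes K :: "'n::finite heis set"
  assumes "compact K"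
  obtains r where "0 < r" "K \<subseteq> heis_ball 0 r"
proof -
  have "bounded (heis_norm ` K)"
    using assms by (intro compact_imp_bounded compact_continuous_image continuous_on_heis_norm)
  then obtain B where B: "\<And>x. x \<in> K \<Longrightarrow> heis_norm x \<le> B"
    by (auto simp: bounded_real)
  show ?thesis
  proof (rule that)
    show "0 < max B 0 + 1" by simp
    show "K \<subseteq> heis_ball 0 (max B 0 + 1)"
      using B by (force simp: heis_ball_0)
  qed
qed

text \<open>
  These are the automorphic dilations, for which the norm is homogeneous of degree one; the central
  coordinate scales quadratically, which raises the exponent of the volume from \<open>2n + 1\<close> to
  \<open>Q\<close>.
\<close>

definition heis_dilation :: "real \<Rightarrow> 'n::finite heis_matrix" where
  "heis_dilation r = (\<chi> i j. if i = j then (case i of None \<Rightarrow> r\<^sup>2 | Some _ \<Rightarrow> r) else 0)"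

lemma heis_dilation_mult: "heis_dilation r *v x = (\<chi> i. (case i of None \<Rightarrow> r\<^sup>2 | Some _ \<Rightarrow> r) * x $ i)"
proof -
  have "(\<Sum>j\<in>UNIV. (if i = j then c i else 0) * x $ j) = c i * x $ i" for i and c :: "'a heis_index \<Rightarrow> real"
    by (subst sum.remove[of _ i]) (auto intro!: sum.neutral)
  then show ?thesis
    by (simp add: heis_dilation_def matrix_vector_mult_def vec_eq_iff)
qed

lemma det_heis_dilation: "det (heis_dilation r :: 'n::finite heis_matrix) = r ^ heis_dim TYPE('n)"
proof -
  have "det (heis_dilation r :: 'n heis_matrix)
      = (\<Prod>i\<in>UNIV. (heis_dilation r :: 'n heis_matrix) $ i $ i)"
    by (rule det_diagonal) (simp add: heis_dilation_def)
  also have "\<dots> = r\<^sup>2 * (\<Prod>k\<in>(UNIV :: ('n + 'n) set). r)"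
    by (simp add: heis_dilation_def UNIV_option_conv prod.reindex)
  also have "\<dots> = r ^ heis_dim TYPE('n)"
    by (simp add: heis_dim_def power_add[symmetric] card_Plus UNIV_Plus_UNIV[symmetric] mult_2 del: UNIV_Plus_UNIV)
  finally show ?thesis .
qed

lemma heis_norm_dilation:
  assumes "0 \<le> r"
  shows "heis_norm (heis_dilation r *v x) = r * heis_norm x"
proof -
  have "heis_norm (heis_dilation r *v x) ^ 4 = (r * heis_norm x) ^ 4"
  proof -
    have "(\<Sum>k\<in>UNIV. (r * x $ Some k)\<^sup>2) = r\<^sup>2 * (\<Sum>k\<in>UNIV. (x $ Some k)\<^sup>2)"
      by (simp add: power_mult_distrib sum_distrib_left)
    then have "heis_norm (heis_dilation r *v x) ^ 4
        = (r\<^sup>2)\<^sup>2 * ((\<Sum>k\<in>UNIV. (x $ Some k)\<^sup>2)\<^sup>2 + (x $ None)\<^sup>2)"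
      unfolding heis_norm_pow4 heis_dilation_mult by (simp add: power_mult_distrib distrib_left)
    then show ?thesis
      by (simp add: heis_norm_pow4 power_mult_distrib)
  qed
  then show ?thesis
    by (rule power_eq_imp_eq_base) (use assms in auto)
qed

lemma measure_heis_ball_0:
  assumes "0 < r"
  shows "measure lebesgue (heis_ball 0 r :: 'n::finite heis set)
    = r ^ heis_dim TYPE('n) * measure lebesgue (heis_ball 0 1 :: 'n heis set)"
proof -
  have "(*v) (heis_dilation r) ` heis_ball 0 1 = (heis_ball 0 r :: 'n heis set)"
  proof (intro set_eqI iffI)
    fix x :: "'n heis" assume x: "x \<in> heis_ball 0 r"
    have "x = heis_dilation r *v (heis_dilation (1 / r) *v x)"
      using assms by (simp add: heis_dilation_mult vec_eq_iff power_divide split: option.split)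
    moreover have "heis_dilation (1 / r) *v x \<in> heis_ball 0 1"
      using x assms by (simp add: heis_ball_0 heis_norm_dilation)
    ultimately show "x \<in> (*v) (heis_dilation r) ` heis_ball 0 1"
      by blast
  qed (use assms in \<open>auto simp: heis_ball_0 heis_norm_dilation\<close>)
  then show ?thesis
    using measure_matrix_image(2)[OF heis_ball_0_lmeasurable, of "heis_dilation r :: 'n heis_matrix" 1] assms
    by (simp add: det_heis_dilation)
qed

lemma heis_norm_matrix_vector_le:
  assumes "heis_matrix_norm M = ennreal N" "0 \<le> N"
  shows "heis_norm (M *v x) \<le> N * heis_norm x"
proof (cases "x = 0")
  case False
  then have "ennreal (heis_norm (M *v x) / heis_norm x) \<le> heis_matrix_norm M"
    unfolding heis_matrix_norm_def by (intro SUP_upper) auto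
  then show ?thesis
    using assms False by (simp add: ennreal_le_iff divide_le_eq)
qed simp

lemma heis_matrix_norm_pos:
  fixes M :: "'n::finite heis_matrix"
  assumes "heis_matrix_norm M = ennreal N" "0 \<le> N" "det M \<noteq> 0"
  shows "0 < N"
proof (rule ccontr)
  assume "\<not> 0 < N"
  with assms have "N = 0" by simp
  then have "heis_norm (M *v x) \<le> 0" for x
    using heis_norm_matrix_vector_le[OF assms(1,2), of x] by simp
  then have "M *v x = 0" for x
    by (metis heis_norm_eq_0_iff heis_norm_nonneg order_antisym)
  then have "M = 0"
    by (simp add: matrix_eq)
  then have "row undefined M = 0"
    by (simp add: row_def vec_eq_iff)
  then show False
    using assms(3) det_zero_row(2) by blast
qed

lemma matrix_image_heis_ball_0:
  assumes "heis_matrix_norm M = ennreal N" "0 < N" "x \<in> heis_ball 0 r"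
  shows "M *v x \<in> heis_ball 0 (N * r)"
proof -
  have "heis_norm (M *v x) \<le> N * heis_norm x"
    using assms by (intro heis_norm_matrix_vector_le) auto
  also have "\<dots> < N * r"
    using assms by (simp add: heis_ball_0)
  finally show ?thesis
    by (simp add: heis_ball_0)
qed

text \<open>
  The matrix maps the unit ball into the ball of radius \<open>N\<close>; compare the volumes.
\<close>

lemma abs_det_le_heis_matrix_norm:
  fixes M :: "'n::finite heis_matrix"
  assumes "heis_matrix_norm M = ennreal N" "0 < N"
  shows "\<bar>det M\<bar> \<le> N ^ heis_dim TYPE('n)"
proof -
  let ?B = "\<lambda>r. heis_ball 0 r :: 'n heis set"
  have "\<bar>det M\<bar> * measure lebesgue (?B 1) = measure lebesgue ((*v) M ` ?B 1)"
    by (rule measure_matrix_image(2)[OF heis_ball_0_lmeasurable, symmetric])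
  also have "\<dots> \<le> measure lebesgue (?B N)"
    using matrix_image_heis_ball_0[OF assms, of _ 1]
    by (intro measure_mono_fmeasurable heis_ball_0_lmeasurable fmeasurableD
        measure_matrix_image(1)[OF heis_ball_0_lmeasurable]) auto
  also have "\<dots> = N ^ heis_dim TYPE('n) * measure lebesgue (?B 1)"
    by (rule measure_heis_ball_0) fact
  finally show ?thesis
    using measure_heis_ball_0_pos[of 1, where 'a = 'n] by simp
qed

lemma matrix_vector_mult_measurable [measurable (raw)]:
  fixes A :: "'a \<Rightarrow> real^'k^'m" and x :: "'a \<Rightarrow> real^'k"
  assumes "A \<in> borel_measurable M" "x \<in> borel_measurable M"
  shows "(\<lambda>t. A t *v x t) \<in> borel_measurable M"
proof -
  have "continuous_on UNIV (\<lambda>p :: (real^'k^'m) \<times> (real^'k). fst p *v snd p)"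
    unfolding matrix_vector_mult_def
    by (intro continuous_on_vec_lambda continuous_intros)
  with assms show ?thesis
    by (rule borel_measurable_continuous_Pair)
qed

lemma det_measurable [measurable]: "(det :: real^'k^'k \<Rightarrow> real) \<in> borel_measurable borel"
  by (intro borel_measurable_continuous_onI) (simp add: det_def, intro continuous_intros)

text \<open>
  A supremum of continuous functions of the matrix is lower semicontinuous.
\<close>

lemma heis_matrix_norm_measurable [measurable]: "(heis_matrix_norm :: 'n::finite heis_matrix \<Rightarrow> ennreal) \<in> borel_measurable borel"
proof (rule borel_measurableI_greater)
  fix c :: ennreal
  have "{M :: 'n heis_matrix. c < heis_matrix_norm M}
      = (\<Union>x\<in>-{0}. {M. c < ennreal (heis_norm (M *v x) / heis_norm x)})"
    unfolding heis_matrix_norm_def by (auto simp: less_SUP_iff)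
  moreover have "open \<dots>"
  proof (intro open_UN ballI open_Collect_less continuous_on_const)
    fix x :: "'n heis" assume "x \<in> -{0}"
    have "continuous_on UNIV (\<lambda>M::'n heis_matrix. M *v x)"
      unfolding matrix_vector_mult_def by (intro continuous_on_vec_lambda continuous_intros)
    from continuous_on_compose2[OF continuous_on_heis_norm[of UNIV] this]
    have "continuous_on UNIV (\<lambda>M::'n heis_matrix. heis_norm (M *v x))"
      by simp
    then show "continuous_on UNIV (\<lambda>M::'n heis_matrix. ennreal (heis_norm (M *v x) / heis_norm x))"
      using \<open>x \<in> -{0}\<close> by (intro continuous_on_ennreal continuous_intros) auto
  qed
  ultimately have "open {M :: 'n heis_matrix. c < heis_matrix_norm M}"
    by simp
  then show "{M \<in> space (borel :: 'n heis_matrix measure). c < heis_matrix_norm M} \<in> sets borel"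
    by (simp only: space_borel UNIV_I simp_thms borel_open)
qed

lemma nn_integral_heis_ball_matrix_le:
  fixes M :: "'n::finite heis_matrix" and g :: "'n heis \<Rightarrow> ennreal"
  assumes "heis_matrix_norm M = ennreal N" "0 < N" "det M \<noteq> 0"
    and [measurable]: "g \<in> borel_measurable borel"
  shows "ennreal \<bar>det M\<bar> * (\<integral>\<^sup>+x\<in>heis_ball 0 r. g (M *v x) \<partial>lebesgue)
    \<le> (\<integral>\<^sup>+x\<in>heis_ball 0 (N * r). g x \<partial>lebesgue)"
proof -
  have "ennreal \<bar>det M\<bar> * (\<integral>\<^sup>+x\<in>heis_ball 0 r. g (M *v x) \<partial>lborel)
    \<le> ennreal \<bar>det M\<bar> * (\<integral>\<^sup>+x. g (M *v x) * indicator (heis_ball 0 (N * r)) (M *v x) \<partial>lborel)"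
    using matrix_image_heis_ball_0[OF assms(1,2)]
    by (intro mult_left_mono nn_integral_mono) (auto simp: indicator_def)
  also have "\<dots> = (\<integral>\<^sup>+x\<in>heis_ball 0 (N * r). g x \<partial>lborel)"
    by (rule nn_integral_matrix_image[symmetric]) (use assms in measurable)
  finally show ?thesis
    by (simp add: nn_integral_completion)
qed

section \<open>Normalised measures on balls\<close>

lemma epow_ennreal_pos: "0 < a \<Longrightarrow> epow (ennreal a) e = ennreal (a powr e)"
  by (auto simp: epow_def ennreal_eq_0_iff)

lemma epow_ennreal: "0 \<le> a \<Longrightarrow> 0 < e \<Longrightarrow> epow (ennreal a) e = ennreal (a powr e)"
  by (cases "a = 0") (auto simp: epow_ennreal_pos epow_def)

lemma epow_top: "0 < e \<Longrightarrow> epow top e = top"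
  by (simp add: epow_def)

lemma epow_0_neg: "e < 0 \<Longrightarrow> epow 0 e = top"
  by (simp add: epow_def)

lemma epow_measurable [measurable]: "(\<lambda>x. epow x e) \<in> borel_measurable borel"
  unfolding epow_def by measurable

lemma locally_integrable_measurable:
  fixes f :: "'a::euclidean_space \<Rightarrow> 'b::euclidean_space"
  assumes "locally_integrable f"
  shows "f \<in> borel_measurable lebesgue"
proof (rule borel_measurable_LIMSEQ_metric)
  show "(\<lambda>x. indicator (cball 0 (real k)) x *\<^sub>R f x) \<in> borel_measurable lebesgue" for k
    using assms compact_cball[of 0 "real k"] unfolding locally_integrable_def set_integrable_def
    by (meson borel_measurable_integrable)
  fix x :: 'a
  obtain k0 :: nat where k0: "norm x \<le> real k0"
    using real_arch_simple[of "norm x"] by auto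
  have "\<forall>\<^sub>F k in sequentially. indicator (cball 0 (real k)) x *\<^sub>R f x = f x"
    using eventually_ge_at_top[of k0]
  proof eventually_elim
    fix k assume "k0 \<le> k"
    then have "x \<in> cball 0 (real k)"
      using k0 by simp
    then show "indicator (cball 0 (real k)) x *\<^sub>R f x = f x"
      by simp
  qed
  then show "(\<lambda>k. indicator (cball 0 (real k)) x *\<^sub>R f x) \<longlonglongrightarrow> f x"
    by (rule tendsto_eventually)
qed

lemma nn_integral_norm_less_top:
  assumes "locally_integrable f" "bounded S"
  shows "(\<integral>\<^sup>+x\<in>S. ennreal (norm (f x)) \<partial>lebesgue) < \<infinity>"
proof -
  have "(\<integral>\<^sup>+x\<in>S. ennreal (norm (f x)) \<partial>lebesgue)
      \<le> (\<integral>\<^sup>+x. ennreal (norm (indicator (closure S) x *\<^sub>R f x)) \<partial>lebesgue)"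
    using closure_subset by (intro nn_integral_mono) (auto simp: indicator_def)
  also have "\<dots> < \<infinity>"
    using assms unfolding locally_integrable_def set_integrable_def integrable_iff_bounded
    by (auto simp: compact_closure)
  finally show ?thesis .
qed

text \<open>
  The normalisation makes these probability measures, so that norms increase with the exponent and Hoelder's
  inequality may be used with slack. The density \<open>1\<close> gives the Lebesgue mean over the ball.
\<close>

definition ball_prob :: "('n::finite heis \<Rightarrow> real) \<Rightarrow> real \<Rightarrow> 'n heis measure" where
  "ball_prob v r = density lebesgue
     (\<lambda>x. ennreal (v x / enn2real (wmeasure v (heis_ball 0 r))) * indicator (heis_ball 0 r) x)"

definition normalizable_ball :: "('n::finite heis \<Rightarrow> real) \<Rightarrow> real \<Rightarrow> bool" where
  "normalizable_ball v r \<longleftrightarrow> v \<in> borel_measurable lebesgue \<and> (\<forall>x. 0 \<le> v x) \<and>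
     0 < wmeasure v (heis_ball 0 r) \<and> wmeasure v (heis_ball 0 r) < \<infinity>"

lemma measurable_ball_prob [simp]: "borel_measurable (ball_prob v r) = borel_measurable lebesgue"
  unfolding ball_prob_def by (rule measurable_cong_sets) auto

lemma heis_ball_0_lebesgue [measurable]: "heis_ball 0 r \<in> sets lebesgue"
  using heis_ball_0_borel by auto

lemma normalizable_ball_enn2real:
  assumes "normalizable_ball v r"
  shows "0 < enn2real (wmeasure v (heis_ball 0 r))"
    and "ennreal (enn2real (wmeasure v (heis_ball 0 r))) = wmeasure v (heis_ball 0 r)"
  using assms by (auto simp: normalizable_ball_def enn2real_positive_iff)

lemma nn_integral_ball_prob:
  assumes v: "normalizable_ball v r" and [measurable]: "g \<in> borel_measurable lebesgue"
  shows "(\<integral>\<^sup>+x. g x \<partial>ball_prob v r)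
    = (\<integral>\<^sup>+x\<in>heis_ball 0 r. ennreal (v x) * g x \<partial>lebesgue)
        * ennreal (1 / enn2real (wmeasure v (heis_ball 0 r)))"
proof -
  have [measurable]: "v \<in> borel_measurable lebesgue" and v0: "\<And>x. 0 \<le> v x"
    using v by (auto simp: normalizable_ball_def)
  note m = normalizable_ball_enn2real[OF v]
  show ?thesis
    unfolding ball_prob_def using v0 m(1)
    by (subst nn_integral_density, simp, simp, subst nn_integral_multc[symmetric], simp)
      (auto intro!: nn_integral_cong simp: divide_inverse ennreal_mult mult_ac)
qed

lemma emeasure_ball_prob:
  assumes "normalizable_ball v r"
  shows "emeasure (ball_prob v r) (space (ball_prob v r)) = 1"
proof -
  note m = normalizable_ball_enn2real[OF assms]
  have "emeasure (ball_prob v r) (space (ball_prob v r)) = (\<integral>\<^sup>+x. 1 \<partial>ball_prob v r)"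
    by simp
  also have "\<dots> = wmeasure v (heis_ball 0 r) * ennreal (1 / enn2real (wmeasure v (heis_ball 0 r)))"
    by (subst nn_integral_ball_prob[OF assms]) (auto simp: wmeasure_def)
  also have "\<dots> = ennreal (enn2real (wmeasure v (heis_ball 0 r)) * (1 / enn2real (wmeasure v (heis_ball 0 r))))"
    using m by (simp only: ennreal_mult[OF less_imp_le[OF m(1)], of "1 / _"] zero_le_divide_1_iff less_imp_le)
  also have "\<dots> = 1"
    using m(1) by simp
  finally show ?thesis .
qed

lemma emeasure_ball_prob_le_1:
  "normalizable_ball v r \<Longrightarrow> emeasure (ball_prob v r) (space (ball_prob v r)) \<le> 1"
  by (simp add: emeasure_ball_prob)

lemma Lp_bound_ball_prob_iff:
  assumes v: "normalizable_ball v r" and p: "0 < p"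
  shows "Lp_bound (ball_prob v r) p g X \<longleftrightarrow> g \<in> borel_measurable lebesgue \<and> 0 \<le> X \<and>
    (\<integral>\<^sup>+x\<in>heis_ball 0 r. ennreal (\<bar>g x\<bar> powr p * v x) \<partial>lebesgue)
      \<le> ennreal (enn2real (wmeasure v (heis_ball 0 r)) * X powr p)"
proof (cases "g \<in> borel_measurable lebesgue \<and> 0 \<le> X")
  case True
  then have [measurable]: "g \<in> borel_measurable lebesgue" by simp
  define m where "m = enn2real (wmeasure v (heis_ball 0 r))"
  have m: "0 < m"
    using normalizable_ball_enn2real(1)[OF v] by (simp add: m_def)
  have v0: "\<And>x. 0 \<le> v x"
    using v by (auto simp: normalizable_ball_def)
  define I where "I = (\<integral>\<^sup>+x\<in>heis_ball 0 r. ennreal (\<bar>g x\<bar> powr p * v x) \<partial>lebesgue)"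
  have "(\<integral>\<^sup>+x. ennreal (\<bar>g x\<bar> powr p) \<partial>ball_prob v r) = I * ennreal (1 / m)"
    unfolding I_def m_def using v0
    by (subst nn_integral_ball_prob[OF v]) (auto simp: ennreal_mult mult.commute)
  moreover have "I * ennreal (1 / m) \<le> ennreal (X powr p) \<longleftrightarrow> I \<le> ennreal (m * X powr p)"
  proof
    assume "I * ennreal (1 / m) \<le> ennreal (X powr p)"
    then have "I * ennreal (1 / m) * ennreal m \<le> ennreal (X powr p) * ennreal m"
      by (rule mult_right_mono) simp
    then show "I \<le> ennreal (m * X powr p)"
      using m by (simp add: mult.assoc ennreal_mult[symmetric] mult.commute[of m])
  next
    assume "I \<le> ennreal (m * X powr p)"
    then have "I * ennreal (1 / m) \<le> ennreal (m * X powr p) * ennreal (1 / m)"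
      by (rule mult_right_mono) simp
    then show "I * ennreal (1 / m) \<le> ennreal (X powr p)"
      using m by (simp add: ennreal_mult[symmetric])
  qed
  ultimately show ?thesis
    using True by (simp add: Lp_bound_def I_def m_def)
qed (auto simp: Lp_bound_def)

abbreviation ball_mean :: "real \<Rightarrow> 'n::finite heis measure" where
  "ball_mean \<equiv> ball_prob (\<lambda>_. 1)"

lemma wmeasure_1:
  "wmeasure (\<lambda>_. 1) (heis_ball 0 r :: 'n::finite heis set) = ennreal (measure lebesgue (heis_ball 0 r :: 'n heis set))"
proof -
  have "wmeasure (\<lambda>_. 1) (heis_ball 0 r :: 'n heis set) = emeasure lebesgue (heis_ball 0 r :: 'n heis set)"
    by (simp add: wmeasure_def)
  also have "\<dots> = ennreal (measure lebesgue (heis_ball 0 r :: 'n heis set))"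
    by (intro emeasure_eq_ennreal_measure fmeasurableD2[OF heis_ball_0_lmeasurable])
  finally show ?thesis .
qed

lemma normalizable_ball_1: "0 < r \<Longrightarrow> normalizable_ball (\<lambda>_ :: 'n::finite heis. 1) r"
  using measure_heis_ball_0_pos[of r, where 'a = 'n] by (simp add: normalizable_ball_def wmeasure_1)

lemma Lp_bound_ball_mean_iff:
  fixes g :: "'n::finite heis \<Rightarrow> real"
  assumes "0 < r" "0 < p"
  shows "Lp_bound (ball_mean r) p g X \<longleftrightarrow> g \<in> borel_measurable lebesgue \<and> 0 \<le> X \<and>
    (\<integral>\<^sup>+x\<in>heis_ball 0 r. ennreal (\<bar>g x\<bar> powr p) \<partial>lebesgue)
      \<le> ennreal (measure lebesgue (heis_ball 0 r :: 'n heis set) * X powr p)"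
  using Lp_bound_ball_prob_iff[OF normalizable_ball_1[OF assms(1)] assms(2), of g X]
  by (simp add: wmeasure_1)

lemma L1_bound_ball_prob_iff:
  assumes "normalizable_ball v r"
  shows "Lp_bound (ball_prob v r) 1 g X \<longleftrightarrow> g \<in> borel_measurable lebesgue \<and> 0 \<le> X \<and>
    (\<integral>\<^sup>+x\<in>heis_ball 0 r. ennreal (\<bar>g x\<bar> * v x) \<partial>lebesgue)
      \<le> ennreal (enn2real (wmeasure v (heis_ball 0 r)) * X)"
  using Lp_bound_ball_prob_iff[OF assms zero_less_one] by auto

lemma L1_bound_ball_mean_iff:
  fixes g :: "'n::finite heis \<Rightarrow> real"
  assumes "0 < r"
  shows "Lp_bound (ball_mean r) 1 g X \<longleftrightarrow> g \<in> borel_measurable lebesgue \<and> 0 \<le> X \<and>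
    (\<integral>\<^sup>+x\<in>heis_ball 0 r. ennreal \<bar>g x\<bar> \<partial>lebesgue)
      \<le> ennreal (measure lebesgue (heis_ball 0 r :: 'n heis set) * X)"
  using Lp_bound_ball_mean_iff[OF assms zero_less_one] by auto

lemma integral_eq_mean_on:
  fixes g :: "'n::finite heis \<Rightarrow> ennreal"
  assumes "0 < r"
  shows "(\<integral>\<^sup>+x\<in>heis_ball 0 r. g x \<partial>lebesgue)
    = ennreal (measure lebesgue (heis_ball 0 r :: 'n heis set)) * mean_on (heis_ball 0 r) g"
proof -
  have "emeasure lebesgue (heis_ball 0 r :: 'n heis set)
      = ennreal (measure lebesgue (heis_ball 0 r :: 'n heis set))"
    by (intro emeasure_eq_ennreal_measure fmeasurableD2[OF heis_ball_0_lmeasurable])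
  moreover have "0 < measure lebesgue (heis_ball 0 r :: 'n heis set)"
    by (rule measure_heis_ball_0_pos) fact
  ultimately show ?thesis
    unfolding mean_on_def
    by (simp only: mult.commute[of "ennreal _"]) (simp add: ennreal_divide_times ennreal_mult_divide_eq mult_divide_eq_ennreal)
qed

section \<open>Muckenhoupt and reverse Hoelder weights\<close>

lemma weight_measurable: "weight w \<Longrightarrow> w \<in> borel_measurable lebesgue"
  and weight_nonneg: "weight w \<Longrightarrow> 0 \<le> w x"
  by (auto simp: weight_def intro: locally_integrable_measurable)

lemma wmeasure_less_top:
  assumes "weight w" "bounded S"
  shows "wmeasure w S < \<infinity>"
  using nn_integral_norm_less_top[of w S] assms by (simp add: weight_def wmeasure_def)

lemma mean_on_weight:
  fixes w :: "'n::finite heis \<Rightarrow> real"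
  assumes "weight w" "0 < r"
  shows "mean_on (heis_ball 0 r) (\<lambda>y. ennreal (w y))
    = ennreal (enn2real (wmeasure w (heis_ball 0 r)) / measure lebesgue (heis_ball 0 r :: 'n heis set))"
proof -
  have M: "0 < measure lebesgue (heis_ball 0 r :: 'n heis set)"
    by (rule measure_heis_ball_0_pos) fact
  have "wmeasure w (heis_ball 0 r) = ennreal (enn2real (wmeasure w (heis_ball 0 r)))"
    using wmeasure_less_top[OF assms(1) bounded_heis_ball_0] by simp
  moreover have "emeasure lebesgue (heis_ball 0 r :: 'n heis set)
      = ennreal (measure lebesgue (heis_ball 0 r :: 'n heis set))"
    by (intro emeasure_eq_ennreal_measure fmeasurableD2[OF heis_ball_0_lmeasurable])
  ultimately show ?thesis
    unfolding mean_on_def wmeasure_def[symmetric] using M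
    by (metis divide_ennreal enn2real_nonneg)
qed

text \<open>
  For \<open>q > 1\<close> this is Hoelder's inequality for \<open>g = (g w\<^bsup>1/q\<^esup>)
  w\<^bsup>-1/q\<^esup>\<close>, where the condition controls the product of the two norms. The mean of the
  negative power of \<open>w\<close> is finite because it is multiplied by a positive mean; hence \<open>w >
  0\<close> almost everywhere on the ball. For \<open>q = 1\<close> the weight is bounded below by a
  multiple of its mean. That the ball has positive weight is an assumption here, and the first half of the
  conclusion serves to remove it.
\<close>

lemma muckenhoupt_ball:
  fixes w :: "'n::finite heis \<Rightarrow> real"
  assumes "1 \<le> q" and w: "muckenhoupt q w"
  shows "\<exists>C>0. \<forall>r>0. 0 < wmeasure w (heis_ball 0 r) \<longrightarrow>
    (AE x in lebesgue. x \<in> heis_ball 0 r \<longrightarrow> 0 < w x) \<and>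
    (\<forall>g X. Lp_bound (ball_prob w r) q g X \<longrightarrow> Lp_bound (ball_mean r) 1 g (C * X))"
proof -
  have wt: "weight w"
    using w by (simp add: muckenhoupt_def)
  note [measurable] = weight_measurable[OF wt] and w0 = weight_nonneg[OF wt]
  define M where "M r = measure lebesgue (heis_ball 0 r :: 'n heis set)" for r
  define m where "m r = enn2real (wmeasure w (heis_ball 0 r))" for r
  have M: "0 < M r" if "0 < r" for r
    unfolding M_def by (rule measure_heis_ball_0_pos) fact
  have mean: "mean_on (heis_ball 0 r) (\<lambda>y. ennreal (w y)) = ennreal (m r / M r)" if "0 < r" for r
    unfolding m_def M_def by (rule mean_on_weight) fact+
  have bw: "normalizable_ball w r" and m: "0 < m r" if "0 < wmeasure w (heis_ball 0 r)" for r
    using that wmeasure_less_top[OF wt bounded_heis_ball_0, of r] w0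
    by (auto simp: normalizable_ball_def m_def enn2real_positive_iff)
  show ?thesis
  proof (cases "q = 1")
    case True
    then obtain C0 where C0: "\<And>r. 0 < r \<Longrightarrow> ennreal (m r / M r)
        \<le> ennreal C0 * ess_inf_on (heis_ball 0 r) (\<lambda>y. ennreal (w y))"
      using w mean unfolding muckenhoupt_def by metis
    define C where "C = max C0 0 + 1"
    have C: "0 < C" "C0 < C" "0 \<le> max C0 0" "max C0 0 < C"
      by (auto simp: C_def)
    show ?thesis
    proof (intro exI[of _ C] conjI allI impI C)
      fix r :: real assume r: "0 < r" and pos: "0 < wmeasure w (heis_ball 0 r)"
      define t where "t = m r / M r / C"
      have t: "0 < t"
        using m[OF pos] M[OF r] C by (simp add: t_def)
      \<comment> \<open>The strict inequality \<open>C0 < C\<close> puts \<open>t\<close> strictly below the essential infimum, so that an essential lower bound lies above \<open>t\<close>.\<close>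
      have "ennreal t < ess_inf_on (heis_ball 0 r) (\<lambda>y. ennreal (w y))"
      proof (rule ccontr)
        assume "\<not> ?thesis"
        then have "ennreal (m r / M r) \<le> ennreal (max C0 0) * ennreal t"
          using C0[OF r] by (auto intro!: mult_mono ennreal_leI elim!: order_trans)
        then have "m r / M r \<le> max C0 0 * t"
          using t by (simp add: ennreal_mult[symmetric] ennreal_le_iff)
        also have "\<dots> < C * t"
          using C t by (intro mult_strict_right_mono) auto
        also have "\<dots> = m r / M r"
          using C by (simp add: t_def)
        finally show False by simp
      qed
      then obtain c where c: "ennreal t < c" "AE x in lebesgue. x \<in> heis_ball 0 r \<longrightarrow> c \<le> ennreal (w x)"
        unfolding ess_inf_on_def less_Sup_iff by auto
      from c(2) have AE: "AE x in lebesgue. x \<in> heis_ball 0 r \<longrightarrow> t \<le> w x"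
      proof eventually_elim
        fix x assume x: "x \<in> heis_ball 0 r \<longrightarrow> c \<le> ennreal (w x)"
        show "x \<in> heis_ball 0 r \<longrightarrow> t \<le> w x"
        proof
          assume "x \<in> heis_ball 0 r"
          with x c(1) have "ennreal t \<le> ennreal (w x)"
            by (metis less_le_trans less_imp_le)
          then show "t \<le> w x"
            using w0 by simp
        qed
      qed
      then show "AE x in lebesgue. x \<in> heis_ball 0 r \<longrightarrow> 0 < w x"
        using t by (auto elim!: eventually_mono)
      fix g X assume "Lp_bound (ball_prob w r) q g X"
      then have g [measurable]: "g \<in> borel_measurable lebesgue" and X: "0 \<le> X"
        and le: "(\<integral>\<^sup>+x\<in>heis_ball 0 r. ennreal (\<bar>g x\<bar> * w x) \<partial>lebesgue) \<le> ennreal (m r * X)"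
        using True Lp_bound_ball_prob_iff[OF bw[OF pos], of 1 g X] by (auto simp: m_def)
      have "(\<integral>\<^sup>+x\<in>heis_ball 0 r. ennreal \<bar>g x\<bar> \<partial>lebesgue)
          \<le> (\<integral>\<^sup>+x. ennreal (1 / t) * (ennreal (\<bar>g x\<bar> * w x) * indicator (heis_ball 0 r) x) \<partial>lebesgue)"
      proof (rule nn_integral_mono_AE)
        show "AE x in lebesgue. ennreal \<bar>g x\<bar> * indicator (heis_ball 0 r) x
            \<le> ennreal (1 / t) * (ennreal (\<bar>g x\<bar> * w x) * indicator (heis_ball 0 r) x)"
          using AE
        proof eventually_elim
          fix x assume x: "x \<in> heis_ball 0 r \<longrightarrow> t \<le> w x"
          show "ennreal \<bar>g x\<bar> * indicator (heis_ball 0 r) x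
            \<le> ennreal (1 / t) * (ennreal (\<bar>g x\<bar> * w x) * indicator (heis_ball 0 r) x)"
          proof (cases "x \<in> heis_ball 0 r")
            case True
            have "\<bar>g x\<bar> \<le> 1 / t * (\<bar>g x\<bar> * w x)"
              using mult_left_mono[of t "w x" "\<bar>g x\<bar>"] x True t by (simp add: field_simps)
            then show ?thesis
              using True t w0 by (simp add: ennreal_mult[symmetric] ennreal_leI del: times_divide_eq_left)
          qed simp
        qed
      qed
      also have "\<dots> = ennreal (1 / t) * (\<integral>\<^sup>+x\<in>heis_ball 0 r. ennreal (\<bar>g x\<bar> * w x) \<partial>lebesgue)"
        by (rule nn_integral_cmult) measurable
      also have "\<dots> \<le> ennreal (1 / t) * ennreal (m r * X)"
        using le by (rule mult_left_mono) simp
      also have "\<dots> = ennreal (M r * (C * X))"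
        using t X m[OF pos] M[OF r] C
        by (simp add: ennreal_mult[symmetric] t_def mult_ac)
      finally show "Lp_bound (ball_mean r) 1 g (C * X)"
        using r X C by (simp add: Lp_bound_ball_mean_iff M_def)
    qed
  next
    case False
    with assms have q: "1 < q" by simp
    define a where "a = - 1 / (q - 1)"
    have a: "a < 0"
      using q by (simp add: a_def divide_neg_pos)
    define V where "V r = mean_on (heis_ball 0 r) (\<lambda>y. epow (ennreal (w y)) a)" for r
    obtain C0 where C0: "\<And>r. 0 < r \<Longrightarrow> ennreal (m r / M r) * epow (V r) (q - 1) \<le> ennreal C0"
      using w False mean unfolding muckenhoupt_def V_def a_def by metis
    define C where "C = (max C0 0 + 1) powr (1 / q)"
    have "0 < C"
      by (simp add: C_def)
    show ?thesis
    proof (intro exI[of _ C] conjI allI impI \<open>0 < C\<close>)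
      fix r :: real assume r: "0 < r" and pos: "0 < wmeasure w (heis_ball 0 r)"
      have "V r \<noteq> \<infinity>"
      proof
        assume "V r = \<infinity>"
        then have "ennreal (m r / M r) * epow (V r) (q - 1) = \<infinity>"
          using q m[OF pos] M[OF r] by (simp add: epow_top ennreal_mult_top ennreal_mult_eq_top_iff)
        with C0[OF r] show False
          by (simp add: top_unique)
      qed
      then obtain v where v: "V r = ennreal v" "0 \<le> v"
        by (cases "V r") auto
      have intV: "(\<integral>\<^sup>+x\<in>heis_ball 0 r. epow (ennreal (w x)) a \<partial>lebesgue) = ennreal (M r * v)"
        using integral_eq_mean_on[OF r, of "\<lambda>y. epow (ennreal (w y)) a"] v M[OF r]
        by (simp add: V_def[symmetric] M_def[symmetric] ennreal_mult)
      have "AE x in lebesgue. epow (ennreal (w x)) a * indicator (heis_ball 0 r) x \<noteq> \<infinity>"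
        by (rule nn_integral_PInf_AE) (use intV in auto)
      then show AE: "AE x in lebesgue. x \<in> heis_ball 0 r \<longrightarrow> 0 < w x"
      proof eventually_elim
        fix x assume x: "epow (ennreal (w x)) a * indicator (heis_ball 0 r) x \<noteq> \<infinity>"
        show "x \<in> heis_ball 0 r \<longrightarrow> 0 < w x"
          using x w0[of x] epow_0_neg[OF a] by (cases "w x = 0") (auto simp: indicator_def)
      qed
      have mv: "m r / M r * v powr (q - 1) \<le> max C0 0 + 1"
      proof -
        have "epow (V r) (q - 1) = ennreal (v powr (q - 1))"
          using v q by (simp add: epow_ennreal)
        moreover have "ennreal (m r / M r * v powr (q - 1)) = ennreal (m r / M r) * ennreal (v powr (q - 1))"
          using m[OF pos] M[OF r] by (intro ennreal_mult) auto
        ultimately have "ennreal (m r / M r * v powr (q - 1)) \<le> ennreal C0"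
          using C0[OF r] by simp
        also have "\<dots> \<le> ennreal (max C0 0 + 1)"
          by (intro ennreal_leI) auto
        finally show ?thesis
          by (subst (asm) ennreal_le_iff) auto
      qed
      fix g X assume "Lp_bound (ball_prob w r) q g X"
      then have g [measurable]: "g \<in> borel_measurable lebesgue" and X: "0 \<le> X"
        and le: "(\<integral>\<^sup>+x\<in>heis_ball 0 r. ennreal (\<bar>g x\<bar> powr q * w x) \<partial>lebesgue) \<le> ennreal (m r * X powr q)"
        using q Lp_bound_ball_prob_iff[OF bw[OF pos], of q g X] by (auto simp: m_def)
      define q' where "q' = q / (q - 1)"
      have q': "0 < q'"
        using q by (simp add: q'_def)
      have "Lp_bound (ball_mean r) q (\<lambda>x. g x * w x powr (1 / q)) ((m r / M r) powr (1 / q) * X)"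
      proof -
        have "(\<integral>\<^sup>+x\<in>heis_ball 0 r. ennreal (\<bar>g x * w x powr (1 / q)\<bar> powr q) \<partial>lebesgue)
            = (\<integral>\<^sup>+x\<in>heis_ball 0 r. ennreal (\<bar>g x\<bar> powr q * w x) \<partial>lebesgue)"
          using q w0 by (simp add: abs_mult powr_mult powr_powr)
        also have "\<dots> \<le> ennreal (m r * X powr q)"
          by fact
        also have "m r * X powr q = M r * ((m r / M r) powr (1 / q) * X) powr q"
          using q M[OF r] m[OF pos] by (simp add: powr_mult powr_powr)
        finally show ?thesis
          using r q X by (simp add: Lp_bound_ball_mean_iff M_def)
      qed
      note H1 = this
      have H2: "Lp_bound (ball_mean r) q' (\<lambda>x. w x powr (- 1 / q)) (v powr (1 / q'))"
      proof -
        have "(\<integral>\<^sup>+x\<in>heis_ball 0 r. ennreal (\<bar>w x powr (- 1 / q)\<bar> powr q') \<partial>lebesgue)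
            = (\<integral>\<^sup>+x\<in>heis_ball 0 r. epow (ennreal (w x)) a \<partial>lebesgue)"
        proof (rule nn_integral_cong_AE)
          have "- 1 / q * q' = a"
            using q by (simp add: q'_def a_def)
          then show "AE x in lebesgue. ennreal (\<bar>w x powr (- 1 / q)\<bar> powr q') * indicator (heis_ball 0 r) x
              = epow (ennreal (w x)) a * indicator (heis_ball 0 r) x"
            using AE by (auto elim!: eventually_mono simp: epow_ennreal_pos powr_powr indicator_def)
        qed
        also have "\<dots> = ennreal (M r * (v powr (1 / q')) powr q')"
          using intV q' v by (simp add: powr_powr)
        finally show ?thesis
          using r q' by (simp add: Lp_bound_ball_mean_iff M_def)
      qed
      have "Lp_bound (ball_mean r) 1 (\<lambda>x. g x * w x powr (1 / q) * w x powr (- 1 / q))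
          ((m r / M r) powr (1 / q) * X * v powr (1 / q'))"
        using q q'
        by (intro Lp_bound_Hoelder[OF emeasure_ball_prob_le_1[OF normalizable_ball_1[OF r]] _ _ _ _ H1 H2])
          (auto simp: q'_def field_simps)
      moreover have "(m r / M r) powr (1 / q) * X * v powr (1 / q') \<le> C * X"
      proof -
        have "(m r / M r) powr (1 / q) * v powr (1 / q') = (m r / M r * v powr (q - 1)) powr (1 / q)"
          by (simp only: powr_mult powr_powr q'_def) simp
        also have "\<dots> \<le> C"
          unfolding C_def using mv q M[OF r] m[OF pos] by (intro powr_mono2) auto
        finally show ?thesis
          using X mult_right_mono by (fastforce simp: mult_ac)
      qed
      ultimately have H: "Lp_bound (ball_mean r) 1 (\<lambda>x. g x * w x powr (1 / q) * w x powr (- 1 / q)) (C * X)"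
        by (rule Lp_bound_mono) simp
      have "(\<integral>\<^sup>+x\<in>heis_ball 0 r. ennreal \<bar>g x * w x powr (1 / q) * w x powr (- 1 / q)\<bar> \<partial>lebesgue)
          = (\<integral>\<^sup>+x\<in>heis_ball 0 r. ennreal \<bar>g x\<bar> \<partial>lebesgue)"
        using AE by (intro nn_integral_cong_AE)
          (auto elim!: eventually_mono simp: indicator_def mult.assoc powr_add[symmetric])
      with H show "Lp_bound (ball_mean r) 1 g (C * X)"
        unfolding L1_bound_ball_mean_iff[OF r] by simp
    qed
  qed
qed

text \<open>
  A weight does not vanish almost everywhere, so it has positive mass on some centred ball, and then on
  every larger one; these balls exhaust the space.
\<close>

proposition muckenhoupt_positive:
  fixes w :: "'n::finite heis \<Rightarrow> real"
  assumes "1 \<le> q" and w: "muckenhoupt q w"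
  shows "AE x in lebesgue. 0 < w x"
proof -
  have wt: "weight w"
    using w by (simp add: muckenhoupt_def)
  note [measurable] = weight_measurable[OF wt] and w0 = weight_nonneg[OF wt]
  have zero: "AE x in lebesgue. x \<in> heis_ball 0 r \<longrightarrow> w x = 0" if "wmeasure w (heis_ball 0 r) = 0" for r
  proof -
    have "AE x in lebesgue. ennreal (w x) * indicator (heis_ball 0 r) x = 0"
      using that unfolding wmeasure_def by (subst (asm) nn_integral_0_iff_AE) auto
    then show ?thesis
      by eventually_elim (use w0 in \<open>auto simp: indicator_def split: if_splits\<close>)
  qed
  have "\<exists>k0::nat. 0 < wmeasure w (heis_ball 0 (real k0 + 1))"
  proof (rule ccontr)
    assume "\<not> ?thesis"
    then have "AE x in lebesgue. \<forall>k::nat. x \<in> heis_ball 0 (real k + 1) \<longrightarrow> w x = 0"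
      unfolding AE_all_countable by (auto intro!: zero)
    then have "AE x in lebesgue. w x = 0"
      by eventually_elim (use heis_ball_0_exhausts in blast)
    then show False
      using wt by (simp add: weight_def)
  qed
  then obtain k0 :: nat where k0: "0 < wmeasure w (heis_ball 0 (real k0 + 1))" ..
  have "AE x in lebesgue. x \<in> heis_ball 0 (real k + 1) \<longrightarrow> 0 < w x" for k :: nat
  proof -
    let ?r = "real (max k k0) + 1"
    have "wmeasure w (heis_ball 0 (real k0 + 1)) \<le> wmeasure w (heis_ball 0 ?r)"
      unfolding wmeasure_def using heis_ball_0_mono[of "real k0 + 1" ?r]
      by (intro nn_integral_mono) (auto simp: indicator_def)
    with k0 have "0 < wmeasure w (heis_ball 0 ?r)"
      by (rule less_le_trans)
    moreover have "0 < ?r"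
      by simp
    ultimately have "AE x in lebesgue. x \<in> heis_ball 0 ?r \<longrightarrow> 0 < w x"
      using muckenhoupt_ball[OF assms] by blast
    then show ?thesis
      by eventually_elim (use heis_ball_0_mono[of "real k + 1" ?r] in auto)
  qed
  then have "AE x in lebesgue. \<forall>k::nat. x \<in> heis_ball 0 (real k + 1) \<longrightarrow> 0 < w x"
    unfolding AE_all_countable by auto
  then show ?thesis
    by eventually_elim (use heis_ball_0_exhausts in blast)
qed

lemma muckenhoupt_normalizable_ball:
  fixes w :: "'n::finite heis \<Rightarrow> real"
  assumes "1 \<le> q" and w: "muckenhoupt q w" and "0 < r"
  shows "normalizable_ball w r"
proof -
  have wt: "weight w"
    using w by (simp add: muckenhoupt_def)
  note [measurable] = weight_measurable[OF wt]
  have "wmeasure w (heis_ball 0 r) \<noteq> 0"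
  proof
    assume "wmeasure w (heis_ball 0 r) = 0"
    then have "AE x in lebesgue. ennreal (w x) * indicator (heis_ball 0 r) x = 0"
      unfolding wmeasure_def by (subst (asm) nn_integral_0_iff_AE) auto
    with muckenhoupt_positive[OF assms(1,2)] have "AE x :: 'n heis in lebesgue. x \<notin> heis_ball 0 r"
      by eventually_elim (auto simp: indicator_def split: if_splits)
    then have "negligible (heis_ball 0 r :: 'n heis set)"
      by (simp add: AE_iff_null_sets[symmetric] negligible_iff_null_sets heis_ball_0_lebesgue)
    then show False
      using measure_heis_ball_0_pos[OF \<open>0 < r\<close>, where 'a = 'n] negligible_imp_measure0 by force
  qed
  then show ?thesis
    using weight_measurable[OF wt] weight_nonneg[OF wt] wmeasure_less_top[OF wt bounded_heis_ball_0]
    by (simp add: normalizable_ball_def zero_less_iff_neq_zero)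
qed

proposition muckenhoupt_Lp_bound:
  fixes w :: "'n::finite heis \<Rightarrow> real"
  assumes "1 \<le> q" and w: "muckenhoupt q w"
  obtains C where "0 < C"
    and "\<And>r g X. 0 < r \<Longrightarrow> Lp_bound (ball_prob w r) q g X \<Longrightarrow> Lp_bound (ball_mean r) 1 g (C * X)"
proof -
  obtain C where "0 < C" and C: "\<forall>r>0. 0 < wmeasure w (heis_ball 0 r) \<longrightarrow>
      (AE x in lebesgue. x \<in> heis_ball 0 r \<longrightarrow> 0 < w x) \<and>
      (\<forall>g X. Lp_bound (ball_prob w r) q g X \<longrightarrow> Lp_bound (ball_mean r) 1 g (C * X))"
    using muckenhoupt_ball[OF assms] by (elim exE conjE)
  show ?thesis
  proof (rule that[OF \<open>0 < C\<close>])
    fix r g X assume r: "0 < r" and "Lp_bound (ball_prob w r) q g X"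
    moreover have "0 < wmeasure w (heis_ball 0 r)"
      using muckenhoupt_normalizable_ball[OF assms r] by (simp add: normalizable_ball_def)
    ultimately show "Lp_bound (ball_mean r) 1 g (C * X)"
      using C by simp
  qed
qed

text \<open>
  Hoelder's inequality for the product \<open>g w\<close> with exponents \<open>s / (s - 1)\<close> and
  \<open>s\<close>; the reverse Hoelder condition bounds the second norm by the mean of \<open>w\<close>.
\<close>

proposition reverse_hoelder_Lp_bound:
  fixes w :: "'n::finite heis \<Rightarrow> real"
  assumes s: "1 < s" and w: "reverse_hoelder s w" and bw: "\<And>r. 0 < r \<Longrightarrow> normalizable_ball w r"
  obtains C where "0 < C"
    and "\<And>r g X. 0 < r \<Longrightarrow> Lp_bound (ball_mean r) (s / (s - 1)) g X \<Longrightarrow> Lp_bound (ball_prob w r) 1 g (C * X)"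
proof -
  have wt: "weight w"
    using w by (simp add: reverse_hoelder_def)
  note [measurable] = weight_measurable[OF wt] and w0 = weight_nonneg[OF wt]
  define M where "M r = measure lebesgue (heis_ball 0 r :: 'n heis set)" for r
  define m where "m r = enn2real (wmeasure w (heis_ball 0 r))" for r
  define U where "U r = mean_on (heis_ball 0 r) (\<lambda>y. epow (ennreal (w y)) s)" for r
  obtain C0 where C0: "\<And>r. 0 < r \<Longrightarrow> epow (U r) (1 / s) \<le> ennreal C0 * ennreal (m r / M r)"
    using w mean_on_weight[OF wt] unfolding reverse_hoelder_def U_def m_def M_def by metis
  define C where "C = max C0 0 + 1"
  have "0 < C"
    by (simp add: C_def)
  moreover have "Lp_bound (ball_prob w r) 1 g (C * X)"
    if r: "0 < r" and g: "Lp_bound (ball_mean r) (s / (s - 1)) g X" for r g X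
  proof -
    have gm [measurable]: "g \<in> borel_measurable lebesgue" and X: "0 \<le> X"
      using g by (auto simp: Lp_bound_def)
    have M: "0 < M r"
      unfolding M_def by (rule measure_heis_ball_0_pos) fact
    have m: "0 < m r"
      unfolding m_def by (rule normalizable_ball_enn2real(1)[OF bw[OF r]])
    have "ennreal C0 * ennreal (m r / M r) \<le> ennreal C * ennreal (m r / M r)"
      unfolding C_def by (intro mult_right_mono ennreal_leI) auto
    also have "\<dots> = ennreal (C * (m r / M r))"
      using m M \<open>0 < C\<close> by (intro ennreal_mult[symmetric]) auto
    finally have "ennreal C0 * ennreal (m r / M r) \<le> ennreal (C * (m r / M r))" .
    with C0[OF r] have U_le: "epow (U r) (1 / s) \<le> ennreal (C * (m r / M r))"
      by (rule order_trans)
    have "U r \<noteq> \<infinity>"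
      using U_le s by (auto simp: epow_top top_unique)
    then obtain u where u: "U r = ennreal u" "0 \<le> u"
      by (cases "U r") auto
    have "u powr (1 / s) \<le> C * (m r / M r)"
      using U_le u s m M \<open>0 < C\<close> by (simp add: epow_ennreal ennreal_le_iff)
    then have "(u powr (1 / s)) powr s \<le> (C * (m r / M r)) powr s"
      using s by (intro powr_mono2) auto
    then have u_le: "u \<le> (C * (m r / M r)) powr s"
      using s u by (simp add: powr_powr)
    have "Lp_bound (ball_mean r) s w (C * (m r / M r))"
    proof -
      have "(\<integral>\<^sup>+x\<in>heis_ball 0 r. ennreal (\<bar>w x\<bar> powr s) \<partial>lebesgue)
          = (\<integral>\<^sup>+x\<in>heis_ball 0 r. epow (ennreal (w x)) s \<partial>lebesgue)"
        using w0 s by (simp add: epow_ennreal)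
      also have "\<dots> = ennreal (M r * u)"
        using integral_eq_mean_on[OF r, of "\<lambda>y. epow (ennreal (w y)) s"] u M
        by (simp add: U_def[symmetric] M_def[symmetric] ennreal_mult)
      also have "\<dots> \<le> ennreal (M r * (C * (m r / M r)) powr s)"
        using u_le M by (intro ennreal_leI mult_left_mono) auto
      finally show ?thesis
        using r s m M \<open>0 < C\<close> by (simp add: Lp_bound_ball_mean_iff M_def)
    qed
    from Lp_bound_Hoelder[OF emeasure_ball_prob_le_1[OF normalizable_ball_1[OF r]] _ _ _ _ g this, of 1]
    have "Lp_bound (ball_mean r) 1 (\<lambda>x. g x * w x) (X * (C * (m r / M r)))"
      using s by (simp add: field_simps)
    then have "(\<integral>\<^sup>+x\<in>heis_ball 0 r. ennreal (\<bar>g x\<bar> * w x) \<partial>lebesgue) \<le> ennreal (M r * (X * (C * (m r / M r))))"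
      using w0 unfolding L1_bound_ball_mean_iff[OF r] M_def abs_mult by simp
    also have "M r * (X * (C * (m r / M r))) = m r * (C * X)"
      using M by simp
    finally show ?thesis
      using X \<open>0 < C\<close> unfolding L1_bound_ball_prob_iff[OF bw[OF r]] m_def by simp
  qed
  ultimately show ?thesis
    by (rule that)
qed

section \<open>Trading the weight for Lebesgue measure\<close>

text \<open>
  The estimates below use the weight only through these two comparisons of means. The parameters
  \<open>Q\<close> and \<open>vol\<close> are names for quantities that depend on nothing but the dimension.
\<close>

locale comparable_weight =
  fixes w :: "'n::finite heis \<Rightarrow> real" and q s Ca Cr Q :: real and vol :: "real \<Rightarrow> real"
  assumes Q: "Q = real (heis_dim TYPE('n))"
    and vol: "\<And>r. vol r = measure lebesgue (heis_ball 0 r :: 'n heis set)"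
    and normalizable_ball: "\<And>r. 0 < r \<Longrightarrow> normalizable_ball w r"
    and q: "1 \<le> q" and s: "1 < s" and Ca: "0 < Ca" and Cr: "0 < Cr"
    and Lebesgue_le_weight: "\<And>r g X. 0 < r \<Longrightarrow> Lp_bound (ball_prob w r) q g X
          \<Longrightarrow> Lp_bound (ball_mean r) 1 g (Ca * X)"
    and weight_le_Lebesgue: "\<And>r g X. 0 < r \<Longrightarrow> Lp_bound (ball_mean r) (s / (s - 1)) g X
          \<Longrightarrow> Lp_bound (ball_prob w r) 1 g (Cr * X)"
begin

definition wvol :: "real \<Rightarrow> real" where
  "wvol r = enn2real (wmeasure w (heis_ball 0 r))"

lemma w_measurable [measurable]: "w \<in> borel_measurable lebesgue" and w_nonneg: "0 \<le> w x"
  using normalizable_ball[of 1] by (auto simp: normalizable_ball_def)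

lemma vol_pos: "0 < r \<Longrightarrow> 0 < vol r"
  unfolding vol by (rule measure_heis_ball_0_pos)

lemma wvol_pos: "0 < r \<Longrightarrow> 0 < wvol r"
  unfolding wvol_def by (rule normalizable_ball_enn2real(1)[OF normalizable_ball])

lemma ennreal_wvol: "0 < r \<Longrightarrow> ennreal (wvol r) = wmeasure w (heis_ball 0 r)"
  unfolding wvol_def by (rule normalizable_ball_enn2real(2)[OF normalizable_ball])

lemma vol_scale:
  assumes "0 < r" "0 < t"
  shows "vol (t * r) = t powr Q * vol r"
proof -
  have "vol (t * r) = (t * r) ^ heis_dim TYPE('n) * vol 1" "vol r = r ^ heis_dim TYPE('n) * vol 1"
    unfolding vol using assms measure_heis_ball_0[of "t * r", where 'n = 'n] measure_heis_ball_0[of r, where 'n = 'n] by auto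
  then show ?thesis
    using assms by (simp add: Q powr_realpow power_mult_distrib)
qed

lemma Lp_bound_w_iff:
  assumes "0 < r" "0 < p"
  shows "Lp_bound (ball_prob w r) p g X \<longleftrightarrow> g \<in> borel_measurable lebesgue \<and> 0 \<le> X \<and>
    (\<integral>\<^sup>+x\<in>heis_ball 0 r. ennreal (\<bar>g x\<bar> powr p * w x) \<partial>lebesgue) \<le> ennreal (wvol r * X powr p)"
  unfolding wvol_def by (rule Lp_bound_ball_prob_iff[OF normalizable_ball[OF assms(1)] assms(2)])

lemma emeasure_prob: "0 < r \<Longrightarrow> emeasure (ball_prob w r) (space (ball_prob w r)) \<le> 1"
  by (intro emeasure_ball_prob_le_1 normalizable_ball)

text \<open>
  These are the integrals in the two comparisons when the function is the indicator of a smaller ball.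
\<close>

lemma indicator_integrals:
  fixes r R p :: real
  assumes "0 < r" "r \<le> R"
  shows "(\<integral>\<^sup>+x\<in>heis_ball 0 R. ennreal (\<bar>indicator (heis_ball 0 r) x\<bar> powr p * w x) \<partial>lebesgue) = ennreal (wvol r)"
    and "(\<integral>\<^sup>+x\<in>heis_ball 0 R. ennreal (\<bar>indicator (heis_ball 0 r) (x :: 'n heis)\<bar> powr p) \<partial>lebesgue) = ennreal (vol r)"
proof -
  have "(\<integral>\<^sup>+x\<in>heis_ball 0 R. ennreal (\<bar>indicator (heis_ball 0 r) x\<bar> powr p * w x) \<partial>lebesgue)
      = wmeasure w (heis_ball 0 r)"
    unfolding wmeasure_def using heis_ball_0_mono[OF assms(2), where 'a = 'n]
    by (intro nn_integral_cong) (auto simp: indicator_def)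
  then show "(\<integral>\<^sup>+x\<in>heis_ball 0 R. ennreal (\<bar>indicator (heis_ball 0 r) x\<bar> powr p * w x) \<partial>lebesgue) = ennreal (wvol r)"
    using ennreal_wvol[OF assms(1)] by simp
  have "(\<integral>\<^sup>+x\<in>heis_ball 0 R. ennreal (\<bar>indicator (heis_ball 0 r) (x :: 'n heis)\<bar> powr p) \<partial>lebesgue)
      = wmeasure (\<lambda>_ :: 'n heis. 1) (heis_ball 0 r)"
    unfolding wmeasure_def using heis_ball_0_mono[OF assms(2), where 'a = 'n]
    by (intro nn_integral_cong) (auto simp: indicator_def)
  then show "(\<integral>\<^sup>+x\<in>heis_ball 0 R. ennreal (\<bar>indicator (heis_ball 0 r) (x :: 'n heis)\<bar> powr p) \<partial>lebesgue) = ennreal (vol r)"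
    by (simp add: wmeasure_1 vol)
qed

text \<open>
  The first comparison for the indicator of the smaller ball; it is the doubling property of
  \<open>w\<close>.
\<close>

lemma vol_ratio_le:
  assumes "0 < r" "r \<le> R"
  shows "vol r / vol R \<le> Ca * (wvol r / wvol R) powr (1 / q)"
proof -
  have R: "0 < R" using assms by simp
  let ?X = "(wvol r / wvol R) powr (1 / q)"
  have "Lp_bound (ball_prob w R) q (indicator (heis_ball 0 r)) ?X"
    unfolding Lp_bound_w_iff[OF R less_le_trans[OF zero_less_one q]] indicator_integrals(1)[OF assms]
    using q wvol_pos[OF R] wvol_pos[OF assms(1)] by (simp add: powr_powr)
  from Lebesgue_le_weight[OF R this] have "ennreal (vol r) \<le> ennreal (vol R * (Ca * ?X))"
    unfolding Lp_bound_ball_mean_iff[OF R zero_less_one] indicator_integrals(2)[OF assms] vol[symmetric]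
    using Ca by simp
  then have "vol r \<le> vol R * (Ca * ?X)"
    using vol_pos[OF R] Ca by (subst (asm) ennreal_le_iff) auto
  then show ?thesis
    using vol_pos[OF R] by (simp add: field_simps)
qed

text \<open>
  The second comparison for the same indicator: \<open>w\<close> does not concentrate near the origin.
\<close>

lemma wvol_ratio_le:
  assumes "0 < r" "r \<le> R"
  shows "wvol r / wvol R \<le> Cr * (vol r / vol R) powr ((s - 1) / s)"
proof -
  have R: "0 < R" using assms by simp
  let ?X = "(vol r / vol R) powr ((s - 1) / s)"
  have s': "0 < s / (s - 1)"
    using s by simp
  have "Lp_bound (ball_mean R) (s / (s - 1)) (indicator (heis_ball 0 r) :: 'n heis \<Rightarrow> real) ?X"
    unfolding Lp_bound_ball_mean_iff[OF R s'] indicator_integrals(2)[OF assms] vol[symmetric]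
    using s vol_pos[OF R] vol_pos[OF assms(1)] by (simp add: powr_powr)
  from weight_le_Lebesgue[OF R this] have "ennreal (wvol r) \<le> ennreal (wvol R * (Cr * ?X))"
    unfolding Lp_bound_w_iff[OF R zero_less_one] indicator_integrals(1)[OF assms]
    using Cr by simp
  then have "wvol r \<le> wvol R * (Cr * ?X)"
    using wvol_pos[OF R] Cr by (subst (asm) ennreal_le_iff) auto
  then show ?thesis
    using wvol_pos[OF R] by (simp add: field_simps)
qed

definition morrey_exponent :: "real \<Rightarrow> real \<Rightarrow> real \<Rightarrow> real" where
  "morrey_exponent lam delta t = (if 1 < t then Q * lam * (delta - 1) / delta else Q * lam * q)"

text \<open>
  As \<open>\<lambda> < 0\<close>, an upper bound is needed for \<open>w(B) / w(tB)\<close>. If \<open>t >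
  1\<close> it comes from the reverse Hoelder side, where \<open>(delta - 1) / delta \<le> (s - 1) /
  s\<close> weakens the exponent; if \<open>t \<le> 1\<close> it comes from doubling.
\<close>

lemma wvol_powr_le:
  assumes lam: "lam < 0" and delta: "1 < delta" "delta \<le> s" and r: "0 < r" and t: "0 < t"
  shows "wvol (t * r) powr lam
    \<le> (Cr powr (- lam) + Ca powr (- lam * q)) * t powr morrey_exponent lam delta t * wvol r powr lam"
proof -
  have tr: "0 < t * r"
    using r t by simp
  have pos: "0 < wvol r" "0 < wvol (t * r)" "0 < vol r" "0 < vol (t * r)"
    using wvol_pos vol_pos r tr by auto
  have eq: "wvol (t * r) powr lam = (wvol r / wvol (t * r)) powr (- lam) * wvol r powr lam"
    using pos by (simp add: powr_divide powr_minus field_simps)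
  have "(wvol r / wvol (t * r)) powr (- lam)
    \<le> (Cr powr (- lam) + Ca powr (- lam * q)) * t powr morrey_exponent lam delta t"
  proof (cases "1 < t")
    case True
    have "wvol r / wvol (t * r) \<le> Cr * (vol r / vol (t * r)) powr ((s - 1) / s)"
      using True r by (intro wvol_ratio_le) auto
    also have "vol r / vol (t * r) = t powr (- Q)"
      using vol_scale[OF r t] pos by (simp add: powr_minus field_simps)
    also have "Cr * (t powr (- Q)) powr ((s - 1) / s) \<le> Cr * t powr (- Q * ((delta - 1) / delta))"
    proof -
      have "(delta - 1) / delta \<le> (s - 1) / s"
        using delta by (simp add: field_simps)
      then have "- Q * ((s - 1) / s) \<le> - Q * ((delta - 1) / delta)"
        by (intro mult_left_mono_neg) (auto simp: Q)
      then show ?thesis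
        using True Cr by (simp add: powr_powr)
    qed
    finally have "(wvol r / wvol (t * r)) powr (- lam) \<le> (Cr * t powr (- Q * ((delta - 1) / delta))) powr (- lam)"
      using lam pos by (intro powr_mono2) auto
    also have "\<dots> = Cr powr (- lam) * t powr morrey_exponent lam delta t"
      using True by (simp add: powr_mult powr_powr morrey_exponent_def mult_ac)
    also have "\<dots> \<le> (Cr powr (- lam) + Ca powr (- lam * q)) * t powr morrey_exponent lam delta t"
      by (intro mult_right_mono) auto
    finally show ?thesis .
  next
    case False
    then have "vol (t * r) / vol r \<le> Ca * (wvol (t * r) / wvol r) powr (1 / q)"
      using tr r by (intro vol_ratio_le) auto
    then have "(vol (t * r) / vol r) powr q \<le> (Ca * (wvol (t * r) / wvol r) powr (1 / q)) powr q"
      using pos q by (intro powr_mono2) auto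
    then have "t powr (Q * q) \<le> Ca powr q * (wvol (t * r) / wvol r)"
      using vol_scale[OF r t] pos q by (simp add: powr_mult powr_powr)
    then have "wvol r / wvol (t * r) \<le> Ca powr q * t powr (- (Q * q))"
      using pos t by (simp add: powr_minus field_simps)
    then have "(wvol r / wvol (t * r)) powr (- lam) \<le> (Ca powr q * t powr (- (Q * q))) powr (- lam)"
      using lam pos by (intro powr_mono2) auto
    also have "\<dots> = Ca powr (- lam * q) * t powr morrey_exponent lam delta t"
      using False by (simp add: powr_mult powr_powr morrey_exponent_def mult_ac)
    also have "\<dots> \<le> (Cr powr (- lam) + Ca powr (- lam * q)) * t powr morrey_exponent lam delta t"
      by (intro mult_right_mono) auto
    finally show ?thesis .
  qed
  then show ?thesis
    unfolding eq by (intro mult_right_mono) auto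
qed

text \<open>
  The chain of comparisons, starting from \<open>|g|\<^bsup>P/q\<^esup>\<close>: from \<open>w\<close> to
  Lebesgue measure on the large ball, the substitution into the small ball, and back from Lebesgue measure
  to \<open>w\<close>, each time with the exponent that the comparison dictates.
\<close>

lemma Lp_bound_matrix_substitution:
  fixes A :: "'n heis_matrix" and g :: "'n heis \<Rightarrow> real"
  assumes N: "heis_matrix_norm A = ennreal N" "0 < N" and det: "det A \<noteq> 0" and P: "0 < P" and r: "0 < r"
    and g [measurable]: "g \<in> borel_measurable borel"
    and bound: "Lp_bound (ball_prob w (N * r)) P g X"
  shows "Lp_bound (ball_prob w r) (P / (q * (s / (s - 1)))) (\<lambda>x. g (A *v x))
    (Cr powr (q * (s / (s - 1)) / P) * Ca powr (q / P) * (N powr Q / \<bar>det A\<bar>) powr (q / P) * X)"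
proof -
  let ?R = "N powr Q / \<bar>det A\<bar>"
  define \<sigma> where "\<sigma> = s / (s - 1)"
  have s': "0 < \<sigma>"
    using s by (simp add: \<sigma>_def)
  have q0: "0 < q"
    using q by simp
  have Nr: "0 < N * r"
    using N r by simp
  have X: "0 \<le> X"
    using bound by (rule Lp_bound_nonneg)
  have [measurable]: "g \<in> borel_measurable lebesgue" "(\<lambda>x. g (A *v x)) \<in> borel_measurable lebesgue"
    using measurable_completion[of g lborel borel] measurable_completion[of "\<lambda>x. g (A *v x)" lborel borel]
    by simp_all
  have R: "0 < ?R"
    using N det by simp
  have "Lp_bound (ball_prob w (N * r)) q (\<lambda>x. \<bar>g x\<bar> powr (P / q)) (X powr (P / q))"
    using bound P q0 X by (subst Lp_bound_powr_iff) auto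
  from Lebesgue_le_weight[OF Nr this]
  have 1: "(\<integral>\<^sup>+x\<in>heis_ball 0 (N * r). ennreal (\<bar>g x\<bar> powr (P / q)) \<partial>lebesgue)
      \<le> ennreal (vol (N * r) * (Ca * X powr (P / q)))"
    unfolding L1_bound_ball_mean_iff[OF Nr] vol by simp
  have "ennreal \<bar>det A\<bar> * (\<integral>\<^sup>+x\<in>heis_ball 0 r. ennreal (\<bar>g (A *v x)\<bar> powr (P / q)) \<partial>lebesgue)
      \<le> ennreal (vol (N * r) * (Ca * X powr (P / q)))"
    by (rule order_trans[OF nn_integral_heis_ball_matrix_le[OF N det] 1]) measurable
  then have "ennreal (1 / \<bar>det A\<bar>) * (ennreal \<bar>det A\<bar> *
        (\<integral>\<^sup>+x\<in>heis_ball 0 r. ennreal (\<bar>g (A *v x)\<bar> powr (P / q)) \<partial>lebesgue))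
      \<le> ennreal (1 / \<bar>det A\<bar>) * ennreal (vol (N * r) * (Ca * X powr (P / q)))"
    by (rule mult_left_mono) simp
  moreover have "ennreal (1 / \<bar>det A\<bar>) * ennreal \<bar>det A\<bar> = 1"
    using det by (simp add: ennreal_mult[symmetric])
  moreover have "ennreal (1 / \<bar>det A\<bar>) * ennreal (vol (N * r) * (Ca * X powr (P / q)))
      = ennreal (1 / \<bar>det A\<bar> * (vol (N * r) * (Ca * X powr (P / q))))"
    using Ca vol_pos[OF Nr] by (intro ennreal_mult[symmetric]) auto
  ultimately have "(\<integral>\<^sup>+x\<in>heis_ball 0 r. ennreal (\<bar>g (A *v x)\<bar> powr (P / q)) \<partial>lebesgue)
      \<le> ennreal (1 / \<bar>det A\<bar> * (vol (N * r) * (Ca * X powr (P / q))))"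
    by (simp only: mult.assoc[symmetric] mult_1_left)
  also have "1 / \<bar>det A\<bar> * (vol (N * r) * (Ca * X powr (P / q))) = vol r * (?R * Ca * X powr (P / q))"
    using vol_scale[OF r N(2)] by simp
  finally have 2: "Lp_bound (ball_mean r) 1 (\<lambda>x. \<bar>g (A *v x)\<bar> powr (P / q)) (?R * Ca * X powr (P / q))"
    unfolding L1_bound_ball_mean_iff[OF r] vol using R Ca by simp
  define Y where "Y = ?R powr (q / P) * Ca powr (q / P) * X"
  have Y: "0 \<le> Y"
    using X by (simp add: Y_def)
  have Yp: "?R * Ca * X powr (P / q) = Y powr (P / q)"
    unfolding Y_def using P q0 R Ca by (simp add: powr_mult powr_powr)
  have "Lp_bound (ball_mean r) (P / q) (\<lambda>x. g (A *v x)) Y"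
    using 2 P q0 Y unfolding Yp by (subst (asm) Lp_bound_powr_iff) auto
  then have "Lp_bound (ball_mean r) \<sigma> (\<lambda>x. \<bar>g (A *v x)\<bar> powr (P / (q * \<sigma>))) (Y powr (P / (q * \<sigma>)))"
    using P q0 s' Y by (subst Lp_bound_powr_iff) auto
  then have 3: "Lp_bound (ball_prob w r) 1 (\<lambda>x. \<bar>g (A *v x)\<bar> powr (P / (q * \<sigma>))) (Cr * Y powr (P / (q * \<sigma>)))"
    unfolding \<sigma>_def by (rule weight_le_Lebesgue[OF r])
  have "Cr * Y powr (P / (q * \<sigma>)) = (Cr powr (q * \<sigma> / P) * Y) powr (P / (q * \<sigma>))"
    using P q0 s' Cr by (simp add: powr_mult powr_powr)
  with 3 have "Lp_bound (ball_prob w r) (P / (q * \<sigma>)) (\<lambda>x. g (A *v x)) (Cr powr (q * \<sigma> / P) * Y)"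
    using P q0 s' Y Lp_bound_powr_iff[of "\<lambda>x. g (A *v x)" "ball_prob w r" "Cr powr (q * \<sigma> / P) * Y" "P / (q * \<sigma>)" 1]
    by simp
  then show ?thesis
    by (simp add: Y_def \<sigma>_def mult_ac)
qed

end

section \<open>The estimate for a single matrix\<close>

lemma locally_integrable_set_integrable:
  fixes b :: "'n::finite heis \<Rightarrow> complex"
  assumes "locally_integrable b"
  shows "set_integrable lebesgue (heis_ball 0 r) b"
proof -
  have "set_integrable lebesgue (closure (heis_ball 0 r)) b"
    using assms bounded_heis_ball_0[of r, where 'n = 'n] by (simp add: locally_integrable_def compact_closure)
  then show ?thesis
    by (rule set_integrable_subset) (auto intro: closure_subset[THEN subsetD])
qed

context comparable_weight
begin

text \<open>
  The first comparison turns the weighted oscillation over the larger ball into a bound of the Lebesgue mean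
  of \<open>|b - c|\<close>, where \<open>c\<close> is the mean of \<open>b\<close>; the smaller ball fills
  at least the fraction \<open>1 / 2\<^sup>Q\<close> of the larger one.
\<close>

lemma cmean_on_difference:
  fixes b :: "'n heis \<Rightarrow> complex"
  assumes b: "locally_integrable b" and r: "0 < r" "r \<le> R" "R \<le> 2 * r" and p2: "q \<le> p2"
    and bmo: "Lp_bound (ball_prob w R) p2 (\<lambda>x. norm (b x - cmean_on (heis_ball 0 R) b)) B"
  shows "norm (cmean_on (heis_ball 0 r) b - cmean_on (heis_ball 0 R) b) \<le> 2 powr Q * Ca * B"
proof -
  let ?c = "cmean_on (heis_ball 0 R) b"
  have R: "0 < R" using r by simp
  have B: "0 \<le> B"
    using bmo by (rule Lp_bound_nonneg)
  have [measurable]: "b \<in> borel_measurable lebesgue"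
    by (rule locally_integrable_measurable) fact
  have int: "set_integrable lebesgue (heis_ball 0 r) b"
    "set_integrable lebesgue (heis_ball 0 r :: 'n heis set) (\<lambda>_. ?c)"
    using locally_integrable_set_integrable[OF b] heis_ball_0_lmeasurable[of r, where 'a = 'n]
    by (auto simp: set_integrable_def fmeasurable_def)
  have "Lp_bound (ball_prob w R) q (\<lambda>x. norm (b x - ?c)) B"
    using q p2 by (intro Lp_bound_lower_exponent[OF emeasure_prob[OF R] _ _ bmo]) auto
  from Lebesgue_le_weight[OF R this]
  have le: "(\<integral>\<^sup>+x\<in>heis_ball 0 R. ennreal (norm (b x - ?c)) \<partial>lebesgue) \<le> ennreal (vol R * (Ca * B))"
    unfolding L1_bound_ball_mean_iff[OF R] vol[symmetric] by simp
  have "(LINT x:heis_ball 0 r|lebesgue. b x - ?c) = (LINT x:heis_ball 0 r|lebesgue. b x) - of_real (vol r) * ?c"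
    using int by (subst set_integral_diff) (auto simp: vol set_lebesgue_integral_def scaleR_conv_of_real)
  also have "\<dots> = of_real (vol r) * (cmean_on (heis_ball 0 r) b - ?c)"
    using vol_pos[OF r(1)] by (simp add: cmean_on_def vol[symmetric] right_diff_distrib)
  finally have "vol r * norm (cmean_on (heis_ball 0 r) b - ?c) = norm (LINT x:heis_ball 0 r|lebesgue. b x - ?c)"
    using vol_pos[OF r(1)] by (simp add: norm_mult)
  then have "ennreal (vol r * norm (cmean_on (heis_ball 0 r) b - ?c)) = ennreal (norm (LINT x:heis_ball 0 r|lebesgue. b x - ?c))"
    by simp
  also have "\<dots> \<le> (\<integral>\<^sup>+x. ennreal (norm (indicator (heis_ball 0 r) x *\<^sub>R (b x - ?c))) \<partial>lebesgue)"
    using set_integral_diff(1)[OF int] unfolding set_lebesgue_integral_def set_integrable_def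
    by (rule integral_norm_bound_ennreal)
  also have "\<dots> \<le> (\<integral>\<^sup>+x\<in>heis_ball 0 R. ennreal (norm (b x - ?c)) \<partial>lebesgue)"
    using heis_ball_0_mono[OF r(2), where 'a = 'n] by (intro nn_integral_mono) (auto simp: indicator_def)
  also note le
  finally have "vol r * norm (cmean_on (heis_ball 0 r) b - ?c) \<le> vol R * (Ca * B)"
    using vol_pos[OF R] Ca B by (subst (asm) ennreal_le_iff) auto
  also have "vol R * (Ca * B) \<le> vol r * (2 powr Q * Ca * B)"
  proof -
    have "vol R = (R / r) powr Q * vol r"
      using vol_scale[of r "R / r"] r by simp
    also have "\<dots> \<le> 2 powr Q * vol r"
      using r vol_pos[OF r(1)] by (intro mult_right_mono powr_mono2) (auto simp: Q field_simps)
    finally show ?thesis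
      using Ca B mult_right_mono[of "vol R" "2 powr Q * vol r" "Ca * B"] by (simp add: mult_ac)
  qed
  finally show ?thesis
    using vol_pos[OF r(1)] by simp
qed

text \<open>
  At each step the larger radius is halved until the two balls are comparable.
\<close>

lemma cmean_on_difference_dyadic:
  fixes b :: "'n heis \<Rightarrow> complex"
  assumes b: "locally_integrable b" and p2: "q \<le> p2"
    and bmo: "\<And>r. 0 < r \<Longrightarrow> Lp_bound (ball_prob w r) p2 (\<lambda>x. norm (b x - cmean_on (heis_ball 0 r) b)) B"
    and r: "0 < r" "r \<le> R" "R \<le> 2 ^ k * r"
  shows "norm (cmean_on (heis_ball 0 r) b - cmean_on (heis_ball 0 R) b) \<le> real k * (2 powr Q * Ca * B)"
  using r
proof (induction k arbitrary: R)
  case 0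
  then show ?case by simp
next
  case (Suc k)
  have D: "0 \<le> 2 powr Q * Ca * B"
    using Ca Lp_bound_nonneg[OF bmo[OF r(1)]] by simp
  let ?\<beta> = "\<lambda>r. cmean_on (heis_ball 0 r) b"
  show ?case
  proof (cases "R \<le> 2 * r")
    case True
    have "norm (?\<beta> r - ?\<beta> R) \<le> 1 * (2 powr Q * Ca * B)"
      using cmean_on_difference[OF b _ _ True p2 bmo] Suc.prems by simp
    also have "\<dots> \<le> real (Suc k) * (2 powr Q * Ca * B)"
      using D by (intro mult_right_mono) auto
    finally show ?thesis .
  next
    case False
    have "norm (?\<beta> r - ?\<beta> (R / 2)) \<le> real k * (2 powr Q * Ca * B)"
      using False Suc.prems by (intro Suc.IH) auto
    moreover have "norm (?\<beta> (R / 2) - ?\<beta> R) \<le> 2 powr Q * Ca * B"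
      using False Suc.prems by (intro cmean_on_difference[OF b _ _ _ p2 bmo]) auto
    moreover have "norm (?\<beta> r - ?\<beta> R) \<le> norm (?\<beta> r - ?\<beta> (R / 2)) + norm (?\<beta> (R / 2) - ?\<beta> R)"
      using norm_triangle_ineq[of "?\<beta> r - ?\<beta> (R / 2)" "?\<beta> (R / 2) - ?\<beta> R"] by simp
    ultimately show ?thesis
      by (simp add: algebra_simps)
  qed
qed

text \<open>
  The number of dyadic steps is \<open>|log\<^sub>2 N|\<close> rounded up; for \<open>N < 1\<close> the two
  balls exchange their roles.
\<close>

lemma cmean_on_difference_log:
  fixes b :: "'n heis \<Rightarrow> complex"
  assumes b: "locally_integrable b" and p2: "q \<le> p2"
    and bmo: "\<And>r. 0 < r \<Longrightarrow> Lp_bound (ball_prob w r) p2 (\<lambda>x. norm (b x - cmean_on (heis_ball 0 r) b)) B"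
    and r: "0 < r" "0 < N"
  shows "norm (cmean_on (heis_ball 0 r) b - cmean_on (heis_ball 0 (N * r)) b)
    \<le> (1 + \<bar>log 2 N\<bar>) * (2 powr Q * Ca * B)"
proof -
  let ?\<beta> = "\<lambda>r. cmean_on (heis_ball 0 r) b"
  have D: "0 \<le> 2 powr Q * Ca * B"
    using Ca Lp_bound_nonneg[OF bmo[OF r(1)]] by simp
  have *: "norm (?\<beta> r - ?\<beta> (t * r)) \<le> (1 + log 2 t) * (2 powr Q * Ca * B)" if "1 \<le> t" "0 < r" for t r
  proof -
    define k where "k = nat \<lceil>log 2 t\<rceil>"
    have log: "0 \<le> log 2 t"
      using that by simp
    then have k: "log 2 t \<le> real k" "real k \<le> 1 + log 2 t"
      unfolding k_def by linarith+
    have "t = 2 powr log 2 t"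
      using that by simp
    also have "\<dots> \<le> 2 powr real k"
      using k by simp
    finally have "t * r \<le> 2 ^ k * r"
      using that by (simp add: powr_realpow)
    then have "norm (?\<beta> r - ?\<beta> (t * r)) \<le> real k * (2 powr Q * Ca * B)"
      using that by (intro cmean_on_difference_dyadic[OF b p2 bmo]) auto
    also have "\<dots> \<le> (1 + log 2 t) * (2 powr Q * Ca * B)"
      using k D by (intro mult_right_mono) auto
    finally show ?thesis .
  qed
  show ?thesis
  proof (cases "1 \<le> N")
    case True
    then show ?thesis
      using *[OF True r(1)] by simp
  next
    case False
    then have "norm (?\<beta> (N * r) - ?\<beta> (1 / N * (N * r))) \<le> (1 + log 2 (1 / N)) * (2 powr Q * Ca * B)"
      using r by (intro *) auto
    moreover have "log 2 (1 / N) = \<bar>log 2 N\<bar>"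
      using False r by (simp add: log_divide)
    ultimately show ?thesis
      using r by (simp add: norm_minus_commute)
  qed
qed

definition kernel_factor :: "real \<Rightarrow> real \<Rightarrow> real \<Rightarrow> real \<Rightarrow> real \<Rightarrow> real" where
  "kernel_factor p1 lam delta N d =
     (N powr Q / d) powr (q / p1) * N powr morrey_exponent lam delta N * max (N powr Q / d) \<bar>log 2 N\<bar>"

lemma matrix_ratio_ge_1:
  fixes A :: "'n heis_matrix"
  assumes "heis_matrix_norm A = ennreal N" "0 < N" "det A \<noteq> 0"
  shows "1 \<le> N powr Q / \<bar>det A\<bar>"
  using abs_det_le_heis_matrix_norm[OF assms(1,2)] assms by (simp add: Q powr_realpow)

text \<open>
  The second bound is the main estimate. The first one, without the difference of \<open>b\<close>, serves
  to show that the Hausdorff operator is defined almost everywhere; it is stated with the same kernel, in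
  which the maximum is at least \<open>1\<close>.
\<close>

proposition substituted_Lp_bounds:
  assumes p: "1 \<le> p" and p1: "1 \<le> p1" and p2: "1 \<le> p2" "q \<le> p2"
    and exp: "(1 / p1 + 1 / p2) * (q * (s / (s - 1))) \<le> 1 / p"
    and lam: "lam < 0" and delta: "1 < delta" "delta \<le> s"
  obtains C where "0 < C"
    and "\<And>(A :: 'n heis_matrix) N f b r F B. \<lbrakk>heis_matrix_norm A = ennreal N; 0 < N; det A \<noteq> 0; 0 < r;
      f \<in> borel_measurable borel; b \<in> borel_measurable borel; locally_integrable b;
      \<And>r. 0 < r \<Longrightarrow> Lp_bound (ball_prob w r) p1 (\<lambda>x. norm (f x :: complex)) (F * wvol r powr lam);
      \<And>r. 0 < r \<Longrightarrow> Lp_bound (ball_prob w r) p2 (\<lambda>x. norm (b x - cmean_on (heis_ball 0 r) b)) B\<rbrakk>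
    \<Longrightarrow> Lp_bound (ball_prob w r) p (\<lambda>x. norm (f (A *v x)))
          (C * kernel_factor p1 lam delta N \<bar>det A\<bar> * F * wvol r powr lam) \<and>
        Lp_bound (ball_prob w r) p (\<lambda>x. norm (f (A *v x)) * norm (b x - b (A *v x)))
          (C * kernel_factor p1 lam delta N \<bar>det A\<bar> * F * B * wvol r powr lam)"
proof -
  define \<sigma> where "\<sigma> = s / (s - 1)"
  define K where "K P = Cr powr (q * \<sigma> / P) * Ca powr (q / P)" for P
  define L where "L = Cr powr (- lam) + Ca powr (- lam * q)"
  define D where "D = 1 + 2 * (2 powr Q * Ca) + K p2"
  have K: "0 < K P" for P
    using Ca Cr by (simp add: K_def)
  have L: "0 < L"
    using Ca Cr by (simp add: L_def add_pos_pos)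
  have D: "1 \<le> D"
    using Ca K[of p2] by (simp add: D_def)
  have s': "1 \<le> \<sigma>"
    using s by (simp add: \<sigma>_def)
  then have qs: "1 \<le> q * \<sigma>"
    using mult_mono[of 1 q 1 \<sigma>] q by simp
  define t1 t2 where "t1 = p1 / (q * \<sigma>)" and "t2 = p2 / (q * \<sigma>)"
  have t0: "0 < t1" "0 < t2"
    using p1 p2 qs by (auto simp: t1_def t2_def intro!: divide_pos_pos)
  have inv: "1 / t1 + 1 / t2 = (1 / p1 + 1 / p2) * (q * \<sigma>)"
    by (simp add: t1_def t2_def add_divide_distrib distrib_right)
  have "0 < 1 / t1" "0 < 1 / t2"
    using t0 by auto
  then have "1 / t1 \<le> 1 / p" "1 / t2 \<le> 1 / p"
    using exp inv unfolding \<sigma>_def[symmetric] by linarith+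
  then have t: "p \<le> t1" "p \<le> t2"
    using t0 p by (auto simp: field_simps)
  have t2': "t2 \<le> p2"
    using qs p2 unfolding t2_def by (simp add: divide_le_eq mult_le_cancel_left1)
  show ?thesis
  proof (rule that)
    show "0 < K p1 * D * L"
      using K D L by (simp add: mult_pos_pos)
    fix A :: "'n heis_matrix" and N r F B :: real and f b :: "'n heis \<Rightarrow> complex"
    assume N: "heis_matrix_norm A = ennreal N" "0 < N" and det: "det A \<noteq> 0" and r: "0 < r"
      and f [measurable]: "f \<in> borel_measurable borel" and b [measurable]: "b \<in> borel_measurable borel"
      and locb: "locally_integrable b"
      and F: "\<And>r. 0 < r \<Longrightarrow> Lp_bound (ball_prob w r) p1 (\<lambda>x. norm (f x)) (F * wvol r powr lam)"
      and B: "\<And>r. 0 < r \<Longrightarrow> Lp_bound (ball_prob w r) p2 (\<lambda>x. norm (b x - cmean_on (heis_ball 0 r) b)) B"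
    \<comment> \<open>As \<open>1 \<le> R\<close>, each of the factors \<open>1\<close>, \<open>1 + \<bar>log 2 N\<bar>\<close> and \<open>R powr (q / p2)\<close> is at most \<open>2 * max R \<bar>log 2 N\<bar>\<close>.\<close>
    define R where "R = N powr Q / \<bar>det A\<bar>"
    have R: "1 \<le> R"
      unfolding R_def by (rule matrix_ratio_ge_1) fact+
    have Nr: "0 < N * r"
      using N r by simp
    have B0: "0 \<le> B"
      using B[OF r] by (rule Lp_bound_nonneg)
    have F0: "0 \<le> F"
      using Lp_bound_nonneg[OF F[OF r]] wvol_pos[OF r] by (simp add: zero_le_mult_iff)
    note prob = emeasure_prob[OF r]
    let ?W = "wvol (N * r) powr lam" and ?\<kappa> = "kernel_factor p1 lam delta N \<bar>det A\<bar>"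
    let ?m = "max R \<bar>log 2 N\<bar>"
    have W: "?W \<le> L * N powr morrey_exponent lam delta N * wvol r powr lam"
      unfolding L_def by (rule wvol_powr_le) fact+
    have fA: "Lp_bound (ball_prob w r) t1 (\<lambda>x. norm (f (A *v x))) (K p1 * R powr (q / p1) * (F * ?W))"
      unfolding K_def R_def t1_def \<sigma>_def
      by (rule Lp_bound_matrix_substitution[OF N det _ r _ F[OF Nr]]) (use p1 in auto)
    have bA: "Lp_bound (ball_prob w r) t2 (\<lambda>x. norm (b (A *v x) - cmean_on (heis_ball 0 (N * r)) b))
        (K p2 * R powr (q / p2) * B)"
      unfolding K_def R_def t2_def \<sigma>_def
      by (rule Lp_bound_matrix_substitution[OF N det _ r _ B[OF Nr]]) (use p2 in simp_all)
    have bA': "Lp_bound (ball_prob w r) t2 (\<lambda>x. norm (b (A *v x) - cmean_on (heis_ball 0 (N * r)) b)) (K p2 * ?m * B)"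
    proof (rule Lp_bound_mono[OF bA])
      have "R powr (q / p2) \<le> R powr 1"
        using R p2 by (intro powr_mono) auto
      then have "R powr (q / p2) \<le> ?m"
        using R by simp
      then show "K p2 * R powr (q / p2) * B \<le> K p2 * ?m * B"
        using K[of p2] B0 by (intro mult_right_mono mult_left_mono) auto
    qed (use t0 in auto)
    have b1: "Lp_bound (ball_prob w r) t2 (\<lambda>x. norm (b x - cmean_on (heis_ball 0 r) b)) (1 * ?m * B)"
    proof (rule Lp_bound_mono[OF Lp_bound_lower_exponent[OF prob _ t2' B[OF r]]])
      show "B \<le> 1 * ?m * B"
        using mult_right_mono[of 1 ?m B] R B0 by simp
    qed (use t0 in auto)
    have b2: "Lp_bound (ball_prob w r) t2
        (\<lambda>_. norm (cmean_on (heis_ball 0 r) b - cmean_on (heis_ball 0 (N * r)) b)) (2 * (2 powr Q * Ca) * ?m * B)"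
    proof (rule Lp_bound_mono[OF Lp_bound_const[OF prob]])
      have "norm (cmean_on (heis_ball 0 r) b - cmean_on (heis_ball 0 (N * r)) b)
          \<le> (1 + \<bar>log 2 N\<bar>) * (2 powr Q * Ca * B)"
        by (rule cmean_on_difference_log) fact+
      also have "\<dots> \<le> (2 * ?m) * (2 powr Q * Ca * B)"
        using R Ca B0 by (intro mult_right_mono) auto
      finally show "\<bar>norm (cmean_on (heis_ball 0 r) b - cmean_on (heis_ball 0 (N * r)) b)\<bar>
          \<le> 2 * (2 powr Q * Ca) * ?m * B"
        by (simp add: mult_ac)
    qed (use t0 in auto)
    have "1 \<le> t2"
      using t p by simp
    from Lp_bound_add[OF this Lp_bound_add[OF this b1 b2] bA']
    have sum: "Lp_bound (ball_prob w r) t2 (\<lambda>x. norm (b x - cmean_on (heis_ball 0 r) b)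
        + norm (cmean_on (heis_ball 0 r) b - cmean_on (heis_ball 0 (N * r)) b)
        + norm (b (A *v x) - cmean_on (heis_ball 0 (N * r)) b)) (D * ?m * B)"
      by (simp add: D_def algebra_simps)
    have [measurable]: "b \<in> borel_measurable lebesgue" "(\<lambda>x. b (A *v x)) \<in> borel_measurable lebesgue"
      using measurable_completion[of b lborel borel] measurable_completion[of "\<lambda>x. b (A *v x)" lborel borel]
      by simp_all
    have diff: "Lp_bound (ball_prob w r) t2 (\<lambda>x. norm (b x - b (A *v x))) (D * ?m * B)"
    proof (rule Lp_bound_AE_mono[OF sum t0(2)])
      have "norm (x - y) \<le> norm (x - c) + norm (c - c') + norm (y - c')" for x y c c' :: complex
      proof -
        have "x - y = (x - c) + (c - c') - (y - c')"
          by simp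
        then show ?thesis
          by (metis add_right_mono norm_triangle_ineq norm_triangle_ineq4 order_trans)
      qed
      then show "AE x in ball_prob w r. \<bar>norm (b x - b (A *v x))\<bar>
          \<le> \<bar>norm (b x - cmean_on (heis_ball 0 r) b)
            + norm (cmean_on (heis_ball 0 r) b - cmean_on (heis_ball 0 (N * r)) b)
            + norm (b (A *v x) - cmean_on (heis_ball 0 (N * r)) b)\<bar>"
        by simp
    qed simp
    have "Lp_bound (ball_prob w r) p (\<lambda>x. norm (f (A *v x)) * norm (b x - b (A *v x)))
        (K p1 * R powr (q / p1) * (F * ?W) * (D * ?m * B))"
      by (rule Lp_bound_Hoelder[OF prob t0 _ _ fA diff]) (use p inv exp in \<open>auto simp: \<sigma>_def\<close>)
    moreover have "K p1 * R powr (q / p1) * (F * ?W) * (D * ?m * B)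
        \<le> K p1 * D * L * ?\<kappa> * F * B * wvol r powr lam"
    proof -
      have "(K p1 * R powr (q / p1) * F * D * ?m * B) * ?W
          \<le> (K p1 * R powr (q / p1) * F * D * ?m * B) * (L * N powr morrey_exponent lam delta N * wvol r powr lam)"
        using W K[of p1] D F0 B0 R by (intro mult_left_mono) auto
      then show ?thesis
        by (simp add: kernel_factor_def R_def[symmetric] mult_ac)
    qed
    ultimately have com: "Lp_bound (ball_prob w r) p (\<lambda>x. norm (f (A *v x)) * norm (b x - b (A *v x)))
        (K p1 * D * L * ?\<kappa> * F * B * wvol r powr lam)"
      by (rule Lp_bound_mono) (use p in simp)
    have "Lp_bound (ball_prob w r) p (\<lambda>x. norm (f (A *v x))) (K p1 * R powr (q / p1) * (F * ?W))"
      using p t by (intro Lp_bound_lower_exponent[OF prob _ _ fA]) auto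
    moreover have "K p1 * R powr (q / p1) * (F * ?W) \<le> K p1 * D * L * ?\<kappa> * F * wvol r powr lam"
    proof -
      have "K p1 * R powr (q / p1) * (F * ?W)
          \<le> K p1 * R powr (q / p1) * (F * (L * N powr morrey_exponent lam delta N * wvol r powr lam))"
        using W K[of p1] F0 by (intro mult_left_mono) auto
      also have "\<dots> \<le> K p1 * R powr (q / p1) * (F * (L * N powr morrey_exponent lam delta N * wvol r powr lam)) * (D * ?m)"
      proof -
        have "1 * 1 \<le> D * ?m"
          using D R by (intro mult_mono) auto
        moreover have "0 \<le> K p1 * R powr (q / p1) * (F * (L * N powr morrey_exponent lam delta N * wvol r powr lam))"
          using K[of p1] F0 L by (auto intro!: mult_nonneg_nonneg)
        ultimately show ?thesis
          by (metis mult.right_neutral mult_left_mono)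
      qed
      finally show ?thesis
        by (simp add: kernel_factor_def R_def[symmetric] mult_ac)
    qed
    ultimately have "Lp_bound (ball_prob w r) p (\<lambda>x. norm (f (A *v x)))
        (K p1 * D * L * ?\<kappa> * F * wvol r powr lam)"
      by (rule Lp_bound_mono) (use p in simp)
    from this com show "Lp_bound (ball_prob w r) p (\<lambda>x. norm (f (A *v x)))
          (K p1 * D * L * ?\<kappa> * F * wvol r powr lam) \<and>
        Lp_bound (ball_prob w r) p (\<lambda>x. norm (f (A *v x)) * norm (b x - b (A *v x)))
          (K p1 * D * L * ?\<kappa> * F * B * wvol r powr lam)" ..
  qed
qed

end

section \<open>Lebesgue null sets and the Hausdorff operator\<close>

lemma sigma_finite_lebesgue: "sigma_finite_measure (lebesgue :: 'a::euclidean_space measure)"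
proof
  obtain A :: "'a set set" where "countable A" "A \<subseteq> sets lborel" "\<Union>A = space lborel"
    "\<forall>a\<in>A. emeasure lborel a \<noteq> \<infinity>"
    using lborel.sigma_finite_countable by blast
  then show "\<exists>A. countable A \<and> A \<subseteq> sets lebesgue \<and> \<Union>A = space (lebesgue :: 'a measure) \<and>
      (\<forall>a\<in>A. emeasure lebesgue a \<noteq> \<infinity>)"
    by (intro exI[of _ A]) auto
qed

lemma lebesgue_measurable_of_borel: "f \<in> borel_measurable borel \<Longrightarrow> f \<in> borel_measurable lebesgue"
  by (rule measurable_completion) simp

text \<open>
  The composition \<open>(x, y) \<mapsto> f (A(y) x)\<close> is jointly measurable if \<open>f\<close> is a
  Borel function, whereas Lebesgue measurability of \<open>f\<close> says nothing about preimages under a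
  map that is merely measurable.
\<close>

lemma borel_version:
  fixes f :: "'a::euclidean_space \<Rightarrow> complex"
  assumes "f \<in> borel_measurable lebesgue"
  obtains f' where "f' \<in> borel_measurable borel" "AE x in lebesgue. f x = f' x"
proof -
  have "(\<lambda>x. Re (f x)) \<in> borel_measurable lebesgue" "(\<lambda>x. Im (f x)) \<in> borel_measurable lebesgue"
    using assms by measurable
  from this[THEN completion_ex_borel_measurable_real]
  obtain u v where uv: "u \<in> borel_measurable lborel" "v \<in> borel_measurable lborel"
    and AE: "AE x in lborel. Re (f x) = u x" "AE x in lborel. Im (f x) = v x"
    by blast
  show ?thesis
  proof (rule that)
    show "(\<lambda>x. Complex (u x) (v x)) \<in> borel_measurable borel"
      using uv unfolding Complex_eq by simp
    show "AE x in lebesgue. f x = Complex (u x) (v x)"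
      using AE[THEN AE_completion] by eventually_elim (simp add: complex_eq_iff)
  qed
qed

text \<open>
  For fixed \<open>y\<close> the change of variables shows that the preimage of a null set under an
  invertible \<open>A(y)\<close> is null; Tonelli's theorem exchanges the two quantifiers. Consequently the
  operators do not see modifications of \<open>f\<close> and \<open>b\<close> on null sets.
\<close>

proposition AE_matrix_substitution:
  fixes A :: "'a::euclidean_space \<Rightarrow> real^'k^'k"
  assumes A [measurable]: "A \<in> borel_measurable lebesgue" and P: "AE z in lebesgue. P z"
  shows "AE x in lebesgue. AE y in lebesgue. det (A y) \<noteq> 0 \<longrightarrow> P (A y *v x)"
proof -
  interpret L1: sigma_finite_measure "lebesgue :: (real^'k) measure"
    by (rule sigma_finite_lebesgue)
  interpret L2: sigma_finite_measure "lebesgue :: 'a measure"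
    by (rule sigma_finite_lebesgue)
  interpret pair_sigma_finite "lebesgue :: (real^'k) measure" "lebesgue :: 'a measure" ..
  obtain N where N: "N \<in> null_sets lborel" and PN: "\<And>z. z \<notin> N \<Longrightarrow> P z"
  proof -
    from P have "{z. \<not> P z} \<in> null_sets lebesgue"
      by (simp add: completion.AE_iff_null_sets)
    then obtain N where "N \<in> null_sets lborel" "{z. \<not> P z} \<subseteq> N"
      unfolding null_sets_completion_iff2 by blast
    then show ?thesis
      by (intro that) auto
  qed
  have [measurable]: "N \<in> sets borel"
    using N by auto
  have [measurable]: "(\<lambda>p. A (snd p)) \<in> borel_measurable ((lebesgue :: (real^'k) measure) \<Otimes>\<^sub>M lebesgue)"
    by measurable
  have [measurable]: "(\<lambda>p. fst p) \<in> borel_measurable ((lebesgue :: (real^'k) measure) \<Otimes>\<^sub>M (lebesgue :: 'a measure))"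
    by (rule measurable_compose[OF measurable_fst]) (simp add: lebesgue_measurable_of_borel)
  have S: "{p \<in> space ((lebesgue :: (real^'k) measure) \<Otimes>\<^sub>M (lebesgue :: 'a measure)).
      det (A (snd p)) \<noteq> 0 \<longrightarrow> A (snd p) *v fst p \<notin> N} \<in> sets (lebesgue \<Otimes>\<^sub>M lebesgue)"
    by measurable
  have "AE x in lebesgue. det (A y) \<noteq> 0 \<longrightarrow> A y *v x \<notin> N" for y
  proof (cases "det (A y) = 0")
    case False
    have [measurable]: "(*v) (A y) \<in> borel_measurable borel"
      by measurable
    have "ennreal \<bar>det (A y)\<bar> * (\<integral>\<^sup>+x. indicator N (A y *v x) \<partial>lborel) = (\<integral>\<^sup>+x. indicator N x \<partial>lborel)"
      by (rule nn_integral_matrix_image[symmetric]) (use False in measurable)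
    also have "\<dots> = 0"
      using N by (simp add: null_setsD1)
    finally have "(\<integral>\<^sup>+x. indicator N (A y *v x) \<partial>lborel) = (0 :: ennreal)"
      using False by simp
    then have "AE x in lborel. indicator N (A y *v x) = (0 :: ennreal)"
      by (subst (asm) nn_integral_0_iff_AE) auto
    then have "AE x in lborel. A y *v x \<notin> N"
      by eventually_elim (auto simp: indicator_def split: if_splits)
    then show ?thesis
      by (auto intro: AE_completion)
  qed simp
  then have "AE y in lebesgue. AE x in lebesgue. det (A y) \<noteq> 0 \<longrightarrow> A y *v x \<notin> N"
    by simp
  then have "AE x in lebesgue. AE y in lebesgue. det (A y) \<noteq> 0 \<longrightarrow> A y *v x \<notin> N"
    by (subst AE_commute[OF S])
  then show ?thesis
    by (elim eventually_mono) (use PN in blast)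
qed

lemma hausdorff_integrand_AE_cong:
  assumes "A \<in> borel_measurable lebesgue" "AE y in lebesgue. \<Phi> y \<noteq> 0 \<longrightarrow> det (A y) \<noteq> 0"
    and "AE z in lebesgue. f z = g z"
  shows "AE x in lebesgue. AE y in lebesgue. hausdorff_integrand \<Phi> A f x y = hausdorff_integrand \<Phi> A g x y"
proof -
  have "AE x in lebesgue. AE y in lebesgue. det (A y) \<noteq> 0 \<longrightarrow> f (A y *v x) = g (A y *v x)"
    by (rule AE_matrix_substitution) fact+
  then show ?thesis
  proof eventually_elim
    fix x assume "AE y in lebesgue. det (A y) \<noteq> 0 \<longrightarrow> f (A y *v x) = g (A y *v x)"
    with assms(2) show "AE y in lebesgue. hausdorff_integrand \<Phi> A f x y = hausdorff_integrand \<Phi> A g x y"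
      by eventually_elim (auto simp: hausdorff_integrand_def)
  qed
qed

text \<open>
  Lebesgue measure is complete, so \<open>u\<close> and \<open>v\<close> are both measurable or both not; in
  the second case both integrals have the default value \<open>0\<close>.
\<close>

lemma lebesgue_integral_AE_cong:
  fixes u v :: "'a::euclidean_space \<Rightarrow> complex"
  assumes eq: "AE y in lebesgue. u y = v y"
  shows "integrable lebesgue u \<longleftrightarrow> integrable lebesgue v" "(LINT y|lebesgue. u y) = (LINT y|lebesgue. v y)"
proof -
  have "AE y in lebesgue. v y = u y"
    using eq by eventually_elim simp
  then have meas: "u \<in> borel_measurable lebesgue \<longleftrightarrow> v \<in> borel_measurable lebesgue"
    using eq borel_measurable_AE by blast
  show "integrable lebesgue u \<longleftrightarrow> integrable lebesgue v"
    using meas eq integrable_cong_AE[of u lebesgue v] borel_measurable_integrable by blast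
  show "(LINT y|lebesgue. u y) = (LINT y|lebesgue. v y)"
  proof (cases "u \<in> borel_measurable lebesgue")
    case True
    then show ?thesis
      using meas eq by (intro integral_cong_AE) auto
  next
    case False
    then show ?thesis
      using meas by (metis borel_measurable_integrable not_integrable_integral_eq)
  qed
qed

lemma hausdorff_op_AE_cong:
  assumes "A \<in> borel_measurable lebesgue" "AE y in lebesgue. \<Phi> y \<noteq> 0 \<longrightarrow> det (A y) \<noteq> 0"
    and "AE z in lebesgue. f z = g z"
  shows "AE x in lebesgue. (hausdorff_defined_at \<Phi> A f x \<longleftrightarrow> hausdorff_defined_at \<Phi> A g x) \<and>
    hausdorff_op \<Phi> A f x = hausdorff_op \<Phi> A g x"
  using hausdorff_integrand_AE_cong[OF assms]
  by eventually_elim (simp add: hausdorff_defined_at_def hausdorff_op_def lebesgue_integral_AE_cong)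

lemma hausdorff_commutator_AE_cong:
  assumes "A \<in> borel_measurable lebesgue" "AE y in lebesgue. \<Phi> y \<noteq> 0 \<longrightarrow> det (A y) \<noteq> 0"
    and f: "AE z in lebesgue. f z = f' z" and b: "AE z in lebesgue. b z = b' z"
  shows "AE x in lebesgue. hausdorff_commutator b \<Phi> A f x = hausdorff_commutator b' \<Phi> A f' x"
proof -
  have "AE z in lebesgue. b z * f z = b' z * f' z"
    using f b by eventually_elim simp
  from hausdorff_op_AE_cong[OF assms(1,2) this] hausdorff_op_AE_cong[OF assms(1-3)] b
  show ?thesis
    by eventually_elim (simp add: hausdorff_commutator_def)
qed

text \<open>
  A constant \<open>b\<close> may be pulled out of the integral that defines the operator; where this
  integral does not exist, both sides have the default value \<open>0\<close>.
\<close>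

lemma hausdorff_commutator_const:
  assumes "A \<in> borel_measurable lebesgue" "AE y in lebesgue. \<Phi> y \<noteq> 0 \<longrightarrow> det (A y) \<noteq> 0"
    and "(AE z in lebesgue. f z = 0) \<or> (AE z in lebesgue. b z = c)"
  shows "AE x in lebesgue. hausdorff_commutator b \<Phi> A f x = 0"
proof -
  have const: "hausdorff_commutator (\<lambda>_. c) \<Phi> A g x = 0" for g x
  proof -
    have "hausdorff_integrand \<Phi> A (\<lambda>z. c * g z) x y = c * hausdorff_integrand \<Phi> A g x y" for y
      by (simp add: hausdorff_integrand_def)
    then show ?thesis
      by (simp add: hausdorff_commutator_def hausdorff_op_def)
  qed
  have zero: "hausdorff_commutator b \<Phi> A (\<lambda>_. 0) x = 0" for x
    by (simp add: hausdorff_commutator_def hausdorff_op_def hausdorff_integrand_def)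
  from assms(3) show ?thesis
  proof
    assume "AE z in lebesgue. f z = 0"
    from hausdorff_commutator_AE_cong[OF assms(1,2) this, of b b] show ?thesis
      by (simp add: zero)
  next
    assume "AE z in lebesgue. b z = c"
    from hausdorff_commutator_AE_cong[OF assms(1,2) _ this, of f f] show ?thesis
      by (simp add: const)
  qed
qed

lemma epow_le_iff:
  assumes "0 < e" "0 \<le> F"
  shows "epow x e \<le> ennreal F \<longleftrightarrow> x \<le> ennreal (F powr (1 / e))"
proof (cases x)
  case (real u)
  have "u powr e \<le> F \<longleftrightarrow> u \<le> F powr (1 / e)"
  proof
    assume "u powr e \<le> F"
    then have "(u powr e) powr (1 / e) \<le> F powr (1 / e)"
      using assms by (intro powr_mono2) auto
    then show "u \<le> F powr (1 / e)"
      using assms real by (simp add: powr_powr)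
  next
    assume "u \<le> F powr (1 / e)"
    then have "u powr e \<le> (F powr (1 / e)) powr e"
      using assms real by (intro powr_mono2) auto
    then show "u powr e \<le> F"
      using assms by (simp add: powr_powr)
  qed
  then show ?thesis
    using real assms by (simp add: epow_ennreal ennreal_le_iff)
next
  case top
  then show ?thesis
    using assms by (simp add: epow_top top_unique)
qed

lemma ennreal_divide_le_iff:
  assumes "0 < c" "0 \<le> a"
  shows "x / ennreal c \<le> ennreal a \<longleftrightarrow> x \<le> ennreal (c * a)"
proof
  assume "x / ennreal c \<le> ennreal a"
  then have "ennreal c * (x / ennreal c) \<le> ennreal c * ennreal a"
    by (rule mult_left_mono) simp
  then show "x \<le> ennreal (c * a)"
    using assms by (simp add: ennreal_times_divide ennreal_mult_divide_eq ennreal_mult mult.commute)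
next
  assume "x \<le> ennreal (c * a)"
  then have "x / ennreal c \<le> ennreal (c * a) / ennreal c"
    by (rule divide_right_mono_ennreal)
  then show "x / ennreal c \<le> ennreal a"
    using assms by (simp add: divide_ennreal)
qed

context comparable_weight
begin

lemma morrey_norm_le_iff:
  assumes p: "1 \<le> p" and f [measurable]: "f \<in> borel_measurable lebesgue" and F: "0 \<le> F"
  shows "morrey_norm p lam w f \<le> ennreal F \<longleftrightarrow>
    (\<forall>r>0. Lp_bound (ball_prob w r) p (\<lambda>x. norm (f x)) (F * wvol r powr lam))"
proof -
  have "epow ((\<integral>\<^sup>+x\<in>heis_ball 0 r. ennreal (norm (f x) powr p * w x) \<partial>lebesgue)
             / epow (wmeasure w (heis_ball 0 r)) (1 + p * lam)) (1 / p) \<le> ennreal F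
    \<longleftrightarrow> Lp_bound (ball_prob w r) p (\<lambda>x. norm (f x)) (F * wvol r powr lam)" if r: "0 < r" for r
  proof -
    have W: "epow (wmeasure w (heis_ball 0 r)) (1 + p * lam) = ennreal (wvol r powr (1 + p * lam))"
      unfolding ennreal_wvol[OF r, symmetric] by (rule epow_ennreal_pos[OF wvol_pos[OF r]])
    have eq: "wvol r powr (1 + p * lam) * F powr p = wvol r * (F * wvol r powr lam) powr p"
      using wvol_pos[OF r] by (simp add: powr_add powr_mult powr_powr mult_ac)
    show ?thesis
      unfolding W using p F wvol_pos[OF r]
      by (simp add: epow_le_iff ennreal_divide_le_iff Lp_bound_w_iff[OF r] eq)
  qed
  then show ?thesis
    by (auto simp: morrey_norm_def SUP_le_iff)
qed

lemma cmo_norm_le_iff: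
  assumes p: "1 \<le> p" and b [measurable]: "b \<in> borel_measurable lebesgue" and B: "0 \<le> B"
  shows "cmo_norm p w b \<le> ennreal B \<longleftrightarrow>
    (\<forall>r>0. Lp_bound (ball_prob w r) p (\<lambda>x. norm (b x - cmean_on (heis_ball 0 r) b)) B)"
proof -
  have "epow ((\<integral>\<^sup>+x\<in>heis_ball 0 r. ennreal (norm (b x - cmean_on (heis_ball 0 r) b) powr p * w x) \<partial>lebesgue)
             / wmeasure w (heis_ball 0 r)) (1 / p) \<le> ennreal B
    \<longleftrightarrow> Lp_bound (ball_prob w r) p (\<lambda>x. norm (b x - cmean_on (heis_ball 0 r) b)) B" if r: "0 < r" for r
    unfolding ennreal_wvol[OF r, symmetric] using p B wvol_pos[OF r]
    by (simp add: epow_le_iff ennreal_divide_le_iff Lp_bound_w_iff[OF r])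
  then show ?thesis
    by (auto simp: cmo_norm_def SUP_le_iff)
qed

lemma AE_ball_prob_iff:
  assumes r: "0 < r" and w: "AE x in lebesgue. 0 < w x"
  shows "(AE x in ball_prob w r. P x) \<longleftrightarrow> (AE x in lebesgue. x \<in> heis_ball 0 r \<longrightarrow> P x)"
proof -
  have "(AE x in ball_prob w r. P x) \<longleftrightarrow>
      (AE x in lebesgue. 0 < ennreal (w x / wvol r) * indicator (heis_ball 0 r) x \<longrightarrow> P x)"
    unfolding ball_prob_def wvol_def[symmetric] by (rule AE_density) measurable
  also have "\<dots> \<longleftrightarrow> (AE x in lebesgue. x \<in> heis_ball 0 r \<longrightarrow> P x)"
  proof
    assume "AE x in lebesgue. 0 < ennreal (w x / wvol r) * indicator (heis_ball 0 r) x \<longrightarrow> P x"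
    with w show "AE x in lebesgue. x \<in> heis_ball 0 r \<longrightarrow> P x"
      by eventually_elim (use wvol_pos[OF r] in auto)
  next
    assume "AE x in lebesgue. x \<in> heis_ball 0 r \<longrightarrow> P x"
    then show "AE x in lebesgue. 0 < ennreal (w x / wvol r) * indicator (heis_ball 0 r) x \<longrightarrow> P x"
      by eventually_elim (auto simp: indicator_def)
  qed
  finally show ?thesis .
qed

lemma AE_of_ball_prob:
  assumes w: "AE x in lebesgue. 0 < w x" and "\<And>r. 0 < r \<Longrightarrow> AE x in ball_prob w r. P x"
  shows "AE x in lebesgue. P x"
proof -
  have "AE x in lebesgue. x \<in> heis_ball 0 (real k + 1) \<longrightarrow> P x" for k :: nat
    using assms(2)[of "real k + 1"] by (simp add: AE_ball_prob_iff[OF _ w])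
  then have "AE x in lebesgue. \<forall>k::nat. x \<in> heis_ball 0 (real k + 1) \<longrightarrow> P x"
    unfolding AE_all_countable by auto
  then show ?thesis
    by eventually_elim (use heis_ball_0_exhausts in blast)
qed

end

section \<open>Integration over the matrices\<close>

context comparable_weight
begin

definition kernel :: "real \<Rightarrow> real \<Rightarrow> real \<Rightarrow> ennreal \<Rightarrow> real \<Rightarrow> ennreal" where
  "kernel p1 lam delta N d = (if N = \<infinity> then \<infinity> else ennreal (kernel_factor p1 lam delta (enn2real N) d))"

lemma kernel_measurable [measurable (raw)]:
  assumes [measurable]: "N \<in> borel_measurable M" "d \<in> borel_measurable M"
  shows "(\<lambda>y. kernel p1 lam delta (N y) (d y)) \<in> borel_measurable M"
  unfolding kernel_def kernel_factor_def morrey_exponent_def by measurable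

lemma commutator_kernel_eq:
  "1 < N \<Longrightarrow> commutator_kernel (heis_dim TYPE('n)) N d (q / p1)
      (real (heis_dim TYPE('n)) * lam * (delta - 1) / delta) (\<lambda>t. log 2 t) = kernel p1 lam delta N d"
  "N \<le> 1 \<Longrightarrow> commutator_kernel (heis_dim TYPE('n)) N d (q / p1)
      (real (heis_dim TYPE('n)) * lam * q) (\<lambda>t. log 2 (1 / t)) = kernel p1 lam delta N d"
proof -
  have Q0: "0 < heis_dim TYPE('n)"
    by (simp add: heis_dim_def)
  have pow: "t ^ heis_dim TYPE('n) = t powr Q" if "0 \<le> t" for t :: real
    using that Q0 by (cases "t = 0") (auto simp: Q powr_realpow)
  show "commutator_kernel (heis_dim TYPE('n)) N d (q / p1)
      (real (heis_dim TYPE('n)) * lam * (delta - 1) / delta) (\<lambda>t. log 2 t) = kernel p1 lam delta N d" if "1 < N"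
  proof (cases N)
    case (real t)
    then have "1 < t"
      using that by (simp add: ennreal_less_iff flip: ennreal_1)
    then show ?thesis
      using real unfolding commutator_kernel_def kernel_def kernel_factor_def morrey_exponent_def
      by (simp add: pow Q)
  qed (simp add: commutator_kernel_def kernel_def)
  show "commutator_kernel (heis_dim TYPE('n)) N d (q / p1)
      (real (heis_dim TYPE('n)) * lam * q) (\<lambda>t. log 2 (1 / t)) = kernel p1 lam delta N d" if "N \<le> 1"
  proof (cases N)
    case (real t)
    then have t: "0 \<le> t" "t \<le> 1"
      using that by (simp_all add: ennreal_le_iff flip: ennreal_1)
    have "log 2 (1 / t) = \<bar>log 2 t\<bar>"
    proof (cases "t = 0")
      case False
      then show ?thesis
        using t by (simp add: log_divide)
    qed (simp add: log_def)
    then show ?thesis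
      using real t unfolding commutator_kernel_def kernel_def kernel_factor_def morrey_exponent_def
      by (simp add: pow Q)
  qed (use that in \<open>simp add: commutator_kernel_def kernel_def\<close>)
qed

text \<open>
  On each of the two regions the logarithm in the constant is \<open>|log\<^sub>2 N|\<close>, and the power
  of \<open>N\<close> is the one that \<open>morrey_exponent\<close> selects, so that the two integrals
  combine into one.
\<close>

lemma commutator_const_eq:
  fixes \<Phi> :: "'n heis \<Rightarrow> complex" and A :: "'n heis \<Rightarrow> 'n heis_matrix"
  assumes [measurable]: "\<Phi> \<in> borel_measurable lebesgue" "A \<in> borel_measurable lebesgue"
  shows "commutator_const p1 q lam delta \<Phi> A =
    (\<integral>\<^sup>+y. ennreal (norm (\<Phi> y) / heis_norm y ^ heis_dim TYPE('n))
        * kernel p1 lam delta (heis_matrix_norm (A y)) \<bar>det (A y)\<bar> \<partial>lebesgue)"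
proof -
  have [measurable]: "(heis_norm :: 'n heis \<Rightarrow> real) \<in> borel_measurable lebesgue"
    by (rule lebesgue_measurable_of_borel) measurable
  let ?k = "\<lambda>y. ennreal (norm (\<Phi> y) / heis_norm y ^ heis_dim TYPE('n))
        * kernel p1 lam delta (heis_matrix_norm (A y)) \<bar>det (A y)\<bar>"
  have "commutator_const p1 q lam delta \<Phi> A
      = (\<integral>\<^sup>+y\<in>{y. heis_matrix_norm (A y) > 1}. ?k y \<partial>lebesgue)
        + (\<integral>\<^sup>+y\<in>{y. heis_matrix_norm (A y) \<le> 1}. ?k y \<partial>lebesgue)"
    unfolding commutator_const_def Let_def
    by (intro arg_cong2[of _ _ _ _ "(+)"] nn_integral_cong)
      (auto simp: indicator_def commutator_kernel_eq(1) commutator_kernel_eq(2)[where delta = delta])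
  also have "\<dots> = (\<integral>\<^sup>+y. ?k y * indicator {y. heis_matrix_norm (A y) > 1} y
        + ?k y * indicator {y. heis_matrix_norm (A y) \<le> 1} y \<partial>lebesgue)"
    by (rule nn_integral_add[symmetric]) measurable
  also have "\<dots> = (\<integral>\<^sup>+y. ?k y \<partial>lebesgue)"
    by (intro nn_integral_cong) (auto simp: indicator_def not_less)
  finally show ?thesis .
qed

lemma kernel_factor_nonneg: "0 \<le> kernel_factor p1 lam delta N d"
  by (auto simp: kernel_factor_def intro!: mult_nonneg_nonneg)

lemma kernel_factor_pos:
  fixes A :: "'n heis_matrix"
  assumes "heis_matrix_norm A = ennreal N" "0 < N" "det A \<noteq> 0"
  shows "0 < kernel_factor p1 lam delta N \<bar>det A\<bar>"
  using matrix_ratio_ge_1[OF assms] assms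
  by (auto simp: kernel_factor_def less_max_iff_disj intro!: mult_pos_pos)

text \<open>
  Minkowski's inequality, where the majorant is the integrand of the constant times \<open>E\<close>. If the
  constant is finite, then so is the norm of \<open>A(y)\<close> for almost every \<open>y\<close> in the
  support of \<open>\<Phi>\<close>. As \<open>E > 0\<close>, the majorant vanishes, up to a null set, only
  where \<open>\<Phi>\<close> does.
\<close>

lemma integral_kernel_Lp_bound:
  fixes \<Phi> :: "'n heis \<Rightarrow> complex" and A :: "'n heis \<Rightarrow> 'n heis_matrix"
  defines "K \<equiv> \<lambda>y. norm (\<Phi> y) / heis_norm y ^ heis_dim TYPE('n)"
  assumes \<Phi> [measurable]: "\<Phi> \<in> borel_measurable lebesgue" and A [measurable]: "A \<in> borel_measurable lebesgue"
    and det: "AE y in lebesgue. \<Phi> y \<noteq> 0 \<longrightarrow> det (A y) \<noteq> 0"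
    and fin: "commutator_const p1 q lam delta \<Phi> A < \<infinity>"
    and p: "1 \<le> p" and r: "0 < r" and E: "0 < E"
    and G [measurable]: "case_prod G \<in> borel_measurable (lebesgue \<Otimes>\<^sub>M lebesgue)" and G0: "\<And>x y. 0 \<le> G x y"
    and bound: "\<And>y N. heis_matrix_norm (A y) = ennreal N \<Longrightarrow> 0 < N \<Longrightarrow> det (A y) \<noteq> 0 \<Longrightarrow>
      Lp_bound (ball_prob w r) p (\<lambda>x. G x y) (kernel_factor p1 lam delta N \<bar>det (A y)\<bar> * E)"
  shows "AE x in ball_prob w r. (\<integral>\<^sup>+y. ennreal (K y * G x y) \<partial>lebesgue) < \<infinity>"
    and "Lp_bound (ball_prob w r) p (\<lambda>x. enn2real (\<integral>\<^sup>+y. ennreal (K y * G x y) \<partial>lebesgue))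
      (enn2real (commutator_const p1 q lam delta \<Phi> A) * E)"
proof -
  have [measurable]: "(heis_norm :: 'n heis \<Rightarrow> real) \<in> borel_measurable lebesgue"
    by (rule lebesgue_measurable_of_borel) measurable
  have K [measurable]: "K \<in> borel_measurable lebesgue"
    unfolding K_def by measurable
  have K0: "0 \<le> K y" for y
    by (simp add: K_def)
  interpret finite_measure "ball_prob w r"
    using emeasure_prob[OF r] by (intro finite_measureI) (auto simp: top_unique)
  define k where "k y = ennreal (K y) * kernel p1 lam delta (heis_matrix_norm (A y)) \<bar>det (A y)\<bar>" for y
  have [measurable]: "k \<in> borel_measurable lebesgue"
    unfolding k_def by measurable
  have c: "commutator_const p1 q lam delta \<Phi> A = (\<integral>\<^sup>+y. k y \<partial>lebesgue)"
    unfolding k_def K_def by (rule commutator_const_eq) fact+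
  then have k_fin: "AE y in lebesgue. k y \<noteq> \<infinity>"
    using fin by (intro nn_integral_PInf_AE) auto
  define h where "h y = enn2real (k y) * E" for y
  have h: "h \<in> borel_measurable lebesgue" "\<And>y. 0 \<le> h y"
    using E unfolding h_def[abs_def] by auto
  \<comment> \<open>Almost every \<open>y\<close> is either irrelevant or carries an invertible matrix of finite norm.\<close>
  have dich: "AE y in lebesgue. K y = 0 \<or> (\<exists>N. heis_matrix_norm (A y) = ennreal N \<and> 0 < N \<and> det (A y) \<noteq> 0 \<and>
      h y = K y * (kernel_factor p1 lam delta N \<bar>det (A y)\<bar> * E))"
    using det k_fin
  proof eventually_elim
    fix y assume det: "\<Phi> y \<noteq> 0 \<longrightarrow> det (A y) \<noteq> 0" and ky: "k y \<noteq> \<infinity>"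
    show "K y = 0 \<or> (\<exists>N. heis_matrix_norm (A y) = ennreal N \<and> 0 < N \<and> det (A y) \<noteq> 0 \<and>
      h y = K y * (kernel_factor p1 lam delta N \<bar>det (A y)\<bar> * E))"
    proof (cases "K y = 0")
      case False
      then have d: "det (A y) \<noteq> 0"
        using det by (auto simp: K_def)
      have "0 < K y"
        using K0[of y] False by simp
      then have "heis_matrix_norm (A y) \<noteq> \<infinity>"
        using ky by (auto simp: k_def kernel_def ennreal_mult_top)
      then obtain N where N: "heis_matrix_norm (A y) = ennreal N" "0 \<le> N"
        by (cases "heis_matrix_norm (A y)") auto
      moreover have "0 < N"
        by (rule heis_matrix_norm_pos[OF N d])
      moreover have "h y = K y * (kernel_factor p1 lam delta N \<bar>det (A y)\<bar> * E)"
        using N K0[of y] kernel_factor_nonneg[of p1 lam delta N "\<bar>det (A y)\<bar>"]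
        by (simp add: h_def k_def kernel_def enn2real_mult)
      ultimately show ?thesis
        using d by blast
    qed simp
  qed
  have zero: "AE y in lebesgue. h y = 0 \<longrightarrow> (\<forall>x. K y * G x y = 0)"
    using dich
  proof eventually_elim
    case (elim y)
    show ?case
    proof (intro impI allI)
      fix x assume "h y = 0"
      with elim E kernel_factor_pos[of "A y" _ p1 lam delta] have "K y = 0"
        by (metis less_irrefl mult_eq_0_iff)
      then show "K y * G x y = 0"
        by simp
    qed
  qed
  have Lp: "AE y in lebesgue. Lp_bound (ball_prob w r) p (\<lambda>x. K y * G x y) (h y)"
    using dich
  proof eventually_elim
    case (elim y)
    show ?case
    proof (cases "K y = 0")
      case True
      then show ?thesis
        using h(2) by (simp add: Lp_bound_AE_zero)
    next
      case False
      then obtain N where N: "heis_matrix_norm (A y) = ennreal N" "0 < N" "det (A y) \<noteq> 0"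
        and hy: "h y = K y * (kernel_factor p1 lam delta N \<bar>det (A y)\<bar> * E)"
        using elim by blast
      have "0 < K y"
        using False K0[of y] by simp
      then show ?thesis
        unfolding hy using bound[OF N] p
        by (subst Lp_bound_scaled_iff) (auto dest: Lp_bound_measurable)
    qed
  qed
  have "sets (ball_prob w r \<Otimes>\<^sub>M (lebesgue :: 'n heis measure)) = sets (lebesgue \<Otimes>\<^sub>M lebesgue)"
    by (intro sets_pair_measure_cong) (auto simp: ball_prob_def)
  then have meas: "(\<lambda>(x, y). K y * G x y) \<in> borel_measurable (ball_prob w r \<Otimes>\<^sub>M lebesgue)"
    by (subst measurable_cong_sets[OF _ refl]) (assumption, measurable)
  have "(\<integral>\<^sup>+y. ennreal (h y) \<partial>lebesgue) = (\<integral>\<^sup>+y. k y * ennreal E \<partial>lebesgue)"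
    using k_fin E by (intro nn_integral_cong_AE) (auto elim!: eventually_mono simp: h_def ennreal_mult less_top)
  also have "\<dots> = commutator_const p1 q lam delta \<Phi> A * ennreal E"
    unfolding c by (rule nn_integral_multc) measurable
  also have "\<dots> = ennreal (enn2real (commutator_const p1 q lam delta \<Phi> A) * E)"
    using fin E by (simp add: ennreal_mult)
  finally have H: "(\<integral>\<^sup>+y. ennreal (h y) \<partial>lebesgue) \<le> ennreal (enn2real (commutator_const p1 q lam delta \<Phi> A) * E)"
    by simp
  have KG0: "0 \<le> K y * G x y" for x y
    using K0 G0 by simp
  have "0 \<le> enn2real (commutator_const p1 q lam delta \<Phi> A) * E"
    using E by simp
  note M = Lp_bound_integral_Minkowski[OF sigma_finite_measure_axioms sigma_finite_lebesgue meas KG0 h zero p Lp H this]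
  show "AE x in ball_prob w r. (\<integral>\<^sup>+y. ennreal (K y * G x y) \<partial>lebesgue) < \<infinity>"
    and "Lp_bound (ball_prob w r) p (\<lambda>x. enn2real (\<integral>\<^sup>+y. ennreal (K y * G x y) \<partial>lebesgue))
      (enn2real (commutator_const p1 q lam delta \<Phi> A) * E)"
    by (fact M)+
qed

text \<open>
  The numbers \<open>F\<close> and \<open>B\<close> stand for upper bounds of the norms of \<open>f\<close>
  and \<open>b\<close>; strictly positive bounds exist even if a norm is \<open>0\<close>. In the proof,
  \<open>S\<close> and \<open>T\<close> are the absolute integrals without and with the difference of
  \<open>b\<close>. Where both are finite, so is the absolute integral for \<open>b f\<close>, by \<open>|b
  (A x)| \<le> |b x - b (A x)| + |b x|\<close>, and \<open>T\<close> dominates the commutator.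
\<close>

proposition commutator_Lp_bound:
  assumes p: "1 \<le> p" and p1: "1 \<le> p1" and p2: "1 \<le> p2" "q \<le> p2"
    and exp: "(1 / p1 + 1 / p2) * (q * (s / (s - 1))) \<le> 1 / p"
    and lam: "lam < 0" and delta: "1 < delta" "delta \<le> s"
    and w: "AE x in lebesgue. 0 < w x"
  obtains C where "0 < C"
    and "\<And>(\<Phi> :: 'n heis \<Rightarrow> complex) (A :: 'n heis \<Rightarrow> 'n heis_matrix) f b F B.
      \<lbrakk>\<Phi> \<in> borel_measurable lebesgue; A \<in> borel_measurable lebesgue;
      AE y in lebesgue. \<Phi> y \<noteq> 0 \<longrightarrow> det (A y) \<noteq> 0; commutator_const p1 q lam delta \<Phi> A < \<infinity>;
      f \<in> borel_measurable borel; b \<in> borel_measurable borel; locally_integrable b; 0 < F; 0 < B;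
      \<And>r. 0 < r \<Longrightarrow> Lp_bound (ball_prob w r) p1 (\<lambda>x. norm (f x :: complex)) (F * wvol r powr lam);
      \<And>r. 0 < r \<Longrightarrow> Lp_bound (ball_prob w r) p2 (\<lambda>x. norm (b x - cmean_on (heis_ball 0 r) b)) B\<rbrakk>
    \<Longrightarrow> (AE x in lebesgue. hausdorff_defined_at \<Phi> A f x \<and> hausdorff_defined_at \<Phi> A (\<lambda>z. b z * f z) x) \<and>
        hausdorff_commutator b \<Phi> A f \<in> borel_measurable lebesgue \<and>
        (\<forall>r>0. Lp_bound (ball_prob w r) p (\<lambda>x. norm (hausdorff_commutator b \<Phi> A f x))
          (C * enn2real (commutator_const p1 q lam delta \<Phi> A) * F * B * wvol r powr lam))"
proof -
  obtain C where C: "0 < C"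
    and sub: "\<And>(A :: 'n heis_matrix) N f b r F B. \<lbrakk>heis_matrix_norm A = ennreal N; 0 < N; det A \<noteq> 0; 0 < r;
      f \<in> borel_measurable borel; b \<in> borel_measurable borel; locally_integrable b;
      \<And>r. 0 < r \<Longrightarrow> Lp_bound (ball_prob w r) p1 (\<lambda>x. norm (f x :: complex)) (F * wvol r powr lam);
      \<And>r. 0 < r \<Longrightarrow> Lp_bound (ball_prob w r) p2 (\<lambda>x. norm (b x - cmean_on (heis_ball 0 r) b)) B\<rbrakk>
    \<Longrightarrow> Lp_bound (ball_prob w r) p (\<lambda>x. norm (f (A *v x)))
          (C * kernel_factor p1 lam delta N \<bar>det A\<bar> * F * wvol r powr lam) \<and>
        Lp_bound (ball_prob w r) p (\<lambda>x. norm (f (A *v x)) * norm (b x - b (A *v x)))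
          (C * kernel_factor p1 lam delta N \<bar>det A\<bar> * F * B * wvol r powr lam)"
    using substituted_Lp_bounds[OF p p1 p2 exp lam delta] by blast
  show ?thesis
  proof (rule that[OF C], intro conjI allI impI)
    fix \<Phi> :: "'n heis \<Rightarrow> complex" and A :: "'n heis \<Rightarrow> 'n heis_matrix" and f b :: "'n heis \<Rightarrow> complex" and F B :: real
    assume \<Phi> [measurable]: "\<Phi> \<in> borel_measurable lebesgue" and A [measurable]: "A \<in> borel_measurable lebesgue"
      and det: "AE y in lebesgue. \<Phi> y \<noteq> 0 \<longrightarrow> det (A y) \<noteq> 0"
      and fin: "commutator_const p1 q lam delta \<Phi> A < \<infinity>"
      and f [measurable]: "f \<in> borel_measurable borel" and b [measurable]: "b \<in> borel_measurable borel"
      and locb: "locally_integrable b" and F: "0 < F" and B: "0 < B"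
      and fF: "\<And>r. 0 < r \<Longrightarrow> Lp_bound (ball_prob w r) p1 (\<lambda>x. norm (f x)) (F * wvol r powr lam)"
      and bB: "\<And>r. 0 < r \<Longrightarrow> Lp_bound (ball_prob w r) p2 (\<lambda>x. norm (b x - cmean_on (heis_ball 0 r) b)) B"
    interpret L: sigma_finite_measure "lebesgue :: 'n heis measure"
      by (rule sigma_finite_lebesgue)
    let ?Q = "heis_dim TYPE('n)"
    let ?L2 = "(lebesgue :: 'n heis measure) \<Otimes>\<^sub>M (lebesgue :: 'n heis measure)"
    have [measurable]: "(heis_norm :: 'n heis \<Rightarrow> real) \<in> borel_measurable lebesgue" "b \<in> borel_measurable lebesgue"
      by (auto intro: lebesgue_measurable_of_borel)
    have [measurable]: "(\<lambda>p. fst p) \<in> borel_measurable ?L2"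
      by (rule measurable_compose[OF measurable_fst]) (simp add: lebesgue_measurable_of_borel)
    have [measurable]: "(\<lambda>p. A (snd p) *v fst p) \<in> borel_measurable ?L2"
      by measurable
    have [measurable]: "(\<lambda>y. A y *v x) \<in> borel_measurable lebesgue" for x
      by measurable
    define K where "K y = norm (\<Phi> y) / heis_norm y ^ ?Q" for y
    have K0: "0 \<le> K y" for y
      by (simp add: K_def)
    have [measurable]: "K \<in> borel_measurable lebesgue"
      unfolding K_def by measurable
    define S where "S x = (\<integral>\<^sup>+y. ennreal (K y * norm (f (A y *v x))) \<partial>lebesgue)" for x
    define T where "T x = (\<integral>\<^sup>+y. ennreal (K y * (norm (f (A y *v x)) * norm (b x - b (A y *v x)))) \<partial>lebesgue)" for x
    have SB: "AE x in ball_prob w r. S x < \<infinity>" if r: "0 < r" for r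
      unfolding S_def K_def
    proof (rule integral_kernel_Lp_bound(1)[OF \<Phi> A det fin p r, where E = "C * F * wvol r powr lam"])
      show "0 < C * F * wvol r powr lam"
        using C F wvol_pos[OF r] by simp
      show "(\<lambda>(x, y). norm (f (A y *v x))) \<in> borel_measurable ?L2"
        unfolding case_prod_beta by measurable
      show "Lp_bound (ball_prob w r) p (\<lambda>x. norm (f (A y *v x)))
          (kernel_factor p1 lam delta N \<bar>det (A y)\<bar> * (C * F * wvol r powr lam))"
        if "heis_matrix_norm (A y) = ennreal N" "0 < N" "det (A y) \<noteq> 0" for y N
        using sub[OF that r f b locb fF bB] by (simp add: mult_ac)
    qed simp
    have TB: "(AE x in ball_prob w r. T x < \<infinity>) \<and> Lp_bound (ball_prob w r) p (\<lambda>x. enn2real (T x))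
        (enn2real (commutator_const p1 q lam delta \<Phi> A) * (C * F * B * wvol r powr lam))" if r: "0 < r" for r
    proof -
      have E: "0 < C * F * B * wvol r powr lam"
        using C F B wvol_pos[OF r] by simp
      have meas: "(\<lambda>(x, y). norm (f (A y *v x)) * norm (b x - b (A y *v x))) \<in> borel_measurable ?L2"
        unfolding case_prod_beta by measurable
      have "Lp_bound (ball_prob w r) p (\<lambda>x. norm (f (A y *v x)) * norm (b x - b (A y *v x)))
          (kernel_factor p1 lam delta N \<bar>det (A y)\<bar> * (C * F * B * wvol r powr lam))"
        if "heis_matrix_norm (A y) = ennreal N" "0 < N" "det (A y) \<noteq> 0" for y N
        using sub[OF that r f b locb fF bB] by (simp add: mult_ac)
      note * = integral_kernel_Lp_bound[OF \<Phi> A det fin p r E meas _ this]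
      show ?thesis
        unfolding T_def K_def by (intro conjI *) auto
    qed
    have "AE x in lebesgue. S x < \<infinity>" "AE x in lebesgue. T x < \<infinity>"
      using SB TB by (auto intro!: AE_of_ball_prob[OF w])
    then have def: "AE x in lebesgue. T x < \<infinity> \<and>
        hausdorff_defined_at \<Phi> A f x \<and> hausdorff_defined_at \<Phi> A (\<lambda>z. b z * f z) x"
    proof eventually_elim
      fix x assume S: "S x < \<infinity>" and T: "T x < \<infinity>"
      have norm: "norm (hausdorff_integrand \<Phi> A g x y) = K y * norm (g (A y *v x))" for g y
        by (simp add: hausdorff_integrand_def K_def norm_mult norm_divide norm_power)
      have "(\<integral>\<^sup>+y. ennreal (norm (hausdorff_integrand \<Phi> A f x y)) \<partial>lebesgue) < \<infinity>"
        unfolding norm using S by (simp add: S_def)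
      then have 1: "hausdorff_defined_at \<Phi> A f x"
        unfolding hausdorff_defined_at_def
        by (intro integrableI_bounded) (simp_all add: hausdorff_integrand_def[abs_def])
      have "(\<integral>\<^sup>+y. ennreal (norm (hausdorff_integrand \<Phi> A (\<lambda>z. b z * f z) x y)) \<partial>lebesgue)
          \<le> (\<integral>\<^sup>+y. ennreal (K y * (norm (f (A y *v x)) * norm (b x - b (A y *v x))))
              + ennreal (norm (b x)) * ennreal (K y * norm (f (A y *v x))) \<partial>lebesgue)"
      proof (intro nn_integral_mono)
        fix y
        have "norm (b (A y *v x)) \<le> norm (b x - b (A y *v x)) + norm (b x)"
          by (metis add.commute norm_minus_commute norm_triangle_sub)
        then have "(K y * norm (f (A y *v x))) * norm (b (A y *v x))
            \<le> (K y * norm (f (A y *v x))) * (norm (b x - b (A y *v x)) + norm (b x))"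
          using K0 by (intro mult_left_mono) auto
        then have "norm (hausdorff_integrand \<Phi> A (\<lambda>z. b z * f z) x y)
            \<le> K y * (norm (f (A y *v x)) * norm (b x - b (A y *v x))) + norm (b x) * (K y * norm (f (A y *v x)))"
          unfolding norm by (simp add: norm_mult algebra_simps)
        then show "ennreal (norm (hausdorff_integrand \<Phi> A (\<lambda>z. b z * f z) x y))
            \<le> ennreal (K y * (norm (f (A y *v x)) * norm (b x - b (A y *v x))))
              + ennreal (norm (b x)) * ennreal (K y * norm (f (A y *v x)))"
          using K0 by (simp add: ennreal_mult[symmetric] ennreal_plus[symmetric] ennreal_leI del: ennreal_plus)
      qed
      also have "\<dots> = T x + ennreal (norm (b x)) * S x"
        unfolding T_def S_def by (subst nn_integral_add) (auto simp: nn_integral_cmult)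
      also have "\<dots> < \<infinity>"
        using S T by (simp add: ennreal_mult_less_top)
      finally have 2: "hausdorff_defined_at \<Phi> A (\<lambda>z. b z * f z) x"
        unfolding hausdorff_defined_at_def
        by (intro integrableI_bounded) (simp_all add: hausdorff_integrand_def[abs_def])
      show "T x < \<infinity> \<and> hausdorff_defined_at \<Phi> A f x \<and> hausdorff_defined_at \<Phi> A (\<lambda>z. b z * f z) x"
        using T 1 2 by blast
    qed
    then show "AE x in lebesgue. hausdorff_defined_at \<Phi> A f x \<and> hausdorff_defined_at \<Phi> A (\<lambda>z. b z * f z) x"
      by eventually_elim simp
    have op: "hausdorff_op \<Phi> A g \<in> borel_measurable lebesgue" if [measurable]: "g \<in> borel_measurable borel" for g
    proof -
      have "(\<lambda>(x, y). hausdorff_integrand \<Phi> A g x y) \<in> borel_measurable ?L2"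
        unfolding hausdorff_integrand_def case_prod_beta by measurable
      then show ?thesis
        unfolding hausdorff_op_def[abs_def] by (rule L.borel_measurable_lebesgue_integral)
    qed
    note [measurable] = op[OF f]
    have [measurable]: "hausdorff_op \<Phi> A (\<lambda>z. b z * f z) \<in> borel_measurable lebesgue"
      by (rule op) measurable
    show comm [measurable]: "hausdorff_commutator b \<Phi> A f \<in> borel_measurable lebesgue"
      unfolding hausdorff_commutator_def[abs_def] by measurable
    fix r :: real assume r: "0 < r"
    have le: "AE x in lebesgue. norm (hausdorff_commutator b \<Phi> A f x) \<le> enn2real (T x)"
      using def
    proof eventually_elim
      fix x assume x: "T x < \<infinity> \<and> hausdorff_defined_at \<Phi> A f x \<and> hausdorff_defined_at \<Phi> A (\<lambda>z. b z * f z) x"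
      let ?g = "\<lambda>y. hausdorff_integrand \<Phi> A f x y * (b x - b (A y *v x))"
      have "integrable lebesgue (\<lambda>y. b x * hausdorff_integrand \<Phi> A f x y - hausdorff_integrand \<Phi> A (\<lambda>z. b z * f z) x y)"
        using x by (auto simp: hausdorff_defined_at_def)
      moreover have "(\<lambda>y. b x * hausdorff_integrand \<Phi> A f x y - hausdorff_integrand \<Phi> A (\<lambda>z. b z * f z) x y) = ?g"
        by (auto simp: hausdorff_integrand_def algebra_simps diff_divide_distrib)
      ultimately have "integrable lebesgue ?g"
        by simp
      then have "ennreal (norm (LINT y|lebesgue. ?g y)) \<le> (\<integral>\<^sup>+y. ennreal (norm (?g y)) \<partial>lebesgue)"
        by (rule integral_norm_bound_ennreal)
      also have "\<dots> = T x"
        unfolding T_def by (simp add: hausdorff_integrand_def K_def norm_mult norm_divide norm_power mult_ac)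
      finally have "ennreal (norm (hausdorff_commutator b \<Phi> A f x)) \<le> T x"
        using x by (simp add: hausdorff_commutator_eq_integral)
      then show "norm (hausdorff_commutator b \<Phi> A f x) \<le> enn2real (T x)"
        using x enn2real_mono by fastforce
    qed
    have "Lp_bound (ball_prob w r) p (\<lambda>x. norm (hausdorff_commutator b \<Phi> A f x))
        (enn2real (commutator_const p1 q lam delta \<Phi> A) * (C * F * B * wvol r powr lam))"
    proof (rule Lp_bound_AE_mono[OF conjunct2[OF TB[OF r]]])
      show "AE x in ball_prob w r. \<bar>norm (hausdorff_commutator b \<Phi> A f x)\<bar> \<le> \<bar>enn2real (T x)\<bar>"
        unfolding AE_ball_prob_iff[OF r w] using le by eventually_elim simp
    qed (use p in auto)
    then show "Lp_bound (ball_prob w r) p (\<lambda>x. norm (hausdorff_commutator b \<Phi> A f x))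
        (C * enn2real (commutator_const p1 q lam delta \<Phi> A) * F * B * wvol r powr lam)"
      by (simp add: mult_ac)
  qed
qed

end

section \<open>The commutator estimate\<close>

text \<open>
  For \<open>K < a\<close> and \<open>s > 1\<close>, the inequality \<open>K s / (s - 1) \<le> a\<close>
  amounts to \<open>a / (a - K) \<le> s\<close>. So two lower bounds are imposed on \<open>s\<close>, and
  the assumptions say that both lie strictly below the critical index.
\<close>

lemma exists_reverse_hoelder_exponent:
  fixes w :: "'n::finite heis \<Rightarrow> real"
  assumes delta: "1 < delta" "ereal delta < rh_index w" and "0 < K"
    and K: "K * conj_exponent (rh_index w) < a"
  obtains s where "delta \<le> s" "reverse_hoelder s w" "K * (s / (s - 1)) \<le> a"
proof -
  define s0 where "s0 = max delta (a / (a - K))"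
  have "K < a \<and> ereal s0 < rh_index w"
  proof (cases "rh_index w")
    case (real \<rho>)
    then have \<rho>: "delta < \<rho>" "1 < \<rho>"
      using delta by auto
    have "K * (\<rho> / (\<rho> - 1)) < a"
      using K real by (simp add: conj_exponent_def)
    then have *: "K * \<rho> < a * (\<rho> - 1)"
      using \<rho> by (simp add: field_simps)
    have "K * (\<rho> - 1) < K * \<rho>"
      using \<open>0 < K\<close> by simp
    with * have "K * (\<rho> - 1) < a * (\<rho> - 1)"
      by linarith
    then have "K < a"
      using \<rho> by simp
    moreover have "a / (a - K) < \<rho>"
      using * \<open>K < a\<close> by (simp add: divide_less_eq algebra_simps)
    ultimately show ?thesis
      using \<rho> real by (simp add: s0_def)
  next
    case PInf
    then show ?thesis
      using K by (simp add: conj_exponent_def)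
  next
    case MInf
    then show ?thesis
      using delta by simp
  qed
  then obtain s where s: "s0 < s" "reverse_hoelder s w" and "K < a"
    unfolding rh_index_def less_Sup_iff by auto
  have "1 < s"
    using s delta by (simp add: s0_def)
  have "a / (a - K) < s"
    using s by (simp add: s0_def)
  then have "K * s \<le> a * (s - 1)"
    using \<open>K < a\<close> by (simp add: divide_less_eq algebra_simps)
  then have "K * (s / (s - 1)) \<le> a"
    using \<open>1 < s\<close> by (simp add: field_simps)
  then show ?thesis
    using s by (intro that[of s]) (auto simp: s0_def)
qed

lemma cmean_on_AE_cong:
  fixes b :: "'a::euclidean_space \<Rightarrow> complex"
  assumes "AE x in lebesgue. b x = b' x"
  shows "cmean_on S b = cmean_on S b'"
proof -
  have "AE x in lebesgue. indicator S x *\<^sub>R b x = indicator S x *\<^sub>R b' x"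
    using assms by eventually_elim simp
  then show ?thesis
    unfolding cmean_on_def set_lebesgue_integral_def by (simp add: lebesgue_integral_AE_cong(2))
qed

lemma locally_integrable_AE_cong:
  fixes b :: "'a::euclidean_space \<Rightarrow> complex"
  assumes "AE x in lebesgue. b x = b' x" "locally_integrable b"
  shows "locally_integrable b'"
proof -
  have "AE x in lebesgue. indicator S x *\<^sub>R b x = indicator S x *\<^sub>R b' x" for S
    using assms(1) by eventually_elim simp
  from lebesgue_integral_AE_cong(1)[OF this] show ?thesis
    using assms(2) unfolding locally_integrable_def set_integrable_def by blast
qed

context comparable_weight
begin

lemma AE_eq_0_of_Lp_bound:
  assumes w: "AE x in lebesgue. 0 < w x" and p: "0 < p"
    and f: "\<And>r. 0 < r \<Longrightarrow> Lp_bound (ball_prob w r) p (\<lambda>x. norm (f x :: complex)) 0"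
  shows "AE x in lebesgue. f x = 0"
proof (rule AE_of_ball_prob[OF w])
  show "AE x in ball_prob w r. f x = 0" if "0 < r" for r
    using Lp_bound_zeroD[OF f[OF that] p] by simp
qed

text \<open>
  Two centred balls meet in the smaller one, which is not a null set, so the constants of all balls agree.
\<close>

lemma AE_const_of_oscillation_0:
  assumes w: "AE x in lebesgue. 0 < w x" and p: "0 < p"
    and b: "\<And>r. 0 < r \<Longrightarrow> Lp_bound (ball_prob w r) p (\<lambda>x. norm (b x - \<beta> r :: complex)) 0"
  shows "AE x in lebesgue. b x = \<beta> 1"
proof (rule AE_of_ball_prob[OF w])
  have b': "AE x in lebesgue. x \<in> heis_ball 0 r \<longrightarrow> b x = \<beta> r" if "0 < r" for r
    using Lp_bound_zeroD[OF b[OF that] p] by (simp add: AE_ball_prob_iff[OF that w])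
  fix r :: real assume r: "0 < r"
  define t where "t = min 1 r"
  have t: "0 < t" "t \<le> 1" "t \<le> r"
    using r by (auto simp: t_def)
  have "AE x in ball_prob w t. \<beta> r = \<beta> 1"
    unfolding AE_ball_prob_iff[OF t(1) w] using b'[OF r] b'[OF zero_less_one]
    by eventually_elim (use t heis_ball_0_mono[of t 1] heis_ball_0_mono[of t r] in auto)
  moreover have "ae_filter (ball_prob w t) \<noteq> bot"
    using emeasure_ball_prob[OF normalizable_ball[OF t(1)]] by (simp add: ae_filter_eq_bot_iff)
  ultimately have "\<beta> r = \<beta> 1"
    by (simp add: eventually_const_iff)
  then show "AE x in ball_prob w r. b x = \<beta> 1"
    using b'[OF r] by (simp add: AE_ball_prob_iff[OF r w])
qed

lemma Lp_loc_of_Lp_bound: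
  assumes p: "0 < p" and f: "f \<in> borel_measurable lebesgue"
    and bound: "\<And>r. 0 < r \<Longrightarrow> Lp_bound (ball_prob w r) p (\<lambda>x. norm (f x)) (X r)"
  shows "f \<in> Lp_loc p w"
proof -
  have "(\<integral>\<^sup>+x\<in>S. ennreal (norm (f x) powr p * w x) \<partial>lebesgue) < \<infinity>" if S: "compact S" for S
  proof -
    obtain r where r: "0 < r" "S \<subseteq> heis_ball 0 r"
      using compact_subset_heis_ball_0[OF S] by blast
    have "(\<integral>\<^sup>+x\<in>S. ennreal (norm (f x) powr p * w x) \<partial>lebesgue)
        \<le> (\<integral>\<^sup>+x\<in>heis_ball 0 r. ennreal (norm (f x) powr p * w x) \<partial>lebesgue)"
      using r by (intro nn_integral_mono) (auto simp: indicator_def)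
    also have "\<dots> \<le> ennreal (wvol r * X r powr p)"
      using bound[OF r(1)] by (simp add: Lp_bound_w_iff[OF r(1) p])
    also have "\<dots> < \<infinity>"
      by simp
    finally show ?thesis .
  qed
  then show ?thesis
    using f by (simp add: Lp_loc_def)
qed

end

theorem theorem1p2:
  fixes p p1 p2 q lam delta :: real
    and w :: "'n::finite heis \<Rightarrow> real"
  assumes "1 \<le> p" and "1 \<le> p1" and "1 \<le> p2" and "1 \<le> q"
    and "- 1 / p1 \<le> lam" and "lam < 0"
    and "muckenhoupt q w"
    and "1 / p > (1 / p1 + 1 / p2) * q * conj_exponent (rh_index w)"
    and "q \<le> p2"
    and "1 < delta" and "ereal delta < rh_index w"
  shows "\<exists>C::real. C > 0 \<and>
    (\<forall>(\<Phi> :: 'n heis \<Rightarrow> complex) (A :: 'n heis \<Rightarrow> 'n heis_matrix)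
      (f :: 'n heis \<Rightarrow> complex) (b :: 'n heis \<Rightarrow> complex).
        locally_integrable \<Phi> \<longrightarrow>
        A \<in> borel_measurable lebesgue \<longrightarrow>
        (AE y in lebesgue. \<Phi> y \<noteq> 0 \<longrightarrow> det (A y) \<noteq> 0) \<longrightarrow>
        f \<in> central_morrey p1 lam w \<longrightarrow>
        locally_integrable b \<longrightarrow>
        b \<in> central_bmo p2 w \<longrightarrow>
        (commutator_const p1 q lam delta \<Phi> A < \<infinity> \<longrightarrow>
          (AE x in lebesgue. hausdorff_defined_at \<Phi> A f x \<and>
             hausdorff_defined_at \<Phi> A (\<lambda>z. b z * f z) x) \<and>
          hausdorff_commutator b \<Phi> A f \<in> central_morrey p lam w) \<and>
        morrey_norm p lam w (hausdorff_commutator b \<Phi> A f)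
          \<le> ennreal C * commutator_const p1 q lam delta \<Phi> A
              * morrey_norm p1 lam w f * cmo_norm p2 w b)"
proof -
  note p = assms(1) and p1 = assms(2) and p2 = assms(3) and q = assms(4) and lam = assms(6)
    and w = assms(7) and exp = assms(8) and qp2 = assms(9) and delta = assms(10,11)
  have wt: "weight w"
    using w by (simp add: muckenhoupt_def)
  have pos: "AE x in lebesgue. 0 < w x"
    by (rule muckenhoupt_positive[OF q w])
  have "0 < (1 / p1 + 1 / p2) * q"
    using p1 p2 q by (intro mult_pos_pos add_pos_pos) auto
  then obtain s where rs: "delta \<le> s" "reverse_hoelder s w" "(1 / p1 + 1 / p2) * q * (s / (s - 1)) \<le> 1 / p"
    using exists_reverse_hoelder_exponent[OF delta _ exp] by blast
  have s1: "1 < s"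
    using rs delta by simp
  note bw = muckenhoupt_normalizable_ball[OF q w]
  obtain Ca where Ca: "0 < Ca"
    "\<And>r g X. 0 < r \<Longrightarrow> Lp_bound (ball_prob w r) q g X \<Longrightarrow> Lp_bound (ball_mean r) 1 g (Ca * X)"
    using muckenhoupt_Lp_bound[OF q w] by blast
  obtain Cr where Cr: "0 < Cr"
    "\<And>r g X. 0 < r \<Longrightarrow> Lp_bound (ball_mean r) (s / (s - 1)) g X \<Longrightarrow> Lp_bound (ball_prob w r) 1 g (Cr * X)"
    using reverse_hoelder_Lp_bound[OF s1 rs(2) bw] by blast
  interpret comparable_weight w q s Ca Cr "real (heis_dim TYPE('n))"
    "\<lambda>r. measure lebesgue (heis_ball 0 r :: 'n heis set)"
    by unfold_locales (use bw q s1 Ca Cr in auto)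
  have exp': "(1 / p1 + 1 / p2) * (q * (s / (s - 1))) \<le> 1 / p"
    using rs(3) by (simp only: mult.assoc)
  obtain C where C: "0 < C"
    and main: "\<And>(\<Phi> :: 'n heis \<Rightarrow> complex) (A :: 'n heis \<Rightarrow> 'n heis_matrix) f b F B.
      \<lbrakk>\<Phi> \<in> borel_measurable lebesgue; A \<in> borel_measurable lebesgue;
      AE y in lebesgue. \<Phi> y \<noteq> 0 \<longrightarrow> det (A y) \<noteq> 0; commutator_const p1 q lam delta \<Phi> A < \<infinity>;
      f \<in> borel_measurable borel; b \<in> borel_measurable borel; locally_integrable b; 0 < F; 0 < B;
      \<And>r. 0 < r \<Longrightarrow> Lp_bound (ball_prob w r) p1 (\<lambda>x. norm (f x :: complex)) (F * wvol r powr lam);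
      \<And>r. 0 < r \<Longrightarrow> Lp_bound (ball_prob w r) p2 (\<lambda>x. norm (b x - cmean_on (heis_ball 0 r) b)) B\<rbrakk>
    \<Longrightarrow> (AE x in lebesgue. hausdorff_defined_at \<Phi> A f x \<and> hausdorff_defined_at \<Phi> A (\<lambda>z. b z * f z) x) \<and>
        hausdorff_commutator b \<Phi> A f \<in> borel_measurable lebesgue \<and>
        (\<forall>r>0. Lp_bound (ball_prob w r) p (\<lambda>x. norm (hausdorff_commutator b \<Phi> A f x))
          (C * enn2real (commutator_const p1 q lam delta \<Phi> A) * F * B * wvol r powr lam))"
    using commutator_Lp_bound[OF p p1 p2 qp2 exp' lam delta(1) rs(1) pos] by blast
  show ?thesis
  proof (intro exI[of _ C] conjI allI impI C)
    fix \<Phi> :: "'n heis \<Rightarrow> complex" and A :: "'n heis \<Rightarrow> 'n heis_matrix" and f b :: "'n heis \<Rightarrow> complex"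
    assume "locally_integrable \<Phi>" and A: "A \<in> borel_measurable lebesgue"
      and det: "AE y in lebesgue. \<Phi> y \<noteq> 0 \<longrightarrow> det (A y) \<noteq> 0"
      and f: "f \<in> central_morrey p1 lam w" and b: "locally_integrable b" "b \<in> central_bmo p2 w"
    have \<Phi>: "\<Phi> \<in> borel_measurable lebesgue"
      by (rule locally_integrable_measurable) fact
    define c2 where "c2 = commutator_const p1 q lam delta \<Phi> A"
    have fm: "f \<in> borel_measurable lebesgue" and bm: "b \<in> borel_measurable lebesgue"
      using f b by (auto simp: central_morrey_def central_bmo_def Lp_loc_def)
    obtain F0 where F0: "morrey_norm p1 lam w f = ennreal F0" "0 \<le> F0"
      using f by (cases "morrey_norm p1 lam w f") (auto simp: central_morrey_def)
    obtain B0 where B0: "cmo_norm p2 w b = ennreal B0" "0 \<le> B0"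
      using b by (cases "cmo_norm p2 w b") (auto simp: central_bmo_def)
    have fF: "Lp_bound (ball_prob w r) p1 (\<lambda>x. norm (f x)) (F0 * wvol r powr lam)" if "0 < r" for r
      using morrey_norm_le_iff[OF p1 fm F0(2), of lam] F0 that by simp
    have bB: "Lp_bound (ball_prob w r) p2 (\<lambda>x. norm (b x - cmean_on (heis_ball 0 r) b)) B0" if "0 < r" for r
      using cmo_norm_le_iff[OF p2 bm B0(2)] B0 that by simp
    obtain f' where f': "f' \<in> borel_measurable borel" "AE x in lebesgue. f x = f' x"
      using borel_version[OF fm] by blast
    obtain b' where b': "b' \<in> borel_measurable borel" "AE x in lebesgue. b x = b' x"
      using borel_version[OF bm] by blast
    note cong = hausdorff_commutator_AE_cong[OF A det f'(2) b'(2)]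
    have bound: "(AE x in lebesgue. hausdorff_defined_at \<Phi> A f x \<and> hausdorff_defined_at \<Phi> A (\<lambda>z. b z * f z) x) \<and>
        hausdorff_commutator b \<Phi> A f \<in> borel_measurable lebesgue \<and>
        (\<forall>r>0. Lp_bound (ball_prob w r) p (\<lambda>x. norm (hausdorff_commutator b \<Phi> A f x))
          (C * enn2real c2 * F * B * wvol r powr lam))"
      if c2: "c2 < \<infinity>" and F: "0 < F" "F0 \<le> F" and B: "0 < B" "B0 \<le> B" for F B
    proof -
      have "Lp_bound (ball_prob w r) p1 (\<lambda>x. norm (f' x)) (F * wvol r powr lam)" if r: "0 < r" for r
      proof (rule Lp_bound_AE_mono)
        show "Lp_bound (ball_prob w r) p1 (\<lambda>x. norm (f x)) (F * wvol r powr lam)"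
          by (rule Lp_bound_mono[OF fF[OF r]]) (use F p1 in \<open>auto intro!: mult_right_mono\<close>)
        show "AE x in ball_prob w r. \<bar>norm (f' x)\<bar> \<le> \<bar>norm (f x)\<bar>"
          unfolding AE_ball_prob_iff[OF r pos] using f'(2) by eventually_elim simp
      qed (use p1 f'(1) in \<open>auto intro: lebesgue_measurable_of_borel\<close>)
      moreover have "Lp_bound (ball_prob w r) p2 (\<lambda>x. norm (b' x - cmean_on (heis_ball 0 r) b')) B" if r: "0 < r" for r
      proof (rule Lp_bound_AE_mono)
        show "Lp_bound (ball_prob w r) p2 (\<lambda>x. norm (b x - cmean_on (heis_ball 0 r) b)) B"
          by (rule Lp_bound_mono[OF bB[OF r]]) (use B p2 in auto)
        show "AE x in ball_prob w r. \<bar>norm (b' x - cmean_on (heis_ball 0 r) b')\<bar>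
            \<le> \<bar>norm (b x - cmean_on (heis_ball 0 r) b)\<bar>"
          unfolding AE_ball_prob_iff[OF r pos] cmean_on_AE_cong[OF b'(2)] using b'(2)
          by eventually_elim simp
      qed (use p2 b'(1) in \<open>auto intro!: lebesgue_measurable_of_borel\<close>)
      ultimately have M: "(AE x in lebesgue. hausdorff_defined_at \<Phi> A f' x \<and> hausdorff_defined_at \<Phi> A (\<lambda>z. b' z * f' z) x) \<and>
          hausdorff_commutator b' \<Phi> A f' \<in> borel_measurable lebesgue \<and>
          (\<forall>r>0. Lp_bound (ball_prob w r) p (\<lambda>x. norm (hausdorff_commutator b' \<Phi> A f' x))
            (C * enn2real c2 * F * B * wvol r powr lam))"
        unfolding c2_def
        by (intro main[OF \<Phi> A det c2[unfolded c2_def] f'(1) b'(1) locally_integrable_AE_cong[OF b'(2) b(1)] F(1) B(1)])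
      have "AE z in lebesgue. b z * f z = b' z * f' z"
        using f'(2) b'(2) by eventually_elim simp
      from conjunct1[OF M] hausdorff_op_AE_cong[OF A det f'(2)] hausdorff_op_AE_cong[OF A det this]
      have 1: "AE x in lebesgue. hausdorff_defined_at \<Phi> A f x \<and> hausdorff_defined_at \<Phi> A (\<lambda>z. b z * f z) x"
        by eventually_elim simp
      have "AE x in lebesgue. hausdorff_commutator b' \<Phi> A f' x = hausdorff_commutator b \<Phi> A f x"
        using cong by eventually_elim simp
      then have 2: "hausdorff_commutator b \<Phi> A f \<in> borel_measurable lebesgue"
        using M borel_measurable_AE by blast
      have "Lp_bound (ball_prob w r) p (\<lambda>x. norm (hausdorff_commutator b \<Phi> A f x))
          (C * enn2real c2 * F * B * wvol r powr lam)" if r: "0 < r" for r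
      proof (rule Lp_bound_AE_mono)
        show "Lp_bound (ball_prob w r) p (\<lambda>x. norm (hausdorff_commutator b' \<Phi> A f' x))
          (C * enn2real c2 * F * B * wvol r powr lam)"
          using M r by blast
        show "AE x in ball_prob w r. \<bar>norm (hausdorff_commutator b \<Phi> A f x)\<bar> \<le> \<bar>norm (hausdorff_commutator b' \<Phi> A f' x)\<bar>"
          unfolding AE_ball_prob_iff[OF r pos] using cong by eventually_elim simp
      qed (use p 2 in auto)
      with 1 2 show ?thesis
        by blast
    qed
    have le: "morrey_norm p lam w (hausdorff_commutator b \<Phi> A f) \<le> ennreal (C * enn2real c2 * F * B)"
      if "c2 < \<infinity>" "0 < F" "F0 \<le> F" "0 < B" "B0 \<le> B" for F B
      using bound[OF that] C that by (subst morrey_norm_le_iff[OF p]) auto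
    have *: "(AE x in lebesgue. hausdorff_defined_at \<Phi> A f x \<and> hausdorff_defined_at \<Phi> A (\<lambda>z. b z * f z) x) \<and>
        hausdorff_commutator b \<Phi> A f \<in> central_morrey p lam w" if c2: "c2 < \<infinity>"
    proof -
      note bd = bound[OF c2, of "F0 + 1" "B0 + 1"]
      have "hausdorff_commutator b \<Phi> A f \<in> Lp_loc p w"
        using bd F0 B0 p by (intro Lp_loc_of_Lp_bound) auto
      moreover have "morrey_norm p lam w (hausdorff_commutator b \<Phi> A f) < \<infinity>"
        using le[OF c2, of "F0 + 1" "B0 + 1"] F0 B0 by (auto simp: le_less_trans)
      ultimately show ?thesis
        using bd F0 B0 by (simp add: central_morrey_def)
    qed
    then show "AE x in lebesgue. hausdorff_defined_at \<Phi> A f x \<and> hausdorff_defined_at \<Phi> A (\<lambda>z. b z * f z) x"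
      and "hausdorff_commutator b \<Phi> A f \<in> central_morrey p lam w"
      if "commutator_const p1 q lam delta \<Phi> A < \<infinity>"
      using that by (auto simp: c2_def)
    \<comment> \<open>If \<open>F0\<close> or \<open>B0\<close> is \<open>0\<close>, the right-hand side is \<open>0\<close> even for \<open>c2 = \<infinity>\<close>.\<close>
    have "morrey_norm p lam w (hausdorff_commutator b \<Phi> A f) \<le> ennreal C * c2 * ennreal F0 * ennreal B0"
    proof (cases "F0 = 0 \<or> B0 = 0")
      case True
      have "(AE x in lebesgue. f x = 0) \<or> (AE x in lebesgue. b x = cmean_on (heis_ball 0 1) b)"
        using True
      proof
        assume "F0 = 0"
        then have "AE x in lebesgue. f x = 0"
          using fF p1 by (intro AE_eq_0_of_Lp_bound[OF pos, of p1]) auto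
        then show ?thesis ..
      next
        assume "B0 = 0"
        then have "AE x in lebesgue. b x = cmean_on (heis_ball 0 1) b"
          using bB p2 by (intro AE_const_of_oscillation_0[OF pos, of p2]) auto
        then show ?thesis ..
      qed
      from hausdorff_commutator_const[OF A det this]
      have zero: "AE x in lebesgue. hausdorff_commutator b \<Phi> A f x = 0" .
      then have "AE x in lebesgue. 0 = hausdorff_commutator b \<Phi> A f x"
        by eventually_elim simp
      then have meas: "hausdorff_commutator b \<Phi> A f \<in> borel_measurable lebesgue"
        by (rule borel_measurable_AE[rotated]) simp
      have "Lp_bound (ball_prob w r) p (\<lambda>x. norm (hausdorff_commutator b \<Phi> A f x)) (0 * wvol r powr lam)" if "0 < r" for r
      proof (rule Lp_bound_AE_zero)
        show "AE x in ball_prob w r. norm (hausdorff_commutator b \<Phi> A f x) = 0"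
          unfolding AE_ball_prob_iff[OF that pos] using zero by eventually_elim simp
      qed (use meas in auto)
      then have "morrey_norm p lam w (hausdorff_commutator b \<Phi> A f) \<le> ennreal 0"
        by (subst morrey_norm_le_iff[OF p meas]) auto
      then show ?thesis
        by simp
    next
      case False
      then have pos0: "0 < F0" "0 < B0"
        using F0 B0 by auto
      show ?thesis
      proof (cases "c2 = \<infinity>")
        case True
        then show ?thesis
          using pos0 C by (simp add: ennreal_mult_top ennreal_top_mult)
      next
        case False
        then have c2: "c2 < \<infinity>"
          by (simp add: less_top)
        have "ennreal (C * enn2real c2 * F0 * B0) = ennreal C * c2 * ennreal F0 * ennreal B0"
          using C F0 B0 c2 by (simp add: ennreal_mult)
        then show ?thesis
          using le[OF c2, of F0 B0] pos0 by simp
      qed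
    qed
    then show "morrey_norm p lam w (hausdorff_commutator b \<Phi> A f)
        \<le> ennreal C * commutator_const p1 q lam delta \<Phi> A * morrey_norm p1 lam w f * cmo_norm p2 w b"
      unfolding F0(1) B0(1) c2_def .
  qed
qed

end
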